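(* Let $k$ be a perfect field of characteristic $p>0$, $W=W(k)$ and $R=W[[q-1]]$. The category of weakly nilpotent finite free $\Gamma$-modules on $R$ that become trivial modulo $q-1$ is isomorphic to the category of weakly nilpotent finite free $\nabla_{\mathbb{\Delta}}$-modules on $R$.
   Context: For $n\in\mathbb N\cup\{\infty\}$, $K_n:=\mathrm{Frac}(W)[\mu_{p^n}]$, and $\Gamma:=\mathrm{Gal}(K_\infty/K_1)$, which acts continuously and $W$-linearly on $R$ by $g(q)=q^{\chi(g)}$ with $\chi$ the cyclotomic character. A $\Gamma$-module on $R$ is an $R$-module with a continuous semilinear action of $\Gamma$ ($R$-modules carry the $(p,q-1)$-adic topology); "becomes trivial modulo $q-1$" means that $\Gamma$ acts trivially on $M/(q-1)M$. Let $\gamma\in\Gamma$ denote the element with $\chi(\gamma)=p+1$, so $\gamma(q)=q^{p+1}$ on $R$. With $(p)_q=1+q+\cdots+q^{p-1}$, a $\nabla_{\mathbb{\Delta}}$-module on $R$ is an $R$-module $M$ with a $W$-linear map $\partial_{M,\mathbb{\Delta}}:M\to M$ such that $\partial_{M,\mathbb{\Delta}}(qs)=(p)_qs+q^{p+1}\partial_{M,\mathbb{\Delta}}(s)$ for all $s\in M$; morphisms are $R$-linear maps commuting with $\partial_{\mathbb{\Delta}}$. A finite $\nabla_{\mathbb{\Delta}}$-module is weakly nilpotent if $\partial_{M,\mathbb{\Delta}}$ ($p$ odd), resp. $\partial_{M,\mathbb{\Delta}}^2-\partial_{M,\mathbb{\Delta}}$ ($p=2$), is nilpotent modulo $(p,q-1)$.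 A $(q-1)$-torsion-free $\Gamma$-module $M$ trivial modulo $q-1$ has an associated $\nabla_{\mathbb{\Delta}}$-module structure $\partial_{M,\mathbb{\Delta}}=(\gamma_M-\mathrm{Id}_M)/(q^2-q)$, where $\gamma_M$ is the action of $\gamma$ on $M$; $M$ is called weakly nilpotent if this $\nabla_{\mathbb{\Delta}}$-module is.
   Formalization: For p = 2 the group Γ is taken to be the closed subgroup of Gal(K_∞/K_1) topologically generated by γ, since with the full Galois group the associated functor is not surjective (e.g. M = Re with ∂e = 2e); for odd p, Γ is Gal(K_∞/K_1). *)

theory Defs
  imports
    "HOL-Analysis.Analysis"
    "HOL-Algebra.Algebra"
    "HOL-Algebra.Algebraic_Closure_Type"
    "HOL-Computational_Algebra.Computational_Algebra"
    "HOL-Library.Poly_Mapping"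
    "HOL-Library.Extended_Nat"
begin

section \<open>Integer polynomials in countably many variables\<close>

type_synonym int_mpoly = "(nat \<Rightarrow>\<^sub>0 nat) \<Rightarrow>\<^sub>0 int"

definition mvar :: "nat \<Rightarrow> int_mpoly" where
  "mvar i = Poly_Mapping.single (Poly_Mapping.single i 1) 1"

definition meval_monom :: "(nat \<Rightarrow> 'a::comm_ring_1) \<Rightarrow> (nat \<Rightarrow>\<^sub>0 nat) \<Rightarrow> 'a" where
  "meval_monom \<phi> m = (\<Prod>i\<in>Poly_Mapping.keys m. \<phi> i ^ Poly_Mapping.lookup m i)"

definition meval :: "(nat \<Rightarrow> 'a::comm_ring_1) \<Rightarrow> int_mpoly \<Rightarrow> 'a" where
  "meval \<phi> f = (\<Sum>m\<in>Poly_Mapping.keys f. of_int (Poly_Mapping.lookup f m) * meval_monom \<phi> m)"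

lemma meval_monom_superset:
  assumes "finite A" "Poly_Mapping.keys m \<subseteq> A"
  shows "meval_monom \<phi> m = (\<Prod>i\<in>A. \<phi> i ^ Poly_Mapping.lookup m i)"
  unfolding meval_monom_def
  by (rule prod.mono_neutral_left) (use assms in \<open>auto simp: in_keys_iff\<close>)

lemma meval_monom_add: "meval_monom \<phi> (m + n) = meval_monom \<phi> m * meval_monom \<phi> n"
proof -
  have f: "finite (Poly_Mapping.keys m \<union> Poly_Mapping.keys n)" by simp
  show ?thesis
    using keys_add[of m n]
    by (simp add: meval_monom_superset[OF f] lookup_add power_add prod.distrib)
qed

lemma meval_superset:
  assumes "finite A" "Poly_Mapping.keys f \<subseteq> A"
  shows "meval \<phi> f = (\<Sum>m\<in>A. of_int (Poly_Mapping.lookup f m) * meval_monom \<phi> m)"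
  unfolding meval_def
  by (rule sum.mono_neutral_left) (use assms in \<open>auto simp: in_keys_iff\<close>)

lemma meval_add: "meval \<phi> (f + g) = meval \<phi> f + meval \<phi> g"
proof -
  have f: "finite (Poly_Mapping.keys f \<union> Poly_Mapping.keys g)" by simp
  show ?thesis
    using keys_add[of f g]
    by (simp add: meval_superset[OF f] lookup_add sum.distrib algebra_simps)
qed

lemma meval_0 [simp]: "meval \<phi> 0 = 0"
  by (simp add: meval_def)

lemma meval_monom_0 [simp]: "meval_monom \<phi> 0 = 1"
  by (simp add: meval_monom_def)

lemma meval_single: "meval \<phi> (Poly_Mapping.single m c) = of_int c * meval_monom \<phi> m"
  by (cases "c = 0") (auto simp: meval_def)

lemma meval_1 [simp]: "meval \<phi> 1 = 1"
  using meval_single[of \<phi> 0 1] by simp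

lemma meval_sum: "meval \<phi> (sum f A) = (\<Sum>x\<in>A. meval \<phi> (f x))"
  by (induction A rule: infinite_finite_induct) (auto simp: meval_add)

lemma poly_mapping_sum_single: "f = (\<Sum>m\<in>Poly_Mapping.keys f. Poly_Mapping.single m (Poly_Mapping.lookup f m))"
proof (rule poly_mapping_eqI)
  fix k
  have "Poly_Mapping.lookup (\<Sum>m\<in>Poly_Mapping.keys f. Poly_Mapping.single m (Poly_Mapping.lookup f m)) k
      = (\<Sum>m\<in>Poly_Mapping.keys f. if m = k then Poly_Mapping.lookup f m else 0)"
    by (auto simp: lookup_sum lookup_single when_def intro!: sum.cong)
  also have "\<dots> = Poly_Mapping.lookup f k"
    by (auto simp: in_keys_iff)
  finally show "Poly_Mapping.lookup f k = Poly_Mapping.lookup (\<Sum>m\<in>Poly_Mapping.keys f. Poly_Mapping.single m (Poly_Mapping.lookup f m)) k" ..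
qed

lemma meval_mult: "meval \<phi> (f * g) = meval \<phi> f * meval \<phi> g"
proof -
  let ?l = Poly_Mapping.lookup
  have "f * g = (\<Sum>m\<in>Poly_Mapping.keys f. Poly_Mapping.single m (?l f m)) *
      (\<Sum>n\<in>Poly_Mapping.keys g. Poly_Mapping.single n (?l g n))"
    by (simp flip: poly_mapping_sum_single)
  also have "\<dots> = (\<Sum>m\<in>Poly_Mapping.keys f. \<Sum>n\<in>Poly_Mapping.keys g. Poly_Mapping.single (m + n) (?l f m * ?l g n))"
    by (simp add: sum_product mult_single)
  finally have "f * g = \<dots>" .
  thus ?thesis
    by (simp add: meval_sum meval_single meval_monom_add meval_def[of _ f] meval_def[of _ g]
        sum_product mult_ac)
qed

lemma meval_uminus: "meval \<phi> (- f) = - meval \<phi> f"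
  using meval_add[of \<phi> f "-f"] by (simp add: eq_neg_iff_add_eq_0 add.commute)

lemma meval_diff: "meval \<phi> (f - g) = meval \<phi> f - meval \<phi> g"
  using meval_add[of \<phi> f "-g"] by (simp add: meval_uminus)

lemma meval_power: "meval \<phi> (f ^ n) = meval \<phi> f ^ n"
  by (induction n) (auto simp: meval_mult)

lemma meval_of_nat [simp]: "meval \<phi> (of_nat n) = of_nat n"
  by (induction n) (auto simp: meval_add)

lemma meval_of_int [simp]: "meval \<phi> (of_int c) = of_int c"
  by (cases c rule: int_cases2) (auto simp: meval_uminus)

lemma meval_mvar [simp]: "meval \<phi> (mvar i) = \<phi> i"
  by (simp add: mvar_def meval_single meval_monom_def)

lemma mvar_power: "mvar i ^ n = Poly_Mapping.single (Poly_Mapping.single i n) 1"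
  by (induction n) (auto simp: mvar_def mult_single single_add[symmetric])

lemma prod_single_1:
  "(\<Prod>i\<in>A. Poly_Mapping.single (f i) (1::int)) = Poly_Mapping.single (\<Sum>i\<in>A. f i) (1::int)"
  for f :: "_ \<Rightarrow> nat \<Rightarrow>\<^sub>0 nat"
  by (induction A rule: infinite_finite_induct) (auto simp: mult_single)

lemma meval_monom_mvar: "meval_monom mvar m = Poly_Mapping.single m 1"
  by (simp add: meval_monom_def mvar_power prod_single_1 poly_mapping_sum_single[symmetric])

lemma meval_meval: "meval \<psi> (meval \<phi> f) = meval (\<lambda>i. meval \<psi> (\<phi> i)) f"
proof -
  have monom: "meval \<psi> (meval_monom \<phi> m) = meval_monom (\<lambda>i. meval \<psi> (\<phi> i)) m" for m
  proof -
    have "meval \<psi> (\<Prod>i\<in>A. \<phi> i ^ Poly_Mapping.lookup m i) = (\<Prod>i\<in>A. meval \<psi> (\<phi> i) ^ Poly_Mapping.lookup m i)" for A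
      by (induction A rule: infinite_finite_induct) (auto simp: meval_mult meval_power)
    thus ?thesis by (simp add: meval_monom_def)
  qed
  show ?thesis
    unfolding meval_def[of \<phi>] meval_def[of "\<lambda>i. meval \<psi> (\<phi> i)"]
    by (simp add: meval_sum meval_mult monom)
qed

lemma int_mpoly_induct [case_names const var add mult]:
  assumes "\<And>c. P (of_int c)" "\<And>i. P (mvar i)"
    "\<And>f g. P f \<Longrightarrow> P g \<Longrightarrow> P (f + g)" "\<And>f g. P f \<Longrightarrow> P g \<Longrightarrow> P (f * g)"
  shows "P (f :: int_mpoly)"
proof -
  have P01: "P 0" "P 1" using assms(1)[of 0] assms(1)[of 1] by auto
  have pow: "P (mvar i ^ n)" for i n
    by (induction n) (auto intro: P01 assms)
  have pr: "P (\<Prod>i\<in>A. mvar i ^ g i)" for A g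
    by (induction A rule: infinite_finite_induct) (auto intro: P01 assms pow)
  have sg: "P (Poly_Mapping.single m c)" for m c
  proof -
    have "Poly_Mapping.single m c = of_int c * meval_monom mvar m"
      unfolding meval_monom_mvar by (simp flip: single_of_int add: mult_single)
    thus ?thesis by (simp add: meval_monom_def assms(1,4) pr)
  qed
  have "P (\<Sum>m\<in>A. Poly_Mapping.single m (Poly_Mapping.lookup f m))" for A
    by (induction A rule: infinite_finite_induct) (auto intro: P01 assms sg)
  thus ?thesis by (subst poly_mapping_sum_single) auto
qed

lemma of_nat_dvd_frobenius_add:
  fixes x y :: "'a::comm_ring_1"
  assumes "Factorial_Ring.prime (p::nat)"
  shows "of_nat p dvd (x + y) ^ p - x ^ p - y ^ p"
proof -
  have p: "p > 1" using assms prime_gt_1_nat by blast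
  have "(x + y) ^ p = (\<Sum>k\<le>p. of_nat (p choose k) * x ^ k * y ^ (p - k))"
    by (rule binomial_ring)
  also have "{..p} = insert 0 (insert p {0<..<p})" using p by auto
  also have "(\<Sum>k\<in>\<dots>. of_nat (p choose k) * x ^ k * y ^ (p - k))
      = y ^ p + x ^ p + (\<Sum>k\<in>{0<..<p}. of_nat (p choose k) * x ^ k * y ^ (p - k))"
    using p by simp
  finally have "(x + y) ^ p - x ^ p - y ^ p
      = (\<Sum>k\<in>{0<..<p}. of_nat (p choose k) * x ^ k * y ^ (p - k))"
    by simp
  also have "of_nat p dvd \<dots>"
  proof (rule dvd_sum)
    fix k assume "k \<in> {0<..<p}"
    hence "p dvd (p choose k)" using assms by (intro dvd_choose_prime) auto
    thus "of_nat p dvd of_nat (p choose k) * x ^ k * y ^ (p - k)"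
      by (intro dvd_mult2) (auto elim!: dvdE)
  qed
  finally show ?thesis .
qed

lemma dvd_diff_trans:
  fixes a b c d :: "'a::comm_ring_1"
  shows "d dvd a - b \<Longrightarrow> d dvd b - c \<Longrightarrow> d dvd a - c"
  using dvd_add[of d "a - b" "b - c"] by simp

lemma dvd_diff_sym:
  fixes a b d :: "'a::comm_ring_1"
  shows "d dvd a - b \<Longrightarrow> d dvd b - a"
  by (metis dvd_minus_iff minus_diff_eq)

lemma of_nat_power_mult_of_nat_power:
  "i + j = n \<Longrightarrow> of_nat (p ^ i) * of_nat (p ^ j) = (of_nat (p ^ n) :: 'a::comm_ring_1)"
  by (auto simp: power_add)

lemma dvd_diff_mult:
  fixes a b c d x :: "'a::comm_ring_1"
  assumes "x dvd a - b" "x dvd c - d"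
  shows "x dvd a * c - b * d"
proof -
  have "a * c - b * d = (a - b) * c + b * (c - d)" by (simp add: algebra_simps)
  thus ?thesis using assms by simp
qed

lemma dvd_diff_power:
  fixes a b x :: "'a::comm_ring_1"
  assumes "x dvd a - b"
  shows "x dvd a ^ n - b ^ n"
  by (induction n) (auto intro: dvd_diff_mult assms)

lemma dvd_diff_sum:
  fixes f g :: "'b \<Rightarrow> 'a::comm_ring_1"
  assumes "\<And>i. i \<in> A \<Longrightarrow> x dvd f i - g i"
  shows "x dvd sum f A - sum g A"
  unfolding sum_subtractf[symmetric] by (intro dvd_sum assms)

lemma dvd_frobenius_lift:
  assumes "Factorial_Ring.prime (p::nat)"
  shows "of_nat p dvd f ^ p - meval (\<lambda>i. mvar i ^ p) f"
proof (induction f rule: int_mpoly_induct)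
  case (const c)
  have "of_nat p dvd (of_int (int n) :: int_mpoly) ^ p - of_int (int n)" for n
  proof (induction n)
    case 0
    show ?case using assms by (simp add: prime_gt_0_nat power_0_left)
  next
    case (Suc n)
    show ?case
      using dvd_add[OF of_nat_dvd_frobenius_add[OF assms, of 1 "of_nat n :: int_mpoly"] Suc]
      by (simp add: algebra_simps)
  qed note nat = this
  have "of_nat p dvd (of_int c :: int_mpoly) ^ p - of_int c"
  proof -
    define d where "d = c mod int p"
    have p: "int p > 0" using assms by (simp add: prime_gt_0_nat)
    have "int p dvd c - d" by (simp add: d_def)
    hence cd: "(of_nat p :: int_mpoly) dvd of_int c - of_int d"
      by (metis of_int_diff of_int_of_nat_eq of_int_mult dvd_def)
    have "d = int (nat d)" using p by (simp add: d_def)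
    hence "of_nat p dvd (of_int d :: int_mpoly) ^ p - of_int d" using nat by metis
    moreover have "(of_nat p :: int_mpoly) dvd of_int c ^ p - of_int d ^ p"
      by (rule dvd_diff_power[OF cd])
    moreover have "(of_nat p :: int_mpoly) dvd of_int d - of_int c"
      using cd by (subst minus_diff_eq[symmetric]) (simp only: dvd_minus_iff)
    ultimately show ?thesis by (blast intro: dvd_diff_trans)
  qed
  moreover have "meval (\<lambda>i. mvar i ^ p) (of_int c) = (of_int c :: int_mpoly)"
    by simp
  ultimately show ?case by simp
next
  case (var i)
  show ?case by simp
next
  case (add f g)
  show ?case
    using dvd_add[OF dvd_add[OF of_nat_dvd_frobenius_add[OF assms, of f g] add(1)] add(2)]
    by (simp add: meval_add algebra_simps)
next
  case (mult f g)
  show ?case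
    using dvd_diff_mult[OF mult] by (simp add: meval_mult power_mult_distrib)
qed

lemma dvd_diff_power_prime_power:
  fixes a b :: "'a::comm_ring_1"
  assumes "Factorial_Ring.prime (p::nat)" "of_nat p dvd a - b"
  shows "of_nat (p ^ Suc k) dvd a ^ (p ^ k) - b ^ (p ^ k)"
proof (induction k)
  case 0
  show ?case using assms by simp
next
  case (Suc k)
  define x y where "x = a ^ (p ^ k)" and "y = b ^ (p ^ k)"
  have IH: "of_nat (p ^ Suc k) dvd x - y" using Suc by (simp add: x_def y_def)
  hence "of_nat p dvd x - y"
    by (metis dvd_mult_left of_nat_mult power_Suc)
  have "x ^ p - y ^ p = (x - y) * (\<Sum>i<p. y ^ (p - Suc i) * x ^ i)"
    by (rule power_diff_sumr2)
  moreover have "of_nat p dvd (\<Sum>i<p. y ^ (p - Suc i) * x ^ i)"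
  proof -
    have "of_nat p dvd (\<Sum>i<p. y ^ (p - Suc i) * x ^ i) - (\<Sum>i<p. y ^ (p - Suc i) * y ^ i)"
      by (intro dvd_diff_sum dvd_diff_mult dvd_diff_power \<open>of_nat p dvd x - y\<close>) auto
    moreover have "(\<Sum>i<p. y ^ (p - Suc i) * y ^ i) = of_nat p * y ^ (p - 1)"
      by (subst sum.cong[OF refl, of _ _ "\<lambda>_. y ^ (p - 1)"])
         (auto simp flip: power_add)
    ultimately show ?thesis
      by (metis dvd_add_left_iff dvd_triv_left diff_conv_add_uminus dvd_minus_iff)
  qed
  ultimately have "of_nat (p ^ Suc k) * of_nat p dvd x ^ p - y ^ p"
    using IH by (simp add: mult_dvd_mono del: power_Suc of_nat_power)
  thus ?case
    by (simp add: x_def y_def mult_ac flip: power_mult)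
qed


section \<open>Witt vectors\<close>

definition ghost :: "nat \<Rightarrow> (nat \<Rightarrow> 'a::comm_ring_1) \<Rightarrow> nat \<Rightarrow> 'a" where
  "ghost p a n = (\<Sum>i\<le>n. of_nat (p ^ i) * a i ^ (p ^ (n - i)))"

text \<open>
  The integer polynomials with prescribed ghost components \<open>G\<close>, as in the textbook definition
  of \<open>S\<^sub>n\<close> and \<open>P\<^sub>n\<close>; existence and uniqueness hold by Dwork's criterion below.
\<close>

definition witt_polys :: "nat \<Rightarrow> (nat \<Rightarrow> int_mpoly) \<Rightarrow> nat \<Rightarrow> int_mpoly" where
  "witt_polys p G = (THE s. \<forall>n. ghost p s n = G n)"

text \<open>The variables of index \<open>2 * i\<close> and \<open>2 * i + 1\<close> play the roles of \<open>X\<^sub>i\<close> and \<open>Y\<^sub>i\<close>.\<close>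

definition interleave :: "(nat \<Rightarrow> 'a) \<Rightarrow> (nat \<Rightarrow> 'a) \<Rightarrow> nat \<Rightarrow> 'a" where
  "interleave a b i = (if even i then a (i div 2) else b (i div 2))"

abbreviation "Xvar i \<equiv> mvar (2 * i)"
abbreviation "Yvar i \<equiv> mvar (2 * i + 1)"

definition witt_add :: "nat \<Rightarrow> (nat \<Rightarrow> 'a::comm_ring_1) \<Rightarrow> (nat \<Rightarrow> 'a) \<Rightarrow> nat \<Rightarrow> 'a" where
  "witt_add p a b n = meval (interleave a b) (witt_polys p (\<lambda>n. ghost p Xvar n + ghost p Yvar n) n)"

definition witt_mult :: "nat \<Rightarrow> (nat \<Rightarrow> 'a::comm_ring_1) \<Rightarrow> (nat \<Rightarrow> 'a) \<Rightarrow> nat \<Rightarrow> 'a" where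
  "witt_mult p a b n = meval (interleave a b) (witt_polys p (\<lambda>n. ghost p Xvar n * ghost p Yvar n) n)"

definition witt_uminus :: "nat \<Rightarrow> (nat \<Rightarrow> 'a::comm_ring_1) \<Rightarrow> nat \<Rightarrow> 'a" where
  "witt_uminus p a n = meval (interleave a a) (witt_polys p (\<lambda>n. - ghost p Xvar n) n)"

definition witt_zero :: "nat \<Rightarrow> 'a::comm_ring_1" where
  "witt_zero n = 0"

definition witt_one :: "nat \<Rightarrow> 'a::comm_ring_1" where
  "witt_one n = (if n = 0 then 1 else 0)"

lemma meval_ghost: "meval \<phi> (ghost p s n) = ghost p (\<lambda>i. meval \<phi> (s i)) n"
  by (simp add: ghost_def meval_sum meval_mult meval_power flip: of_nat_power)

lemma ghost_last:
  "ghost p a n = (\<Sum>i<n. of_nat (p ^ i) * a i ^ (p ^ (n - i))) + of_nat (p ^ n) * a n"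
  by (simp add: ghost_def flip: lessThan_Suc_atMost)

lemma ghost_inj:
  fixes s t :: "nat \<Rightarrow> int_mpoly"
  assumes "p > 0" "\<And>n. ghost p s n = ghost p t n"
  shows "s = t"
proof
  fix n
  show "s n = t n"
  proof (induction n rule: less_induct)
    case (less n)
    have "(\<Sum>i<n. of_nat (p ^ i) * s i ^ (p ^ (n - i))) = (\<Sum>i<n. of_nat (p ^ i) * t i ^ (p ^ (n - i)))"
      using less by (intro sum.cong) auto
    hence "of_nat (p ^ n) * s n = of_nat (p ^ n) * t n"
      using assms(2)[of n] by (simp add: ghost_last)
    thus ?case using assms(1) by simp
  qed
qed

text \<open>Dwork's criterion\<close>

lemma ghost_exists:
  fixes G :: "nat \<Rightarrow> int_mpoly"
  assumes p: "Factorial_Ring.prime (p::nat)"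
    and G: "\<And>n. of_nat (p ^ Suc n) dvd G (Suc n) - meval (\<lambda>i. mvar i ^ p) (G n)"
  shows "\<exists>s. \<forall>n. ghost p s n = G n"
proof -
  have p0: "p > 0" using p by (simp add: prime_gt_0_nat)
  define Q where "Q = (\<lambda>n h (x::int_mpoly). G n = (\<Sum>i<n. of_nat (p ^ i) * h i ^ (p ^ (n - i))) + of_nat (p ^ n) * x)"
  have "\<exists>f. \<forall>n. Q n f (f n)"
  proof (rule dependent_wellorder_choice)
    fix n f assume IH: "\<And>m. m < n \<Longrightarrow> Q m f (f m)"
    have gh: "ghost p f m = G m" if "m < n" for m
      using IH[OF that] by (simp add: Q_def ghost_last)
    show "\<exists>r. Q n f r"
    proof (cases n)
      case 0
      thus ?thesis by (simp add: Q_def)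
    next
      case (Suc m)
      let ?\<Phi> = "meval (\<lambda>i. mvar i ^ p)"
      have "of_nat (p ^ n) dvd (\<Sum>i\<le>m. of_nat (p ^ i) * f i ^ (p ^ (n - i))) - ghost p (\<lambda>i. ?\<Phi> (f i)) m"
        unfolding ghost_def
      proof (rule dvd_diff_sum)
        fix i assume i: "i \<in> {..m}"
        have "of_nat (p ^ Suc (m - i)) dvd (f i ^ p) ^ (p ^ (m - i)) - (?\<Phi> (f i)) ^ (p ^ (m - i))"
          by (intro dvd_diff_power_prime_power p dvd_frobenius_lift)
        hence "of_nat (p ^ i) * of_nat (p ^ Suc (m - i)) dvd
            of_nat (p ^ i) * ((f i ^ p) ^ (p ^ (m - i)) - (?\<Phi> (f i)) ^ (p ^ (m - i)))"
          by (intro mult_dvd_mono) auto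
        moreover have "of_nat (p ^ i) * of_nat (p ^ Suc (m - i)) = (of_nat (p ^ n) :: int_mpoly)"
          using i Suc by (intro of_nat_power_mult_of_nat_power) auto
        moreover have "(f i ^ p) ^ (p ^ (m - i)) = f i ^ (p ^ (n - i))"
          using i Suc by (simp add: Suc_diff_le power_mult)
        ultimately show "of_nat (p ^ n) dvd of_nat (p ^ i) * f i ^ (p ^ (n - i))
            - of_nat (p ^ i) * ?\<Phi> (f i) ^ (p ^ (m - i))"
          by (simp only: right_diff_distrib)
      qed
      moreover have "ghost p (\<lambda>i. ?\<Phi> (f i)) m = ?\<Phi> (G m)"
        using gh[of m] Suc by (simp flip: meval_ghost)
      ultimately have "of_nat (p ^ n) dvd (\<Sum>i\<le>m. of_nat (p ^ i) * f i ^ (p ^ (n - i))) - ?\<Phi> (G m)"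
        by simp
      moreover have "of_nat (p ^ n) dvd G n - ?\<Phi> (G m)"
        using G[of m] unfolding Suc .
      ultimately have "of_nat (p ^ n) dvd G n - (\<Sum>i\<le>m. of_nat (p ^ i) * f i ^ (p ^ (n - i)))"
        by (blast intro: dvd_diff_sym dvd_diff_trans)
      then obtain x where "G n - (\<Sum>i\<le>m. of_nat (p ^ i) * f i ^ (p ^ (n - i))) = of_nat (p ^ n) * x"
        by (elim dvdE)
      hence "Q n f x"
        using Suc by (simp add: Q_def lessThan_Suc_atMost algebra_simps)
      thus ?thesis ..
    qed
  next
    fix r :: int_mpoly and f g :: "nat \<Rightarrow> int_mpoly" and n :: nat
    assume "\<And>m. m < n \<Longrightarrow> f m = g m"
    hence "(\<Sum>i<n. of_nat (p ^ i) * f i ^ (p ^ (n - i))) = (\<Sum>i<n. of_nat (p ^ i) * g i ^ (p ^ (n - i)))"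
      by (intro sum.cong) auto
    thus "Q n f r = Q n g r" by (simp add: Q_def)
  qed
  then obtain f where "\<forall>n. Q n f (f n)" ..
  hence "\<forall>n. ghost p f n = G n" by (simp add: Q_def ghost_last)
  thus ?thesis by blast
qed

lemma ghost_witt_polys:
  fixes G :: "nat \<Rightarrow> int_mpoly"
  assumes p: "Factorial_Ring.prime (p::nat)"
    and G: "\<And>n. of_nat (p ^ Suc n) dvd G (Suc n) - meval (\<lambda>i. mvar i ^ p) (G n)"
  shows "ghost p (witt_polys p G) n = G n"
proof -
  have "\<exists>!s. \<forall>n. ghost p s n = G n"
  proof (rule ex_ex1I)
    show "\<exists>s. \<forall>n. ghost p s n = G n" by (rule ghost_exists[OF assms])
    fix s t assume "\<forall>n. ghost p s n = G n" "\<forall>n. ghost p t n = G n"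
    thus "s = t" using p by (intro ghost_inj[of p]) (auto simp: prime_gt_0_nat)
  qed
  from theI'[OF this] show ?thesis by (simp add: witt_polys_def)
qed

lemma ghost_mvar_congruence:
  assumes "Factorial_Ring.prime (p::nat)"
  shows "of_nat (p ^ Suc n) dvd
    ghost p (\<lambda>i. mvar (g i)) (Suc n) - meval (\<lambda>i. mvar i ^ p) (ghost p (\<lambda>i. mvar (g i)) n)"
proof -
  have "(\<Sum>i\<le>n. of_nat (p ^ i) * mvar (g i) ^ (p ^ (Suc n - i))) = ghost p (\<lambda>i. mvar (g i) ^ p) n"
    unfolding ghost_def by (intro sum.cong) (auto simp: Suc_diff_le power_mult)
  thus ?thesis
    by (simp add: meval_ghost ghost_last[of p _ "Suc n"] lessThan_Suc_atMost)
qed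

context
  fixes p :: nat
  assumes p: "Factorial_Ring.prime (p::nat)"
begin

lemma ghost_add_polys:
  "ghost p (witt_polys p (\<lambda>n. ghost p Xvar n + ghost p Yvar n)) n = ghost p Xvar n + ghost p Yvar n"
proof (rule ghost_witt_polys[OF p])
  fix n
  show "of_nat (p ^ Suc n) dvd ghost p Xvar (Suc n) + ghost p Yvar (Suc n)
      - meval (\<lambda>i. mvar i ^ p) (ghost p Xvar n + ghost p Yvar n)"
    using dvd_add[OF ghost_mvar_congruence[OF p, of n "\<lambda>i. 2 * i"]
        ghost_mvar_congruence[OF p, of n "\<lambda>i. 2 * i + 1"]]
    by (simp add: meval_add algebra_simps del: power_Suc of_nat_power)
qed

lemma ghost_mult_polys:
  "ghost p (witt_polys p (\<lambda>n. ghost p Xvar n * ghost p Yvar n)) n = ghost p Xvar n * ghost p Yvar n"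
proof (rule ghost_witt_polys[OF p])
  fix n
  show "of_nat (p ^ Suc n) dvd ghost p Xvar (Suc n) * ghost p Yvar (Suc n)
      - meval (\<lambda>i. mvar i ^ p) (ghost p Xvar n * ghost p Yvar n)"
    using dvd_diff_mult[OF ghost_mvar_congruence[OF p, of n "\<lambda>i. 2 * i"]
        ghost_mvar_congruence[OF p, of n "\<lambda>i. 2 * i + 1"]]
    by (simp only: meval_mult)
qed

lemma ghost_uminus_polys:
  "ghost p (witt_polys p (\<lambda>n. - ghost p Xvar n)) n = - ghost p Xvar n"
proof (rule ghost_witt_polys[OF p])
  fix n
  have "of_nat (p ^ Suc n) dvd - (ghost p Xvar (Suc n) - meval (\<lambda>i. mvar i ^ p) (ghost p Xvar n))"
    using ghost_mvar_congruence[OF p, of n "\<lambda>i. 2 * i"] by (simp only: dvd_minus_iff)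
  thus "of_nat (p ^ Suc n) dvd - ghost p Xvar (Suc n)
      - meval (\<lambda>i. mvar i ^ p) (- ghost p Xvar n)"
    by (simp add: meval_uminus del: power_Suc of_nat_power)
qed

lemma interleave_even [simp]: "interleave a b (2 * i) = a i"
  and interleave_odd [simp]: "interleave a b (Suc (2 * i)) = b i"
  by (auto simp: interleave_def)

lemma ghost_meval: "ghost p (\<lambda>i. meval \<phi> (s i)) n = meval \<phi> (ghost p s n)"
  by (rule meval_ghost[symmetric])

lemma ghost_witt_add: "ghost p (witt_add p a b) n = ghost p a n + ghost p b n"
  unfolding witt_add_def ghost_meval ghost_add_polys
  by (simp add: meval_add meval_ghost)

lemma ghost_witt_mult: "ghost p (witt_mult p a b) n = ghost p a n * ghost p b n"
  unfolding witt_mult_def ghost_meval ghost_mult_polys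
  by (simp add: meval_mult meval_ghost)

lemma ghost_witt_uminus: "ghost p (witt_uminus p a) n = - ghost p a n"
  unfolding witt_uminus_def ghost_meval ghost_uminus_polys
  by (simp add: meval_uminus meval_ghost)

lemma ghost_witt_zero: "ghost p witt_zero n = 0"
  using p by (simp add: ghost_def witt_zero_def prime_gt_0_nat power_0_left)

lemma ghost_witt_one: "ghost p witt_one n = 1"
proof -
  have "ghost p witt_one n = (\<Sum>i\<le>n. if i = 0 then 1 else 0 :: 'a)"
    unfolding ghost_def using p by (intro sum.cong) (auto simp: witt_one_def prime_gt_0_nat power_0_left)
  thus ?thesis by simp
qed

lemmas ghost_witt = ghost_witt_add ghost_witt_mult ghost_witt_uminus ghost_witt_zero ghost_witt_one

lemma interleave_meval:
  "interleave (\<lambda>n. meval \<phi> (a n)) (\<lambda>n. meval \<phi> (b n)) = (\<lambda>n. meval \<phi> (interleave a b n))"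
  by (auto simp: interleave_def)

lemma meval_witt_add:
  "witt_add p (\<lambda>n. meval \<phi> (a n)) (\<lambda>n. meval \<phi> (b n)) = (\<lambda>n. meval \<phi> (witt_add p a b n))"
  by (auto simp: witt_add_def meval_meval interleave_meval)

lemma meval_witt_mult:
  "witt_mult p (\<lambda>n. meval \<phi> (a n)) (\<lambda>n. meval \<phi> (b n)) = (\<lambda>n. meval \<phi> (witt_mult p a b n))"
  by (auto simp: witt_mult_def meval_meval interleave_meval)

lemma meval_witt_uminus:
  "witt_uminus p (\<lambda>n. meval \<phi> (a n)) = (\<lambda>n. meval \<phi> (witt_uminus p a n))"
  by (auto simp: witt_uminus_def meval_meval interleave_meval)

lemma meval_witt_zero: "witt_zero = (\<lambda>n. meval \<phi> (witt_zero n))"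
  by (auto simp: witt_zero_def)

lemma meval_witt_one: "witt_one = (\<lambda>n. meval \<phi> (witt_one n))"
  by (auto simp: witt_one_def)

lemma generic_witt:
  fixes a b c :: "nat \<Rightarrow> 'a::comm_ring_1"
  obtains \<phi> A B C where "a = (\<lambda>n. meval \<phi> (A n))" "b = (\<lambda>n. meval \<phi> (B n))" "c = (\<lambda>n. meval \<phi> (C n))"
proof -
  define \<phi> where "\<phi> i = (if i mod 3 = 0 then a (i div 3) else if i mod 3 = 1 then b (i div 3) else c (i div 3))" for i
  have [simp]: "(3 * n + 1) div 3 = n" "(3 * n + 1) mod 3 = 1" "(3 * n + 2) div 3 = n" "(3 * n + 2) mod 3 = 2"
    for n :: nat by presburger+
  have "a = (\<lambda>n. meval \<phi> (mvar (3 * n)))" "b = (\<lambda>n. meval \<phi> (mvar (3 * n + 1)))"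
    "c = (\<lambda>n. meval \<phi> (mvar (3 * n + 2)))"
    by (auto simp: \<phi>_def simp del: Suc_eq_plus1 One_nat_def add_Suc_right add_2_eq_Suc' add_2_eq_Suc)
  thus thesis by (rule that)
qed

lemma witt_ghost_eqI:
  fixes s t :: "nat \<Rightarrow> int_mpoly"
  shows "(\<And>n. ghost p s n = ghost p t n) \<Longrightarrow> s = t"
  using p by (intro ghost_inj[of p]) (auto simp: prime_gt_0_nat)

lemma witt_add_assoc: "witt_add p (witt_add p a b) c = witt_add p a (witt_add p b c)"
proof -
  obtain \<phi> A B C where *: "a = (\<lambda>n. meval \<phi> (A n))" "b = (\<lambda>n. meval \<phi> (B n))" "c = (\<lambda>n. meval \<phi> (C n))"
    by (rule generic_witt)
  have "witt_add p (witt_add p A B) C = witt_add p A (witt_add p B C)"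
    by (rule witt_ghost_eqI) (simp add: ghost_witt)
  thus ?thesis unfolding * meval_witt_add by simp
qed

lemma witt_add_commute: "witt_add p a b = witt_add p b a"
proof -
  obtain \<phi> A B C where *: "a = (\<lambda>n. meval \<phi> (A n))" "b = (\<lambda>n. meval \<phi> (B n))" "a = (\<lambda>n. meval \<phi> (C n))"
    by (rule generic_witt)
  have "witt_add p A B = witt_add p B A"
    by (rule witt_ghost_eqI) (simp add: ghost_witt)
  thus ?thesis unfolding *(1,2) meval_witt_add by simp
qed

lemma witt_add_zero: "witt_add p witt_zero a = a"
proof -
  obtain \<phi> A B C where *: "a = (\<lambda>n. meval \<phi> (A n))" "a = (\<lambda>n. meval \<phi> (B n))" "a = (\<lambda>n. meval \<phi> (C n))"
    by (rule generic_witt)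
  have "witt_add p witt_zero A = A"
    by (rule witt_ghost_eqI) (simp add: ghost_witt)
  thus ?thesis unfolding *(1) meval_witt_zero[of \<phi>] meval_witt_add by simp
qed

lemma witt_add_uminus: "witt_add p (witt_uminus p a) a = witt_zero"
proof -
  obtain \<phi> A B C where *: "a = (\<lambda>n. meval \<phi> (A n))" "a = (\<lambda>n. meval \<phi> (B n))" "a = (\<lambda>n. meval \<phi> (C n))"
    by (rule generic_witt)
  have "witt_add p (witt_uminus p A) A = witt_zero"
    by (rule witt_ghost_eqI) (simp add: ghost_witt)
  thus ?thesis unfolding *(1) meval_witt_zero[of \<phi>] meval_witt_add meval_witt_uminus by simp
qed

lemma witt_mult_assoc: "witt_mult p (witt_mult p a b) c = witt_mult p a (witt_mult p b c)"
proof -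
  obtain \<phi> A B C where *: "a = (\<lambda>n. meval \<phi> (A n))" "b = (\<lambda>n. meval \<phi> (B n))" "c = (\<lambda>n. meval \<phi> (C n))"
    by (rule generic_witt)
  have "witt_mult p (witt_mult p A B) C = witt_mult p A (witt_mult p B C)"
    by (rule witt_ghost_eqI) (simp add: ghost_witt)
  thus ?thesis unfolding * meval_witt_mult by simp
qed

lemma witt_mult_commute: "witt_mult p a b = witt_mult p b a"
proof -
  obtain \<phi> A B C where *: "a = (\<lambda>n. meval \<phi> (A n))" "b = (\<lambda>n. meval \<phi> (B n))" "a = (\<lambda>n. meval \<phi> (C n))"
    by (rule generic_witt)
  have "witt_mult p A B = witt_mult p B A"
    by (rule witt_ghost_eqI) (simp add: ghost_witt)
  thus ?thesis unfolding *(1,2) meval_witt_mult by simp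
qed

lemma witt_mult_one: "witt_mult p witt_one a = a"
proof -
  obtain \<phi> A B C where *: "a = (\<lambda>n. meval \<phi> (A n))" "a = (\<lambda>n. meval \<phi> (B n))" "a = (\<lambda>n. meval \<phi> (C n))"
    by (rule generic_witt)
  have "witt_mult p witt_one A = A"
    by (rule witt_ghost_eqI) (simp add: ghost_witt)
  thus ?thesis unfolding *(1) meval_witt_one[of \<phi>] meval_witt_mult by simp
qed

lemma witt_distrib:
  "witt_mult p (witt_add p a b) c = witt_add p (witt_mult p a c) (witt_mult p b c)"
proof -
  obtain \<phi> A B C where *: "a = (\<lambda>n. meval \<phi> (A n))" "b = (\<lambda>n. meval \<phi> (B n))" "c = (\<lambda>n. meval \<phi> (C n))"
    by (rule generic_witt)
  have "witt_mult p (witt_add p A B) C = witt_add p (witt_mult p A C) (witt_mult p B C)"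
    by (rule witt_ghost_eqI) (simp add: ghost_witt algebra_simps)
  thus ?thesis unfolding * meval_witt_mult meval_witt_add by simp
qed

text \<open>Verschiebung; in characteristic \<open>p\<close> it satisfies \<open>V a * b = V (a * F b)\<close>.\<close>

definition witt_V :: "(nat \<Rightarrow> 'a::zero) \<Rightarrow> nat \<Rightarrow> 'a" where
  "witt_V a n = (if n = 0 then 0 else a (n - 1))"

lemma ghost_witt_V: "ghost p (witt_V a) n = (if n = 0 then 0 else of_nat p * ghost p a (n - 1))"
proof (cases n)
  case 0
  thus ?thesis using p by (simp add: ghost_def witt_V_def)
next
  case (Suc m)
  have "p > 0" using p by (simp add: prime_gt_0_nat)
  thus ?thesis unfolding Suc ghost_def
    by (subst sum.atMost_Suc_shift)
       (auto simp: witt_V_def sum_distrib_left mult_ac power_0_left intro!: sum.cong)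
qed

lemma ghost_cong_imp:
  fixes s t :: "nat \<Rightarrow> int_mpoly"
  assumes "\<And>n. of_nat (p ^ Suc n) dvd ghost p s n - ghost p t n"
  shows "of_nat p dvd s n - t n"
proof (induction n rule: less_induct)
  case (less n)
  have p0: "p > 0" using p by (simp add: prime_gt_0_nat)
  have "of_nat (p ^ Suc n) dvd (\<Sum>i<n. of_nat (p ^ i) * s i ^ (p ^ (n - i))) - (\<Sum>i<n. of_nat (p ^ i) * t i ^ (p ^ (n - i)))"
  proof (rule dvd_diff_sum)
    fix i assume i: "i \<in> {..<n}"
    have "of_nat (p ^ Suc (n - i)) dvd s i ^ (p ^ (n - i)) - t i ^ (p ^ (n - i))"
      using i by (intro dvd_diff_power_prime_power p less.IH) auto
    hence "of_nat (p ^ i) * of_nat (p ^ Suc (n - i)) dvd of_nat (p ^ i) * (s i ^ (p ^ (n - i)) - t i ^ (p ^ (n - i)))"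
      by (intro mult_dvd_mono) auto
    moreover have "of_nat (p ^ i) * of_nat (p ^ Suc (n - i)) = (of_nat (p ^ Suc n) :: int_mpoly)"
      using i by (intro of_nat_power_mult_of_nat_power) auto
    ultimately show "of_nat (p ^ Suc n) dvd of_nat (p ^ i) * s i ^ (p ^ (n - i)) - of_nat (p ^ i) * t i ^ (p ^ (n - i))"
      by (simp add: right_diff_distrib del: power_Suc of_nat_power)
  qed
  from dvd_diff[OF assms[of n] this]
  have "of_nat (p ^ Suc n) dvd of_nat (p ^ n) * (s n - t n)"
    by (simp add: ghost_last algebra_simps del: power_Suc of_nat_power)
  hence "of_nat (p ^ n) * of_nat p dvd of_nat (p ^ n) * (s n - t n)"
    by (simp add: mult_ac)
  thus ?case using p0 by (subst (asm) dvd_mult_cancel_left) auto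
qed

lemma witt_V_mult:
  fixes a b :: "nat \<Rightarrow> 'a::comm_ring_1"
  assumes "of_nat p = (0::'a)"
  shows "witt_mult p (witt_V a) b = witt_V (witt_mult p a (\<lambda>n. b n ^ p))"
proof -
  obtain \<phi> A B C where *: "a = (\<lambda>n. meval \<phi> (A n))" "b = (\<lambda>n. meval \<phi> (B n))" "a = (\<lambda>n. meval \<phi> (C n))"
    by (rule generic_witt)
  let ?s = "witt_mult p (witt_V A) B" and ?t = "witt_V (witt_mult p A (\<lambda>n. B n ^ p))"
  have ghB: "ghost p B (Suc m) = ghost p (\<lambda>n. B n ^ p) m + of_nat (p ^ Suc m) * B (Suc m)" for m
    unfolding ghost_last[of p B "Suc m"] lessThan_Suc_atMost
    unfolding ghost_def by (auto intro!: sum.cong simp: Suc_diff_le simp flip: power_mult)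
  have "of_nat (p ^ Suc n) dvd ghost p ?s n - ghost p ?t n" for n
  proof (cases n)
    case 0
    thus ?thesis by (simp add: ghost_witt ghost_witt_V)
  next
    case (Suc m)
    have "ghost p ?s n - ghost p ?t n = of_nat (p ^ Suc n) * (ghost p A m * B (Suc m))"
      by (simp add: Suc ghost_witt ghost_witt_V ghB algebra_simps)
    thus ?thesis by simp
  qed
  hence dvd: "of_nat p dvd ?s n - ?t n" for n by (rule ghost_cong_imp)
  have eq: "meval \<phi> (?s n) = meval \<phi> (?t n)" for n
  proof -
    from dvd[of n] obtain x where "?s n - ?t n = of_nat p * x" by (elim dvdE)
    hence "meval \<phi> (?s n - ?t n) = 0" by (simp add: meval_mult assms)
    thus ?thesis by (simp add: meval_diff)
  qed
  have V: "witt_V (\<lambda>n. meval \<phi> (f n)) = (\<lambda>n. meval \<phi> (witt_V f n))" for f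
    by (auto simp: witt_V_def)
  show ?thesis
    unfolding *(1,2) V meval_power[symmetric] meval_witt_mult using eq by auto
qed

lemma witt_mult_0: "witt_mult p a b 0 = a 0 * b 0"
  using ghost_witt_mult[of a b 0] by (simp add: ghost_def)

lemma witt_V_pow_mult:
  fixes a b :: "nat \<Rightarrow> 'a::comm_ring_1"
  assumes "of_nat p = (0::'a)"
  shows "witt_mult p ((witt_V ^^ m) a) b = (witt_V ^^ m) (witt_mult p a (\<lambda>n. b n ^ (p ^ m)))"
proof (induction m arbitrary: b)
  case (Suc m)
  show ?case
    by (simp add: witt_V_mult[OF assms] Suc.IH mult_ac flip: power_mult)
qed auto

lemma witt_V_pow_nth: "(witt_V ^^ m) a (n + m) = a n"
  by (induction m arbitrary: n) (auto simp: witt_V_def)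

lemma witt_V_powE:
  fixes a :: "nat \<Rightarrow> 'a::comm_ring_1"
  assumes "a \<noteq> witt_zero"
  obtains m c where "a = (witt_V ^^ m) c" "c 0 \<noteq> 0"
proof -
  have "\<exists>n. a n \<noteq> 0" using assms by (auto simp: witt_zero_def fun_eq_iff)
  hence "\<exists>m c. a = (witt_V ^^ m) c \<and> c 0 \<noteq> 0"
  proof (elim exE)
    fix n assume "a n \<noteq> 0"
    thus ?thesis
    proof (induction n arbitrary: a)
      case 0
      thus ?case by (intro exI[of _ 0] exI[of _ a]) auto
    next
      case (Suc n)
      show ?case
      proof (cases "a 0 = 0")
        case True
        hence a: "a = witt_V (\<lambda>i. a (Suc i))" by (auto simp: witt_V_def fun_eq_iff)
        from Suc.IH[of "\<lambda>i. a (Suc i)"] Suc.prems obtain m c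
          where "(\<lambda>i. a (Suc i)) = (witt_V ^^ m) c" "c 0 \<noteq> 0" by auto
        thus ?thesis using a by (intro exI[of _ "Suc m"] exI[of _ c]) auto
      next
        case False
        thus ?thesis by (intro exI[of _ 0] exI[of _ a]) auto
      qed
    qed
  qed
  thus thesis using that by blast
qed

lemma witt_no_zero_divisors:
  fixes a b :: "nat \<Rightarrow> 'a::idom"
  assumes "of_nat p = (0::'a)" "a \<noteq> witt_zero" "b \<noteq> witt_zero"
  shows "witt_mult p a b \<noteq> witt_zero"
proof -
  obtain m c where a: "a = (witt_V ^^ m) c" "c 0 \<noteq> 0" using assms(2) by (rule witt_V_powE)
  obtain n d where b: "b = (witt_V ^^ n) d" "d 0 \<noteq> 0" using assms(3) by (rule witt_V_powE)
  have p0: "p > 0" using p by (simp add: prime_gt_0_nat)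
  have pw: "(\<lambda>i. (witt_V ^^ n) d i ^ (p ^ k)) = (witt_V ^^ n) (\<lambda>i. d i ^ (p ^ k))" for k
    using p0 by (induction n) (auto simp: witt_V_def fun_eq_iff power_0_left)
  have "witt_mult p a b = (witt_V ^^ m) ((witt_V ^^ n) (witt_mult p (\<lambda>i. d i ^ (p ^ m)) (\<lambda>i. c i ^ (p ^ n))))"
    unfolding a(1) b(1) witt_V_pow_mult[OF assms(1)] pw
    by (subst witt_mult_commute) (simp add: witt_V_pow_mult[OF assms(1)])
  hence "witt_mult p a b (n + m) = (witt_V ^^ m) ((witt_V ^^ n) (witt_mult p (\<lambda>i. d i ^ (p ^ m)) (\<lambda>i. c i ^ (p ^ n)))) (n + m)"
    by simp
  also have "\<dots> = d 0 ^ (p ^ m) * c 0 ^ (p ^ n)"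
    using witt_V_pow_nth[of n "witt_mult p (\<lambda>i. d i ^ p ^ m) (\<lambda>i. c i ^ p ^ n)" 0]
    by (simp add: witt_V_pow_nth witt_mult_0)
  finally have "witt_mult p a b (n + m) \<noteq> 0" using a b by simp
  thus ?thesis by (auto simp: witt_zero_def)
qed

end

typedef (overloaded) 'a witt = "UNIV :: (nat \<Rightarrow> 'a::comm_ring_prime_char) set"
  morphisms witt_nth Witt ..

setup_lifting type_definition_witt

instantiation witt :: (comm_ring_prime_char) comm_ring_1
begin

lift_definition zero_witt :: "'a witt" is witt_zero .
lift_definition one_witt :: "'a witt" is witt_one .
lift_definition plus_witt :: "'a witt \<Rightarrow> 'a witt \<Rightarrow> 'a witt" is "witt_add CHAR('a)" .
lift_definition times_witt :: "'a witt \<Rightarrow> 'a witt \<Rightarrow> 'a witt" is "witt_mult CHAR('a)" .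
lift_definition uminus_witt :: "'a witt \<Rightarrow> 'a witt" is "witt_uminus CHAR('a)" .
lift_definition minus_witt :: "'a witt \<Rightarrow> 'a witt \<Rightarrow> 'a witt"
  is "\<lambda>a b. witt_add CHAR('a) a (witt_uminus CHAR('a) b)" .

instance
proof
  fix a b c :: "'a witt"
  note p = CHAR_prime[where ?'a = 'a]
  show "a * b * c = a * (b * c)" by transfer (rule witt_mult_assoc[OF p])
  show "a * b = b * a" by transfer (rule witt_mult_commute[OF p])
  show "1 * a = a" by transfer (rule witt_mult_one[OF p])
  show "a + b + c = a + (b + c)" by transfer (rule witt_add_assoc[OF p])
  show "a + b = b + a" by transfer (rule witt_add_commute[OF p])
  show "0 + a = a" by transfer (rule witt_add_zero[OF p])
  show "- a + a = 0" by transfer (rule witt_add_uminus[OF p])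
  show "a - b = a + - b" by transfer (rule refl)
  show "(a + b) * c = a * c + b * c" by transfer (rule witt_distrib[OF p])
  show "(0::'a witt) \<noteq> 1"
    by transfer (metis witt_zero_def witt_one_def zero_neq_one)
qed

end

instance witt :: (idom_prime_char) idom
proof
  fix a b :: "'a witt"
  assume "a \<noteq> 0" "b \<noteq> 0"
  thus "a * b \<noteq> 0"
    by transfer (rule witt_no_zero_divisors[OF CHAR_prime of_nat_CHAR])
qed

section \<open>The ring \<open>R = W[[q - 1]]\<close>\<close>

text \<open>\<open>R\<close> is the type \<open>'k witt fps\<close>, with \<open>fps_X\<close> in the role of \<open>q - 1\<close>.\<close>

definition qvar :: "'k::field_prime_char witt fps" where
  "qvar = 1 + fps_X"

definition q_analog_p :: "'k::field_prime_char witt fps" where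
  "q_analog_p = (\<Sum>i<CHAR('k). qvar ^ i)"

primrec pq_ideal_power :: "nat \<Rightarrow> 'k::field_prime_char witt fps set" where
  "pq_ideal_power 0 = UNIV"
| "pq_ideal_power (Suc n) =
     {of_nat CHAR('k) * a + (qvar - 1) * b | a b. a \<in> pq_ideal_power n \<and> b \<in> pq_ideal_power n}"

text \<open>
  A \<open>p\<close>-adic integer is given by its sequence of residues modulo \<open>p ^ n\<close> in \<open>{0..<p ^ n}\<close>.
\<close>

definition zp_of_nat :: "nat \<Rightarrow> nat \<Rightarrow> nat \<Rightarrow> nat" where
  "zp_of_nat p m n = m mod p ^ n"

text \<open>\<open>q\<close> to a \<open>p\<close>-adic power, as a \<open>(p, q - 1)\<close>-adic limit.\<close>

definition qpower :: "(nat \<Rightarrow> nat) \<Rightarrow> 'k::field_prime_char witt fps" where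
  "qpower a = (THE r. \<forall>N. \<exists>n\<^sub>0. \<forall>n\<ge>n\<^sub>0. qvar ^ a n - r \<in> pq_ideal_power N)"


section \<open>Galois groups of subfields of a field\<close>

definition ring_adjoin :: "'a::field set \<Rightarrow> 'a set \<Rightarrow> 'a set" where
  "ring_adjoin F S = \<Inter>{A. F \<union> S \<subseteq> A \<and> (\<forall>x\<in>A. \<forall>y\<in>A. x - y \<in> A \<and> x * y \<in> A)}"

definition galois_group :: "'a::field set \<Rightarrow> 'a set \<Rightarrow> ('a \<Rightarrow> 'a) monoid" where
  "galois_group L F =
    \<lparr>carrier = {g \<in> extensional L. bij_betw g L L \<and>
        (\<forall>x\<in>L. \<forall>y\<in>L. g (x + y) = g x + g y \<and> g (x * y) = g x * g y) \<and> (\<forall>x\<in>F. g x = x)},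
     monoid.mult = compose L,
     one = (\<lambda>x\<in>L. x)\<rparr>"

definition finite_intermediate_field :: "'a::field set \<Rightarrow> 'a set \<Rightarrow> 'a set \<Rightarrow> bool" where
  "finite_intermediate_field L F E \<longleftrightarrow> F \<subseteq> E \<and> E \<subseteq> L \<and>
     (\<forall>x\<in>E. \<forall>y\<in>E. x - y \<in> E \<and> x * y \<in> E \<and> inverse x \<in> E) \<and>
     (\<exists>B. finite B \<and> E \<subseteq> {\<Sum>b\<in>B. c b * b | c. c \<in> B \<rightarrow> F})"

text \<open>The sets below are the left cosets \<open>g Gal(L/E)\<close>, for \<open>E/F\<close> finite.\<close>

definition krull_topology :: "'a::field set \<Rightarrow> 'a set \<Rightarrow> ('a \<Rightarrow> 'a) topology" where
  "krull_topology L F = topology_generated_by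
     {{h \<in> carrier (galois_group L F). \<forall>x\<in>E. h x = g x} | g E.
        g \<in> carrier (galois_group L F) \<and> finite_intermediate_field L F E}"


section \<open>The group \<open>\<Gamma>\<close>\<close>

type_synonym 'k frac_closure = "'k witt fract alg_closure"

definition cyclotomic_field :: "enat \<Rightarrow> 'k::field_prime_char frac_closure set" where
  "cyclotomic_field n =
     ring_adjoin (range to_ac) {z. \<exists>m. enat m \<le> n \<and> z ^ (CHAR('k) ^ m) = 1}"

abbreviation cyclotomic_galois_group ::
    "('k::field_prime_char frac_closure \<Rightarrow> 'k frac_closure) monoid" where
  "cyclotomic_galois_group \<equiv> galois_group (cyclotomic_field \<infinity>) (cyclotomic_field 1)"

abbreviation cyclotomic_krull_topology ::
    "('k::field_prime_char frac_closure \<Rightarrow> 'k frac_closure) topology" where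
  "cyclotomic_krull_topology \<equiv> krull_topology (cyclotomic_field \<infinity>) (cyclotomic_field 1)"

definition cyclotomic_character ::
    "('k::field_prime_char frac_closure \<Rightarrow> 'k frac_closure) \<Rightarrow> nat \<Rightarrow> nat" where
  "cyclotomic_character g n =
     (THE a. a < CHAR('k) ^ n \<and> (\<forall>z. z ^ (CHAR('k) ^ n) = 1 \<longrightarrow> g z = z ^ a))"

definition gamma_elem :: "'k::field_prime_char frac_closure \<Rightarrow> 'k frac_closure" where
  "gamma_elem = (THE g. g \<in> carrier cyclotomic_galois_group \<and>
     cyclotomic_character g = zp_of_nat CHAR('k) (CHAR('k) + 1))"

text \<open>
  For odd \<open>p\<close>, \<open>\<Gamma>\<close> is \<open>Gal(K\<^sub>\<infinity>/K\<^sub>1) \<cong> 1 + p\<int>\<^sub>p\<close>, which \<open>\<gamma>\<close> generates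
  topologically. For \<open>p = 2\<close> one has \<open>K\<^sub>1 = K\<^sub>0\<close> and \<open>Gal(K\<^sub>\<infinity>/K\<^sub>1) \<cong> \<int>\<^sub>2\<^sup>*\<close>, which is
  not procyclic, and the automorphism \<open>q \<mapsto> q\<^sup>-\<^sup>1\<close> need not lift to a \<open>\<nabla>\<close>-module: for
  \<open>k = \<bbbF>\<^sub>2\<close> and \<open>\<partial> e = 2 e\<close> on \<open>M = R e\<close>, a lift \<open>e \<mapsto> u e\<close> satisfies
  \<open>u(i) u(-i) = 1\<close> and \<open>u(-i) (-1 - 2i) = (-1 + 2i) u(i)\<close> at \<open>q = i\<close>, so that
  \<open>5 = ((1 + 2i) / u(i))\<^sup>2\<close> would be a square in \<open>\<rat>\<^sub>2(i)\<close>. So for \<open>p = 2\<close>, \<open>\<Gamma>\<close> denotes the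
  closed subgroup of \<open>Gal(K\<^sub>\<infinity>/K\<^sub>1)\<close> topologically generated by \<open>\<gamma>\<close>.
\<close>

definition Gamma_group :: "('k::field_prime_char frac_closure \<Rightarrow> 'k frac_closure) monoid" where
  "Gamma_group = (if CHAR('k) = 2
     then cyclotomic_galois_group
       \<lparr>carrier := cyclotomic_krull_topology closure_of generate cyclotomic_galois_group {gamma_elem}\<rparr>
     else cyclotomic_galois_group)"

definition Gamma_topology :: "('k::field_prime_char frac_closure \<Rightarrow> 'k frac_closure) topology" where
  "Gamma_topology = subtopology cyclotomic_krull_topology (carrier Gamma_group)"

text \<open>The \<open>W\<close>-linear action on \<open>R\<close> with \<open>g(q) = q ^ \<chi>(g)\<close>: substitute \<open>q ^ \<chi>(g) - 1\<close> for \<open>q - 1\<close>.\<close>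

definition Gamma_act :: "('k::field_prime_char frac_closure \<Rightarrow> 'k frac_closure) \<Rightarrow>
    'k witt fps \<Rightarrow> 'k witt fps" where
  "Gamma_act g f = fps_compose f (qpower (cyclotomic_character g) - 1)"


section \<open>Modules over \<open>R\<close>\<close>

abbreviation R_ring :: "'k::field_prime_char witt fps ring" where
  "R_ring \<equiv> ring_of_type_algebra"

definition finite_free :: "('k::field_prime_char witt fps, 'm) module \<Rightarrow> bool" where
  "finite_free M \<longleftrightarrow> Module.module R_ring M \<and>
     (\<exists>B. finite B \<and> B \<subseteq> carrier M \<and>
       (\<forall>m\<in>carrier M. \<exists>!c. c \<in> B \<rightarrow>\<^sub>E UNIV \<and> m = (\<Oplus>\<^bsub>M\<^esub>b\<in>B. c b \<odot>\<^bsub>M\<^esub> b)))"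

text \<open>The submodule \<open>(p, q - 1)\<^sup>n M\<close>\<close>

primrec pq_filtration :: "('k::field_prime_char witt fps, 'm) module \<Rightarrow> nat \<Rightarrow> 'm set" where
  "pq_filtration M 0 = carrier M"
| "pq_filtration M (Suc n) =
     {of_nat CHAR('k) \<odot>\<^bsub>M\<^esub> x \<oplus>\<^bsub>M\<^esub> (qvar - 1) \<odot>\<^bsub>M\<^esub> y | x y.
        x \<in> pq_filtration M n \<and> y \<in> pq_filtration M n}"

definition pq_adic_topology :: "('k::field_prime_char witt fps, 'm) module \<Rightarrow> 'm topology" where
  "pq_adic_topology M = topology_generated_by
     {{m \<oplus>\<^bsub>M\<^esub> x | x. x \<in> pq_filtration M n} | m n. m \<in> carrier M}"

definition linear_map :: "('k::field_prime_char witt fps, 'm) module \<Rightarrow>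
    ('k witt fps, 'm) module \<Rightarrow> ('m \<Rightarrow> 'm) \<Rightarrow> bool" where
  "linear_map M N f \<longleftrightarrow> f \<in> carrier M \<rightarrow>\<^sub>E carrier N \<and>
     (\<forall>x\<in>carrier M. \<forall>y\<in>carrier M. f (x \<oplus>\<^bsub>M\<^esub> y) = f x \<oplus>\<^bsub>N\<^esub> f y) \<and>
     (\<forall>r. \<forall>x\<in>carrier M. f (r \<odot>\<^bsub>M\<^esub> x) = r \<odot>\<^bsub>N\<^esub> f x)"


subsection \<open>\<open>\<Gamma>\<close>-modules\<close>

type_synonym ('k, 'm) gamma_structure =
  "('k witt fps, 'm) module \<times> (('k frac_closure \<Rightarrow> 'k frac_closure) \<Rightarrow> 'm \<Rightarrow> 'm)"

definition is_gamma_module :: "('k::field_prime_char, 'm) gamma_structure \<Rightarrow> bool" where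
  "is_gamma_module = (\<lambda>(M, \<rho>). Module.module R_ring M \<and>
     \<rho> \<in> carrier Gamma_group \<rightarrow>\<^sub>E (carrier M \<rightarrow>\<^sub>E carrier M) \<and>
     (\<forall>x\<in>carrier M. \<rho> \<one>\<^bsub>Gamma_group\<^esub> x = x) \<and>
     (\<forall>g\<in>carrier Gamma_group. \<forall>h\<in>carrier Gamma_group. \<forall>x\<in>carrier M.
        \<rho> (g \<otimes>\<^bsub>Gamma_group\<^esub> h) x = \<rho> g (\<rho> h x)) \<and>
     (\<forall>g\<in>carrier Gamma_group. \<forall>x\<in>carrier M. \<forall>y\<in>carrier M.
        \<rho> g (x \<oplus>\<^bsub>M\<^esub> y) = \<rho> g x \<oplus>\<^bsub>M\<^esub> \<rho> g y) \<and>
     (\<forall>g\<in>carrier Gamma_group. \<forall>r. \<forall>x\<in>carrier M.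
        \<rho> g (r \<odot>\<^bsub>M\<^esub> x) = Gamma_act g r \<odot>\<^bsub>M\<^esub> \<rho> g x) \<and>
     continuous_map (prod_topology Gamma_topology (pq_adic_topology M)) (pq_adic_topology M)
       (\<lambda>(g, x). \<rho> g x))"

definition trivial_mod_q_minus_1 :: "('k::field_prime_char, 'm) gamma_structure \<Rightarrow> bool" where
  "trivial_mod_q_minus_1 = (\<lambda>(M, \<rho>). \<forall>g\<in>carrier Gamma_group. \<forall>x\<in>carrier M.
     \<exists>y\<in>carrier M. \<rho> g x \<ominus>\<^bsub>M\<^esub> x = (qvar - 1) \<odot>\<^bsub>M\<^esub> y)"

text \<open>\<open>(\<gamma>\<^sub>M - Id) / (q\<^sup>2 - q)\<close>, for \<open>M\<close> torsion-free and trivial modulo \<open>q - 1\<close>\<close>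

definition associated_nabla ::
    "('k::field_prime_char, 'm) gamma_structure \<Rightarrow> 'm \<Rightarrow> 'm" where
  "associated_nabla = (\<lambda>(M, \<rho>). \<lambda>x\<in>carrier M.
     THE y. y \<in> carrier M \<and> (qvar\<^sup>2 - qvar) \<odot>\<^bsub>M\<^esub> y = \<rho> gamma_elem x \<ominus>\<^bsub>M\<^esub> x)"


subsection \<open>\<open>\<nabla>\<close>-modules\<close>

type_synonym ('k, 'm) nabla_structure = "('k witt fps, 'm) module \<times> ('m \<Rightarrow> 'm)"

definition is_nabla_module :: "('k::field_prime_char, 'm) nabla_structure \<Rightarrow> bool" where
  "is_nabla_module = (\<lambda>(M, D). Module.module R_ring M \<and> D \<in> carrier M \<rightarrow>\<^sub>E carrier M \<and>
     (\<forall>x\<in>carrier M. \<forall>y\<in>carrier M. D (x \<oplus>\<^bsub>M\<^esub> y) = D x \<oplus>\<^bsub>M\<^esub> D y) \<and>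
     (\<forall>w. \<forall>x\<in>carrier M. D (fps_const w \<odot>\<^bsub>M\<^esub> x) = fps_const w \<odot>\<^bsub>M\<^esub> D x) \<and>
     (\<forall>x\<in>carrier M. D (qvar \<odot>\<^bsub>M\<^esub> x) =
        q_analog_p \<odot>\<^bsub>M\<^esub> x \<oplus>\<^bsub>M\<^esub> qvar ^ (CHAR('k) + 1) \<odot>\<^bsub>M\<^esub> D x))"

definition weakly_nilpotent :: "('k::field_prime_char, 'm) nabla_structure \<Rightarrow> bool" where
  "weakly_nilpotent = (\<lambda>(M, D).
     let E = (if CHAR('k) = 2 then (\<lambda>x. D (D x) \<ominus>\<^bsub>M\<^esub> D x) else D)
     in \<exists>n. \<forall>x\<in>carrier M. (E ^^ n) x \<in> pq_filtration M 1)"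


section \<open>Categories\<close>

record ('o, 'a) cat =
  Objs :: "'o set"
  Homs :: "'o \<Rightarrow> 'o \<Rightarrow> 'a set"
  Comp :: "'o \<Rightarrow> 'o \<Rightarrow> 'o \<Rightarrow> 'a \<Rightarrow> 'a \<Rightarrow> 'a"
  Idn :: "'o \<Rightarrow> 'a"

definition category :: "('o, 'a) cat \<Rightarrow> bool" where
  "category C \<longleftrightarrow>
     (\<forall>a\<in>Objs C. Idn C a \<in> Homs C a a) \<and>
     (\<forall>a\<in>Objs C. \<forall>b\<in>Objs C. \<forall>c\<in>Objs C. \<forall>f\<in>Homs C a b. \<forall>g\<in>Homs C b c.
        Comp C a b c g f \<in> Homs C a c) \<and>
     (\<forall>a\<in>Objs C. \<forall>b\<in>Objs C. \<forall>f\<in>Homs C a b.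
        Comp C a a b f (Idn C a) = f \<and> Comp C a b b (Idn C b) f = f) \<and>
     (\<forall>a\<in>Objs C. \<forall>b\<in>Objs C. \<forall>c\<in>Objs C. \<forall>d\<in>Objs C.
        \<forall>f\<in>Homs C a b. \<forall>g\<in>Homs C b c. \<forall>h\<in>Homs C c d.
        Comp C a c d h (Comp C a b c g f) = Comp C a b d (Comp C b c d h g) f)"

definition cat_functor :: "('o, 'a) cat \<Rightarrow> ('p, 'b) cat \<Rightarrow>
    ('o \<Rightarrow> 'p) \<Rightarrow> ('o \<Rightarrow> 'o \<Rightarrow> 'a \<Rightarrow> 'b) \<Rightarrow> bool" where
  "cat_functor C D Fo Fm \<longleftrightarrow> category C \<and> category D \<and>
     (\<forall>a\<in>Objs C. Fo a \<in> Objs D) \<and>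
     (\<forall>a\<in>Objs C. \<forall>b\<in>Objs C. \<forall>f\<in>Homs C a b. Fm a b f \<in> Homs D (Fo a) (Fo b)) \<and>
     (\<forall>a\<in>Objs C. Fm a a (Idn C a) = Idn D (Fo a)) \<and>
     (\<forall>a\<in>Objs C. \<forall>b\<in>Objs C. \<forall>c\<in>Objs C. \<forall>f\<in>Homs C a b. \<forall>g\<in>Homs C b c.
        Fm a c (Comp C a b c g f) = Comp D (Fo a) (Fo b) (Fo c) (Fm b c g) (Fm a b f))"

definition cat_isomorphism :: "('o, 'a) cat \<Rightarrow> ('p, 'b) cat \<Rightarrow>
    ('o \<Rightarrow> 'p) \<Rightarrow> ('o \<Rightarrow> 'o \<Rightarrow> 'a \<Rightarrow> 'b) \<Rightarrow> bool" where
  "cat_isomorphism C D Fo Fm \<longleftrightarrow> cat_functor C D Fo Fm \<and>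
     (\<exists>Go Gm. cat_functor D C Go Gm \<and>
        (\<forall>a\<in>Objs C. Go (Fo a) = a) \<and>
        (\<forall>a\<in>Objs C. \<forall>b\<in>Objs C. \<forall>f\<in>Homs C a b. Gm (Fo a) (Fo b) (Fm a b f) = f) \<and>
        (\<forall>a\<in>Objs D. Fo (Go a) = a) \<and>
        (\<forall>a\<in>Objs D. \<forall>b\<in>Objs D. \<forall>f\<in>Homs D a b. Fm (Go a) (Go b) (Gm a b f) = f))"

text \<open>
  The objects of the following categories are all modules whose carrier is a set of elements of
  the (arbitrary) type \<open>'m\<close>, which serves as the universe.
\<close>

definition Gamma_category ::
    "(('k::field_prime_char, 'm) gamma_structure, 'm \<Rightarrow> 'm) cat" where
  "Gamma_category =
    \<lparr>Objs = {(M, \<rho>). is_gamma_module (M, \<rho>) \<and> finite_free M \<and> trivial_mod_q_minus_1 (M, \<rho>) \<and>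
        weakly_nilpotent (M, associated_nabla (M, \<rho>))},
     Homs = (\<lambda>(M, \<rho>) (N, \<sigma>). {f. linear_map M N f \<and>
        (\<forall>g\<in>carrier Gamma_group. \<forall>x\<in>carrier M. f (\<rho> g x) = \<sigma> g (f x))}),
     Comp = (\<lambda>a b c g f. compose (carrier (fst a)) g f),
     Idn = (\<lambda>a. \<lambda>x\<in>carrier (fst a). x)\<rparr>"

definition nabla_category ::
    "(('k::field_prime_char, 'm) nabla_structure, 'm \<Rightarrow> 'm) cat" where
  "nabla_category =
    \<lparr>Objs = {(M, D). is_nabla_module (M, D) \<and> finite_free M \<and> weakly_nilpotent (M, D)},
     Homs = (\<lambda>(M, D) (N, D'). {f. linear_map M N f \<and> (\<forall>x\<in>carrier M. f (D x) = D' (f x))}),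
     Comp = (\<lambda>a b c g f. compose (carrier (fst a)) g f),
     Idn = (\<lambda>a. \<lambda>x\<in>carrier (fst a). x)\<rparr>"

end

theory Submission
  imports Defs "HOL-Number_Theory.Residues"
begin

text \<open>
  Weak nilpotence is the same condition on both sides, so the point is that a \<open>\<nabla>\<close>-structure
  \<open>\<partial>\<close> on \<open>M\<close> integrates to a unique action of \<open>\<Gamma>\<close>. The Leibniz rule for \<open>\<partial>\<close> says precisely that
  \<open>\<gamma>\<^sub>M = 1 + (q\<^sup>2 - q) \<partial>\<close> is \<open>\<gamma>\<close>-semilinear. Since \<open>\<gamma>\<^sub>M - 1\<close> maps \<open>(p, q - 1)\<^sup>j M\<close> into
  \<open>(p, q - 1)\<^sup>j\<^sup>+\<^sup>1 M\<close>, the operator \<open>\<gamma>\<^sub>M ^ (p ^ k) - 1\<close> raises this filtration by \<open>k + 1\<close>, so that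
  \<open>m \<mapsto> \<gamma>\<^sub>M ^ m\<close> extends continuously from the powers of \<open>\<gamma>\<close> to their closure \<open>\<Gamma> \<cong> \<int>\<^sub>p\<close>.
  Conversely continuity forces an action of \<open>\<Gamma>\<close>, as well as equivariance of a linear map, to be
  determined by \<open>\<gamma>\<close>.

  On the arithmetic side, \<open>\<gamma>\<close> exists because the cyclotomic polynomials of \<open>p\<close>-power order are
  irreducible over \<open>Frac W\<close> (Eisenstein, as \<open>p\<close> is a prime element of \<open>W\<close>), and it generates \<open>\<Gamma>\<close>
  topologically because \<open>1 + p\<close> generates \<open>1 + p \<int>\<^sub>p\<close> for odd \<open>p\<close> (for \<open>p = 2\<close>, by the definition
  of \<open>\<Gamma>\<close>); lifting the exponent gives \<open>\<Gamma> \<cong> \<int>\<^sub>p\<close> in all cases.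
\<close>

section \<open>Witt vectors over a perfect field\<close>

text \<open>The constants come from the identity
  \<open>(q\<^sup>2 - q) (p)_q = q ^ (p + 1) - q\<close>: it converts the rule for
  \<open>D (qvar \<odot> x)\<close> into semilinearity of \<open>1 + (q\<^sup>2 - q) D\<close> for
  the scalar \<open>q\<close>. As \<open>q\<close> is a unit, divisibility by
  \<open>q\<^sup>2 - q\<close> is divisibility by \<open>q - 1\<close>, which is what triviality
  modulo \<open>q - 1\<close> provides. Two obstacles shape the proof. The operator of a
  nabla-module is additive, \<open>W\<close>-linear and controlled on \<open>q\<close>, but not
  assumed continuous, so scalars that are power series cannot be reached as limits of polynomials;
  instead the failure of semilinearity is shown to be divisible by every power of
  \<open>q - 1\<close>. And elements of the Galois group are field automorphisms, not p-adic
  integers: each one is attached, at every finite level, to natural exponents of \<gamma>, unique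
  modulo a power of \<open>p\<close>, and all limits run along these exponents. The result is an
  isomorphism rather than an equivalence because both constructions keep the underlying module and
  the morphism sets are equal as sets of maps, so everything reduces to a bijection on
  objects.\<close>

context
  fixes p :: nat
  assumes p: "Factorial_Ring.prime (p::nat)"
begin

text \<open>Ghost components up to \<open>i\<close> determine \<open>s i\<close>, because
  \<open>p ^ i\<close> can be cancelled over the integers. With a substitution that kills late
  variables this bounds the variables occurring in a Witt polynomial.\<close>

lemma meval_fixes_witt_polys:
  fixes s :: "nat \<Rightarrow> int_mpoly"
  assumes "\<And>i. i \<le> n \<Longrightarrow> meval \<sigma> (ghost p s i) = ghost p s i" "i \<le> n"
  shows "meval \<sigma> (s i) = s i"
  using assms(2)
proof (induction i rule: less_induct)
  case (less i)
  have "ghost p (\<lambda>i. meval \<sigma> (s i)) i = ghost p s i"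
    using assms(1)[OF less.prems] by (simp add: meval_ghost)
  moreover have "(\<Sum>j<i. of_nat (p ^ j) * meval \<sigma> (s j) ^ (p ^ (i - j)))
      = (\<Sum>j<i. of_nat (p ^ j) * s j ^ (p ^ (i - j)))"
    using less by (intro sum.cong) auto
  ultimately have "of_nat (p ^ i) * meval \<sigma> (s i) = of_nat (p ^ i) * s i"
    by (simp add: ghost_last)
  thus ?case using p by (simp add: prime_gt_0_nat)
qed

lemma witt_add_cong:
  assumes "\<And>i. i \<le> n \<Longrightarrow> a i = a' i" "\<And>i. i \<le> n \<Longrightarrow> b i = b' i"
  shows "witt_add p a b n = witt_add p a' b' n"
proof -
  \<comment> \<open>The substitution kills the variables \<open>Xvar i\<close> and
    \<open>Yvar i\<close> with \<open>i > n\<close>, which do not occur in the ghost components up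
    to \<open>n\<close>.\<close>
  define \<sigma> where "\<sigma> j = (if j \<le> 2 * n + 1 then mvar j else 0 :: int_mpoly)" for j
  define S where "S = witt_polys p (\<lambda>n. ghost p Xvar n + ghost p Yvar n)"
  have gh: "ghost p S i = ghost p Xvar i + ghost p Yvar i" for i
    unfolding S_def by (rule ghost_add_polys[OF p])
  have "meval \<sigma> (ghost p S i) = ghost p S i" if "i \<le> n" for i
    unfolding gh meval_add meval_ghost unfolding ghost_def using that
    by (intro arg_cong2[of _ _ _ _ "(+)"] sum.cong) (auto simp: \<sigma>_def)
  hence \<sigma>: "meval \<sigma> (S n) = S n"
    by (rule meval_fixes_witt_polys) auto
  have "meval (interleave a b) (\<sigma> j) = meval (interleave a' b') (\<sigma> j)" for j
    using assms by (auto simp: \<sigma>_def interleave_def)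
  hence "meval (interleave a b) (meval \<sigma> (S n)) = meval (interleave a' b') (meval \<sigma> (S n))"
    by (simp add: meval_meval)
  thus ?thesis unfolding witt_add_def S_def[symmetric] \<sigma> .
qed

text \<open>Lets an integer multiple of \<open>1\<close> be computed over \<open>int_mpoly\<close>,
  where ghost components decide equality and congruence, and then be specialised.\<close>

lemma meval_witt_of_nat:
  "((witt_add p witt_one ^^ m) witt_zero) = (\<lambda>n. meval \<phi> (((witt_add p witt_one ^^ m) witt_zero) n))"
proof (induction m)
  case 0
  show ?case using meval_witt_zero[OF p, of \<phi>] by (simp add: fun_eq_iff)
next
  case (Suc m)
  have "(witt_add p witt_one ^^ Suc m) witt_zero
      = witt_add p (\<lambda>n. meval \<phi> (witt_one n)) (\<lambda>n. meval \<phi> (((witt_add p witt_one ^^ m) witt_zero) n))"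
    using Suc meval_witt_one[OF p, of \<phi>] by simp
  also have "\<dots> = (\<lambda>n. meval \<phi> (((witt_add p witt_one ^^ Suc m) witt_zero) n))"
    unfolding meval_witt_add[OF p] by simp
  finally show ?case .
qed

lemma ghost_witt_of_nat: "ghost p ((witt_add p witt_one ^^ m) witt_zero) n = of_nat m"
  by (induction m) (simp_all add: ghost_witt[OF p])

text \<open>The ghost components of \<open>p\<close> are \<open>p, p, p, ...\<close> and those of
  V(1) are \<open>0, p, p, ...\<close>. They agree modulo \<open>p ^ (n + 1)\<close> in each degree
  \<open>n\<close>, so the coordinates agree modulo \<open>p\<close>, that is, in characteristic
  \<open>p\<close>.\<close>

lemma witt_of_nat_p:
  assumes "of_nat p = (0 :: 'a :: comm_ring_1)"
  shows "((witt_add p witt_one ^^ p) witt_zero) = witt_V (witt_one :: nat \<Rightarrow> 'a)"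
proof
  fix n
  define s t :: "nat \<Rightarrow> int_mpoly"
    where "s = (witt_add p witt_one ^^ p) witt_zero" and "t = witt_V witt_one"
  define \<phi> :: "nat \<Rightarrow> 'a" where "\<phi> = (\<lambda>_. 0)"
  have "of_nat (p ^ Suc n) dvd ghost p s n - ghost p t n" for n
    by (cases n) (simp_all add: s_def t_def ghost_witt_of_nat ghost_witt_V[OF p] ghost_witt[OF p])
  hence "of_nat p dvd s n - t n" by (rule ghost_cong_imp[OF p])
  then obtain x where "s n - t n = of_nat p * x" by (elim dvdE)
  hence "meval \<phi> (s n - t n) = 0" by (simp add: meval_mult assms)
  hence "meval \<phi> (s n) = meval \<phi> (t n)" by (simp add: meval_diff)
  moreover have "(witt_add p witt_one ^^ p) witt_zero n = meval \<phi> (s n)"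
    using fun_cong[OF meval_witt_of_nat[of p \<phi>], of n] by (simp add: s_def)
  moreover have "witt_V witt_one n = meval \<phi> (t n)"
    by (auto simp: t_def witt_V_def[OF p] witt_one_def)
  ultimately show "(witt_add p witt_one ^^ p) witt_zero n = witt_V (witt_one :: nat \<Rightarrow> 'a) n"
    by simp
qed

end

section \<open>Multiplication by \<open>p\<close> in Witt coordinates\<close>

lemma witt_nth_of_nat:
  "witt_nth (of_nat m :: 'a::comm_ring_prime_char witt) = (witt_add CHAR('a) witt_one ^^ m) witt_zero"
  by (induction m) (simp_all add: zero_witt.rep_eq one_witt.rep_eq plus_witt.rep_eq)

lemma witt_nth_char_mult:
  fixes b :: "'a::comm_ring_prime_char witt"
  shows "witt_nth (of_nat CHAR('a) * b) = witt_V (\<lambda>n. witt_nth b n ^ CHAR('a))"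
  by (simp add: times_witt.rep_eq witt_nth_of_nat witt_of_nat_p[OF CHAR_prime]
      witt_V_mult[OF CHAR_prime] witt_mult_one[OF CHAR_prime])

lemma witt_nth_char_power_mult:
  fixes b :: "'a::comm_ring_prime_char witt"
  shows "witt_nth (of_nat CHAR('a) ^ n * b) i =
    (if i < n then 0 else witt_nth b (i - n) ^ (CHAR('a) ^ n))"
proof (induction n arbitrary: i)
  case (Suc n)
  have "CHAR('a) > 0" by simp
  thus ?case
    by (cases i) (auto simp: mult.assoc witt_nth_char_mult witt_V_def[OF CHAR_prime[where ?'a = 'a]] Suc
        power_0_left mult.commute[of "CHAR('a)"] simp flip: power_mult)
qed auto

lemma surj_power_power:
  assumes "surj (\<lambda>x :: 'a::monoid_mult. x ^ p)"
  shows "surj (\<lambda>x :: 'a. x ^ (p ^ n))"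
proof (induction n)
  case (Suc n)
  have "(\<lambda>x :: 'a. x ^ (p ^ Suc n)) = (\<lambda>x. x ^ (p ^ n)) \<circ> (\<lambda>x. x ^ p)"
    by (auto simp: fun_eq_iff simp flip: power_mult)
  thus ?case using comp_surj[OF assms Suc] by (simp only:)
qed simp

lemma witt_eqI: "(\<And>i. witt_nth a i = witt_nth b i) \<Longrightarrow> a = b"
  by (metis witt_nth_inject ext)

text \<open>Coordinates of a difference are not differences of coordinates. The link is that the
  first \<open>n\<close> coordinates of a sum depend only on the first \<open>n\<close> coordinates
  of the summands.\<close>

lemma witt_nth_diff_eq_0_iff:
  fixes a b :: "'a::comm_ring_prime_char witt"
  shows "(\<forall>i<n. witt_nth (a - b) i = 0) \<longleftrightarrow> (\<forall>i<n. witt_nth a i = witt_nth b i)"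
proof
  have *: "witt_nth c i = witt_nth d i" if "\<forall>i<n. witt_nth (c - d) i = 0" "i < n"
    for c d :: "'a witt" and i
  proof -
    have "witt_nth (d + (c - d)) i = witt_nth (d + 0) i"
      unfolding plus_witt.rep_eq using that
      by (intro witt_add_cong[OF CHAR_prime]) (auto simp: zero_witt.rep_eq witt_zero_def)
    thus ?thesis by simp
  qed
  show "\<forall>i<n. witt_nth a i = witt_nth b i" if "\<forall>i<n. witt_nth (a - b) i = 0"
    using *[OF that] by blast
  show "\<forall>i<n. witt_nth (a - b) i = 0" if *: "\<forall>i<n. witt_nth a i = witt_nth b i"
  proof (intro allI impI)
    fix i assume "i < n"
    hence "witt_nth (a + (- b)) i = witt_nth (b + (- b)) i"
      unfolding plus_witt.rep_eq using *
      by (intro witt_add_cong[OF CHAR_prime]) auto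
    thus "witt_nth (a - b) i = 0" by (simp add: zero_witt.rep_eq witt_zero_def)
  qed
qed

lemma char_witt_neq_0: "of_nat CHAR('a) \<noteq> (0 :: 'a::comm_ring_prime_char witt)"
proof
  assume "of_nat CHAR('a) = (0 :: 'a witt)"
  hence "witt_nth (of_nat CHAR('a) ^ 1 * 1 :: 'a witt) 1 = witt_nth 0 1" by simp
  thus False unfolding witt_nth_char_power_mult
    by (simp add: zero_witt.rep_eq one_witt.rep_eq witt_zero_def witt_one_def)
qed

section \<open>The p-adic structure of \<open>W\<close>\<close>

locale perfect_char =
  fixes TYPE_k :: "'k::field_prime_char itself"
  assumes surj_frob: "surj (\<lambda>x :: 'k. x ^ CHAR('k))"
begin

abbreviation pW :: "'k witt" where "pW \<equiv> of_nat CHAR('k)"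

text \<open>Perfectness enters here: multiplication by \<open>p ^ n\<close> shifts coordinates by
  \<open>n\<close> and raises them to the power \<open>p ^ n\<close>, so division requires
  \<open>p ^ n\<close>-th roots in \<open>k\<close>.\<close>

lemma pW_power_dvd_iff: "pW ^ n dvd a \<longleftrightarrow> (\<forall>i<n. witt_nth a i = 0)"
proof
  assume "pW ^ n dvd a"
  thus "\<forall>i<n. witt_nth a i = 0" by (auto elim!: dvdE simp: witt_nth_char_power_mult)
next
  assume *: "\<forall>i<n. witt_nth a i = 0"
  define f where "f = inv_into UNIV (\<lambda>x :: 'k. x ^ (CHAR('k) ^ n))"
  have f: "f x ^ (CHAR('k) ^ n) = x" for x
    unfolding f_def using surj_f_inv_f[OF surj_power_power[OF surj_frob, of n]] by simp
  have "a = pW ^ n * Witt (\<lambda>i. f (witt_nth a (i + n)))"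
    using * by (intro witt_eqI) (auto simp: witt_nth_char_power_mult Witt_inverse f)
  thus "pW ^ n dvd a" by (metis dvd_triv_left)
qed

lemma pW_power_dvd_diff_iff: "pW ^ n dvd a - b \<longleftrightarrow> (\<forall>i<n. witt_nth a i = witt_nth b i)"
  by (simp add: pW_power_dvd_iff witt_nth_diff_eq_0_iff)

lemma witt_separated:
  assumes "\<And>n. pW ^ n dvd a"
  shows "a = 0"
  using assms by (intro witt_eqI) (auto simp: pW_power_dvd_iff zero_witt.rep_eq witt_zero_def)

lemma witt_complete:
  assumes "\<And>n. pW ^ n dvd w (Suc n) - w n"
  shows "\<exists>l. \<forall>n. pW ^ n dvd w n - l"
proof -
  have step: "witt_nth (w (Suc n)) i = witt_nth (w n) i" if "i < n" for i n
    using assms[of n] that by (simp add: pW_power_dvd_diff_iff)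
  have stable: "witt_nth (w n) i = witt_nth (w (Suc i)) i" if "Suc i \<le> n" for i n
    using that by (induction n rule: dec_induct) (auto simp: step)
  show ?thesis
  proof (intro exI allI)
    fix n
    \<comment> \<open>Diagonal limit: coordinate \<open>i\<close> no longer changes from
      \<open>w (Suc i)\<close> on.\<close>
    show "pW ^ n dvd w n - Witt (\<lambda>i. witt_nth (w (Suc i)) i)"
      unfolding pW_power_dvd_diff_iff using stable[of _ n] by (auto simp only: Witt_inverse UNIV_I Suc_le_eq)
  qed
qed

lemma pW_neq_0 [simp]: "pW \<noteq> 0"
  by (rule char_witt_neq_0)

text \<open>Divisibility by \<open>p\<close> is vanishing of coordinate 0, which is multiplicative
  with values in a field.\<close>

lemma pW_dvd_mult: "pW dvd a * b \<Longrightarrow> pW dvd a \<or> pW dvd b"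
  using pW_power_dvd_iff[of 1]
  by (simp add: times_witt.rep_eq witt_mult_0[OF CHAR_prime])

lemma not_pW_dvd_1: "\<not> pW dvd 1"
  using pW_power_dvd_iff[of 1 1] by (simp add: one_witt.rep_eq witt_one_def)

end

section \<open>The \<open>(p, q - 1)\<close>-adic filtration on \<open>R\<close>\<close>

context perfect_char
begin

abbreviation I :: "nat \<Rightarrow> 'k witt fps set" where "I \<equiv> pq_ideal_power"

lemma qvar_minus_1: "(qvar :: 'k witt fps) - 1 = fps_X"
  by (simp add: qvar_def)

text \<open>Each factor \<open>q - 1\<close> moves coefficients up by one place and each factor
  \<open>p\<close> makes them more divisible. Sums, products, separation and completeness of the
  ideal powers are then checked coefficient by coefficient.\<close>

lemma pq_ideal_power_eq: "I n = {f. \<forall>i<n. pW ^ (n - i) dvd fps_nth f i}"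
proof (induction n)
  case (Suc n)
  show ?case
  proof (intro subset_antisym subsetI)
    fix f assume "f \<in> I (Suc n)"
    then obtain a b where ab: "f = of_nat CHAR('k) * a + fps_X * b" "a \<in> I n" "b \<in> I n"
      by (auto simp: qvar_minus_1)
    have "pW ^ (Suc n - i) dvd fps_nth f i" if "i < Suc n" for i
    proof -
      have "pW ^ (Suc n - i) dvd pW * fps_nth a i"
      proof (cases "i < n")
        case True
        hence "pW ^ (n - i) dvd fps_nth a i" using ab(2) by (simp add: Suc)
        thus ?thesis using True by (simp add: Suc_diff_le)
      next
        case False
        hence "i = n" using that by simp
        thus ?thesis by simp
      qed
      moreover have "pW ^ (Suc n - i) dvd fps_nth b (i - 1)" if "i > 0"
        using ab(3) that \<open>i < Suc n\<close> unfolding Suc by (cases i) auto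
      ultimately show ?thesis
        by (auto simp: ab(1) fps_of_nat[symmetric])
    qed
    thus "f \<in> {f. \<forall>i<Suc n. pW ^ (Suc n - i) dvd fps_nth f i}" by blast
  next
    fix f assume "f \<in> {f. \<forall>i<Suc n. pW ^ (Suc n - i) dvd fps_nth f i}"
    hence *: "\<And>i. i < Suc n \<Longrightarrow> pW ^ (Suc n - i) dvd fps_nth f i" by blast
    from *[of 0] obtain w where w: "fps_nth f 0 = pW ^ Suc n * w" by (auto elim: dvdE)
    \<comment> \<open>Only the constant term has to give up a factor \<open>p\<close>; all other
      terms are absorbed by a shift.\<close>
    have "f = of_nat CHAR('k) * fps_const (pW ^ n * w) + fps_X * fps_shift 1 f"
      by (rule fps_ext) (auto simp: w fps_of_nat[symmetric] mult_ac)
    moreover have "fps_const (pW ^ n * w) \<in> I n" unfolding Suc by auto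
    moreover have "fps_shift 1 f \<in> I n" unfolding Suc using * by force
    ultimately show "f \<in> I (Suc n)" by (auto simp: qvar_minus_1)
  qed
qed auto

declare pq_ideal_power.simps [simp del]

lemma pq_nthD: "f \<in> I n \<Longrightarrow> i < n \<Longrightarrow> pW ^ (n - i) dvd fps_nth f i"
  and pq_nthI: "(\<And>i. i < n \<Longrightarrow> pW ^ (n - i) dvd fps_nth f i) \<Longrightarrow> f \<in> I n"
  by (simp_all add: pq_ideal_power_eq)

lemma pq_add: "f \<in> I n \<Longrightarrow> g \<in> I n \<Longrightarrow> f + g \<in> I n"
  and pq_diff: "f \<in> I n \<Longrightarrow> g \<in> I n \<Longrightarrow> f - g \<in> I n"
  and pq_zero [simp]: "0 \<in> I n"
  and pq_0 [simp]: "I 0 = UNIV"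
  by (auto simp: pq_ideal_power_eq)

lemma pq_uminus: "f \<in> I n \<Longrightarrow> - f \<in> I n"
  using pq_diff[of 0 n f] by simp

lemma pq_antimono: "f \<in> I n \<Longrightarrow> m \<le> n \<Longrightarrow> f \<in> I m"
  by (rule pq_nthI) (auto intro: power_le_dvd[OF pq_nthD diff_le_mono])

lemma pq_mult:
  assumes "f \<in> I m" "g \<in> I n"
  shows "f * g \<in> I (m + n)"
  unfolding pq_ideal_power_eq mem_Collect_eq
proof (intro allI impI)
  fix i assume i: "i < m + n"
  show "pW ^ (m + n - i) dvd fps_nth (f * g) i"
    unfolding fps_mult_nth
  proof (rule dvd_sum)
    fix j assume j: "j \<in> {0..i}"
    have "pW ^ (m - j) dvd fps_nth f j" using assms(1) by (cases "j < m") (auto simp: pq_ideal_power_eq)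
    moreover have "pW ^ (n - (i - j)) dvd fps_nth g (i - j)"
      using assms(2) by (cases "i - j < n") (auto simp: pq_ideal_power_eq)
    ultimately have "pW ^ (m - j + (n - (i - j))) dvd fps_nth f j * fps_nth g (i - j)"
      by (simp add: power_add mult_dvd_mono)
    moreover have "m + n - i \<le> m - j + (n - (i - j))" using j by auto
    ultimately show "pW ^ (m + n - i) dvd fps_nth f j * fps_nth g (i - j)"
      by (rule power_le_dvd)
  qed
qed

lemma pq_mult_left: "g \<in> I n \<Longrightarrow> f * g \<in> I n"
  using pq_mult[of f 0 g n] by simp

lemma pq_mult_right: "f \<in> I n \<Longrightarrow> f * g \<in> I n"
  using pq_mult_left[of f n g] by (simp add: mult.commute)

lemma pq_sum: "(\<And>i. i \<in> A \<Longrightarrow> f i \<in> I n) \<Longrightarrow> sum f A \<in> I n"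
  by (induction A rule: infinite_finite_induct) (auto intro: pq_add)

lemma p_in_pq: "of_nat CHAR('k) \<in> I 1"
  and X_in_pq: "fps_X \<in> I 1"
  by (auto simp: pq_ideal_power_eq simp flip: fps_of_nat)

lemma pq_separated:
  assumes "\<And>n. f \<in> I n"
  shows "f = 0"
proof (rule fps_ext)
  fix i
  have "pW ^ n dvd fps_nth f i" for n
  proof (rule power_le_dvd)
    show "pW ^ (n + Suc i - i) dvd fps_nth f i" by (rule pq_nthD[OF assms]) simp
  qed simp
  thus "fps_nth f i = fps_nth 0 i" using witt_separated by simp
qed

lemma pq_complete:
  assumes "\<And>n. f (Suc n) - f n \<in> I n"
  shows "\<exists>l. \<forall>n. f n - l \<in> I n"
proof -
  \<comment> \<open>Membership in \<open>I (n + i)\<close> controls coefficient \<open>i\<close>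
    only modulo \<open>pW ^ n\<close>, hence the index shift by \<open>i\<close>.\<close>
  have "\<exists>l. \<forall>n. pW ^ n dvd fps_nth (f (n + i)) i - l" for i
  proof (rule witt_complete)
    fix n
    show "pW ^ n dvd fps_nth (f (Suc n + i)) i - fps_nth (f (n + i)) i"
      using assms[of "n + i"] unfolding pq_ideal_power_eq by (cases "n = 0") (auto dest!: spec[of _ i])
  qed
  then obtain l where l: "\<And>i n. pW ^ n dvd fps_nth (f (n + i)) i - l i" by metis
  have "f n - Abs_fps l \<in> I n" for n
    unfolding pq_ideal_power_eq mem_Collect_eq
  proof (intro allI impI)
    fix i assume "i < n"
    thus "pW ^ (n - i) dvd fps_nth (f n - Abs_fps l) i" using l[of "n - i" i] by simp
  qed
  thus ?thesis by blast
qed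

lemma power_p_in_pq:
  assumes "y - 1 \<in> I (Suc n)"
  shows "y ^ CHAR('k) - 1 \<in> I (Suc (Suc n))"
proof -
  have 1: "y ^ i - 1 \<in> I 1" for i
  proof (induction i)
    case (Suc i)
    have "y ^ Suc i - 1 = y * (y ^ i - 1) + (y - 1)" by (simp add: algebra_simps)
    thus ?case using Suc pq_antimono[OF assms, of 1] by (simp only: pq_add pq_mult_left)
  qed simp
  \<comment> \<open>The cofactor of \<open>y - 1\<close> in \<open>y ^ p - 1\<close> is a sum of
    \<open>p\<close> terms congruent to 1, so it lies in \<open>I 1\<close> and gains the extra
    step.\<close>
  have "(\<Sum>i<CHAR('k). y ^ i) = (\<Sum>i<CHAR('k). y ^ i - 1) + of_nat CHAR('k)"
    by (simp add: sum_subtractf)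
  hence "(\<Sum>i<CHAR('k). y ^ i) \<in> I 1"
    using 1 p_in_pq by (simp only: pq_add pq_sum)
  hence "(y - 1) * (\<Sum>i<CHAR('k). y ^ i) \<in> I (Suc n + 1)" using assms pq_mult by blast
  thus ?thesis by (simp add: power_diff_1_eq)
qed

lemma qvar_power_p_power: "qvar ^ (CHAR('k) ^ n) - 1 \<in> I (Suc n)"
proof (induction n)
  case 0
  show ?case using X_in_pq by (simp add: qvar_minus_1)
next
  case (Suc n)
  show ?case using power_p_in_pq[OF Suc] by (simp add: mult.commute flip: power_mult)
qed

lemma power_minus_1_in_pq: "y - 1 \<in> I n \<Longrightarrow> y ^ k - 1 \<in> I n"
  by (simp only: power_diff_1_eq pq_mult_right)

lemma qvar_power_cong:
  assumes "[a = b] (mod CHAR('k) ^ n)"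
  shows "qvar ^ a - qvar ^ b \<in> I n"
proof -
  have *: "qvar ^ (b + CHAR('k) ^ n * k) - qvar ^ b \<in> I n" for b k
  proof -
    have "qvar ^ (CHAR('k) ^ n) - 1 \<in> I n"
      using pq_antimono[OF qvar_power_p_power] by simp
    hence "(qvar ^ (CHAR('k) ^ n)) ^ k - 1 \<in> I n" by (rule power_minus_1_in_pq)
    hence "qvar ^ b * ((qvar ^ (CHAR('k) ^ n)) ^ k - 1) \<in> I n" by (rule pq_mult_left)
    thus ?thesis by (simp add: right_diff_distrib power_add flip: power_mult)
  qed
  let ?r = "a mod CHAR('k) ^ n"
  have "qvar ^ (?r + CHAR('k) ^ n * (a div CHAR('k) ^ n)) - qvar ^ ?r \<in> I n"
    "qvar ^ (?r + CHAR('k) ^ n * (b div CHAR('k) ^ n)) - qvar ^ ?r \<in> I n" by (rule *)+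
  moreover have "?r + CHAR('k) ^ n * (a div CHAR('k) ^ n) = a" by simp
  moreover have "?r + CHAR('k) ^ n * (b div CHAR('k) ^ n) = b"
    using assms by (simp add: cong_def)
  ultimately have "qvar ^ a - qvar ^ ?r \<in> I n" "qvar ^ b - qvar ^ ?r \<in> I n" by simp_all
  from pq_diff[OF this] show ?thesis by simp
qed

text \<open>Replaces the limit in the definition of \<open>qpower\<close> by an explicit rate.
  Coherent exponents make the powers of \<open>q\<close> Cauchy, and separatedness makes the limit
  unique.\<close>

lemma qpower_approx:
  assumes a: "\<And>n. [a (Suc n) = a n] (mod CHAR('k) ^ n)"
  shows "qvar ^ a n - qpower a \<in> I n"
proof -
  have step: "qvar ^ a (Suc n) - qvar ^ a n \<in> I n" for n
    by (intro qvar_power_cong a)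
  then obtain l where l: "\<And>n. qvar ^ a n - l \<in> I n" using pq_complete[of "\<lambda>n. qvar ^ a n"] by blast
  have "qpower a = l"
    unfolding qpower_def
  proof (rule the_equality)
    show "\<forall>N. \<exists>n\<^sub>0. \<forall>n\<ge>n\<^sub>0. qvar ^ a n - l \<in> I N"
      using pq_antimono[OF l] by blast
    fix r assume r: "\<forall>N. \<exists>n\<^sub>0. \<forall>n\<ge>n\<^sub>0. qvar ^ a n - r \<in> I N"
    have "r - l \<in> I N" for N
    proof -
      from r obtain n0 where "\<forall>n\<ge>n0. qvar ^ a n - r \<in> I N" by blast
      hence "qvar ^ a (max n0 N) - r \<in> I N" by simp
      moreover have "qvar ^ a (max n0 N) - l \<in> I N" by (intro pq_antimono[OF l]) simp
      ultimately have "(qvar ^ a (max n0 N) - l) - (qvar ^ a (max n0 N) - r) \<in> I N" by (rule pq_diff[rotated])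
      thus ?thesis by simp
    qed
    from pq_separated[OF this] show "r = l" by simp
  qed
  thus ?thesis using l by simp
qed

text \<open>Coefficient \<open>i\<close> of a composition is a finite sum of terms
  \<open>fps_nth f j * fps_nth (A ^ j) i\<close>, and \<open>A - B\<close> divides
  \<open>A ^ j - B ^ j\<close>.\<close>

lemma fps_compose_cong_pq:
  assumes "A - B \<in> I n"
  shows "fps_compose f A - fps_compose f B \<in> I n"
proof (rule pq_nthI)
  fix i assume i: "i < n"
  have "pW ^ (n - i) dvd fps_nth f j * fps_nth (A ^ j) i - fps_nth f j * fps_nth (B ^ j) i" for j
  proof -
    have "A ^ j - B ^ j \<in> I n"
      by (subst power_diff_sumr2) (rule pq_mult_right[OF assms])
    from pq_nthD[OF this i] have "pW ^ (n - i) dvd fps_nth f j * (fps_nth (A ^ j) i - fps_nth (B ^ j) i)"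
      by (intro dvd_mult) (simp only: fps_sub_nth)
    thus ?thesis by (simp only: right_diff_distrib)
  qed
  thus "pW ^ (n - i) dvd fps_nth (fps_compose f A - fps_compose f B) i"
    unfolding fps_compose_nth fps_sub_nth by (rule dvd_diff_sum)
qed

end

section \<open>Evaluation of polynomials along a ring homomorphism\<close>

locale coeff_hom =
  fixes h :: "'a::comm_ring_1 \<Rightarrow> 'b::comm_ring_1"
  assumes h_add: "h (x + y) = h x + h y"
    and h_mult: "h (x * y) = h x * h y"
    and h_1: "h 1 = 1"
begin

lemma h_0: "h 0 = 0"
  using h_add[of 0 0] by simp

lemma h_uminus: "h (- x) = - h x"
  using h_add[of x "- x"] h_0 by (simp add: eq_neg_iff_add_eq_0 add.commute)

lemma h_of_nat: "h (of_nat n) = of_nat n"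
  by (induction n) (auto simp: h_0 h_1 h_add)

text \<open>Serves two coefficient rings with values in one algebraic closure: the fraction field of
  \<open>W\<close> to describe the tower, and \<open>W\<close> itself for Eisenstein.\<close>

definition ev :: "'a poly \<Rightarrow> 'b \<Rightarrow> 'b" where
  "ev f x = poly (map_poly h f) x"

lemma ev_0 [simp]: "ev 0 x = 0"
  by (simp add: ev_def)

lemma ev_pCons [simp]: "ev (pCons a f) x = h a + x * ev f x"
  by (simp add: ev_def map_poly_pCons h_0)

lemma ev_1 [simp]: "ev 1 x = 1"
  by (simp add: one_pCons h_1)

lemma ev_add: "ev (f + g) x = ev f x + ev g x"
  by (induction f g rule: poly_induct2) (auto simp: h_add h_0 algebra_simps)

lemma ev_smult: "ev (Polynomial.smult a f) x = h a * ev f x"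
  by (induction f) (auto simp: h_mult algebra_simps)

lemma ev_uminus: "ev (- f) x = - ev f x"
  using ev_smult[of "- 1" f x] by (simp add: h_uminus h_1)

lemma ev_diff: "ev (f - g) x = ev f x - ev g x"
  using ev_add[of f "- g" x] by (simp add: ev_uminus)

lemma ev_mult: "ev (f * g) x = ev f x * ev g x"
  by (induction f) (auto simp: ev_add ev_smult h_0 algebra_simps)

lemma ev_power: "ev (f ^ n) x = ev f x ^ n"
  by (induction n) (auto simp: ev_mult)

lemma ev_monom: "ev (Polynomial.monom a n) x = h a * x ^ n"
  by (induction n) (auto simp: monom_Suc monom_0 h_0 algebra_simps)

lemma ev_pcompose: "ev (pcompose f g) x = ev f (ev g x)"
  by (induction f) (auto simp: pcompose_pCons ev_add ev_mult)

end

section \<open>Eisenstein's criterion\<close>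

locale prime_element =
  fixes \<pi> :: "'a::idom"
  assumes pi_neq_0: "\<pi> \<noteq> 0"
    and pi_dvd_mult: "\<pi> dvd a * b \<Longrightarrow> \<pi> dvd a \<or> \<pi> dvd b"
    and pi_not_dvd_1: "\<not> \<pi> dvd 1"
    and pi_separated: "(\<And>n. \<pi> ^ n dvd a) \<Longrightarrow> a = 0"
begin

text \<open>Separatedness bounds how often \<pi> divides a nonzero coefficient; the induction runs
  on this bound \<open>N\<close>. "Primitive" here refers to the single prime \<pi>.\<close>

lemma primitive_decomposition:
  fixes f :: "'a poly"
  assumes "f \<noteq> 0"
  obtains n g where "f = Polynomial.smult (\<pi> ^ n) g" "\<not> [:\<pi>:] dvd g"
proof -
  from assms obtain i where "Polynomial.coeff f i \<noteq> 0" by (auto simp: poly_eq_iff)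
  then obtain N where "\<not> \<pi> ^ N dvd Polynomial.coeff f i" using pi_separated by blast
  hence "\<exists>n g. f = Polynomial.smult (\<pi> ^ n) g \<and> \<not> [:\<pi>:] dvd g"
  proof (induction N arbitrary: f)
    case (Suc N)
    show ?case
    proof (cases "[:\<pi>:] dvd f")
      case True
      then obtain g where g: "f = Polynomial.smult \<pi> g" by (auto elim!: dvdE)
      with Suc.prems have "\<not> \<pi> ^ N dvd Polynomial.coeff g i" using pi_neq_0 by auto
      from Suc.IH[OF this] obtain n g' where "g = Polynomial.smult (\<pi> ^ n) g'" "\<not> [:\<pi>:] dvd g'"
        by blast
      thus ?thesis using g by (intro exI[of _ "Suc n"] exI[of _ g']) auto
    next
      case False
      thus ?thesis by (intro exI[of _ 0] exI[of _ f]) auto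
    qed
  qed auto
  thus thesis using that by blast
qed

lemma primitive_least_coeff:
  assumes "\<not> [:\<pi>:] dvd f"
  obtains i where "\<not> \<pi> dvd Polynomial.coeff f i" "\<And>j. j < i \<Longrightarrow> \<pi> dvd Polynomial.coeff f j"
    "i \<le> Polynomial.degree f"
proof -
  define i where "i = (LEAST i. \<not> \<pi> dvd Polynomial.coeff f i)"
  have ex: "\<exists>i. \<not> \<pi> dvd Polynomial.coeff f i" using assms by (simp add: const_poly_dvd_iff)
  show thesis
  proof (rule that)
    show 1: "\<not> \<pi> dvd Polynomial.coeff f i" unfolding i_def using ex by (rule LeastI_ex)
    show "\<pi> dvd Polynomial.coeff f j" if "j < i" for j
      using not_less_Least[of j] that unfolding i_def by blast
    show "i \<le> Polynomial.degree f" using 1 coeff_eq_0[of f i] by (cases "i \<le> Polynomial.degree f") auto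
  qed
qed

text \<open>In the convolution sum every term except the one at \<open>(i, j)\<close> has a factor
  standing before its least position. Beyond Gauss's lemma this locates the nonzero coefficient
  modulo \<pi>, which the Eisenstein argument needs.\<close>

lemma least_coeff_mult:
  assumes "\<not> \<pi> dvd Polynomial.coeff f i" "\<And>k. k < i \<Longrightarrow> \<pi> dvd Polynomial.coeff f k"
    and "\<not> \<pi> dvd Polynomial.coeff g j" "\<And>k. k < j \<Longrightarrow> \<pi> dvd Polynomial.coeff g k"
  shows "\<not> \<pi> dvd Polynomial.coeff (f * g) (i + j)"
proof
  assume *: "\<pi> dvd Polynomial.coeff (f * g) (i + j)"
  have "Polynomial.coeff (f * g) (i + j) = (\<Sum>k\<le>i + j. Polynomial.coeff f k * Polynomial.coeff g (i + j - k))"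
    by (rule coeff_mult)
  also have "\<dots> = Polynomial.coeff f i * Polynomial.coeff g j
      + (\<Sum>k\<in>{..i + j} - {i}. Polynomial.coeff f k * Polynomial.coeff g (i + j - k))"
    by (subst sum.remove[of _ i]) auto
  finally have eq: "Polynomial.coeff (f * g) (i + j) = \<dots>" .
  have "\<pi> dvd (\<Sum>k\<in>{..i + j} - {i}. Polynomial.coeff f k * Polynomial.coeff g (i + j - k))"
  proof (rule dvd_sum)
    fix k assume "k \<in> {..i + j} - {i}"
    hence "k < i \<or> i + j - k < j" by auto
    thus "\<pi> dvd Polynomial.coeff f k * Polynomial.coeff g (i + j - k)" using assms(2,4) by auto
  qed
  from * this have "\<pi> dvd Polynomial.coeff f i * Polynomial.coeff g j"
    unfolding eq by (simp only: dvd_add_left_iff)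
  thus False using pi_dvd_mult assms(1,3) by blast
qed

lemma primitive_mult:
  assumes "\<not> [:\<pi>:] dvd f" "\<not> [:\<pi>:] dvd g"
  shows "\<not> [:\<pi>:] dvd f * g"
proof -
  obtain i j where "\<not> \<pi> dvd Polynomial.coeff f i" "\<And>k. k < i \<Longrightarrow> \<pi> dvd Polynomial.coeff f k"
    "\<not> \<pi> dvd Polynomial.coeff g j" "\<And>k. k < j \<Longrightarrow> \<pi> dvd Polynomial.coeff g k"
    using primitive_least_coeff[OF assms(1)] primitive_least_coeff[OF assms(2)] by metis
  from least_coeff_mult[OF this] show ?thesis by (auto simp: const_poly_dvd_iff)
qed

lemma smult_power_eq_primitive:
  assumes "Polynomial.smult (\<pi> ^ m) f = Polynomial.smult (\<pi> ^ n) g"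
    and "\<not> [:\<pi>:] dvd f" "\<not> [:\<pi>:] dvd g"
  shows "f = g"
proof -
  have *: "m = n" if "m \<le> n" "Polynomial.smult (\<pi> ^ m) f = Polynomial.smult (\<pi> ^ n) g" "\<not> [:\<pi>:] dvd f"
    for m n and f g :: "'a poly"
  proof (rule ccontr)
    assume "m \<noteq> n"
    hence d: "n = m + Suc d" if "d = n - Suc m" for d using \<open>m \<le> n\<close> that by simp
    define d where "d = n - Suc m"
    note d = d[OF d_def]
    have "Polynomial.smult (\<pi> ^ m) f = Polynomial.smult (\<pi> ^ m) (Polynomial.smult (\<pi> ^ Suc d) g)"
      using that(2) by (simp add: d power_add mult_ac)
    hence "f = Polynomial.smult (\<pi> ^ Suc d) g" using pi_neq_0 by (simp add: poly_eq_iff del: power_Suc)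
    hence "[:\<pi>:] dvd f" by (simp add: const_poly_dvd_iff)
    thus False using that(3) by blast
  qed
  have "m = n" using *[of m n f g] *[of n m g f] assms by (metis nat_le_linear)
  thus ?thesis using assms(1) pi_neq_0 by (simp add: poly_eq_iff)
qed

text \<open>Irreducibility in the form in which it acts on conjugates: \<open>P\<close> generates
  the ideal of polynomials vanishing at \<open>x\<close>. It suffices that \<open>P\<close> has
  least degree among the nonzero ones, since division by the monic \<open>P\<close> then leaves
  remainder zero.\<close>

lemma eisenstein_dvd:
  fixes h :: "'a \<Rightarrow> 'b::idom" and P :: "'a poly"
  assumes hom: "coeff_hom h" and inj: "\<And>x. h x = 0 \<Longrightarrow> x = 0"
    and monic: "Polynomial.lead_coeff P = 1"
    and eis: "\<And>i. i < Polynomial.degree P \<Longrightarrow> \<pi> dvd Polynomial.coeff P i"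
      "\<not> \<pi> ^ 2 dvd Polynomial.coeff P 0"
    and root: "coeff_hom.ev h P x = 0" and f: "coeff_hom.ev h f x = 0"
  shows "P dvd f"
proof -
  interpret coeff_hom h by (rule hom)
  have P0: "P \<noteq> 0" using monic by auto
  have Pprim: "\<not> [:\<pi>:] dvd P"
    using monic pi_not_dvd_1 by (metis const_poly_dvd_iff)
  have min_degree: "Polynomial.degree P \<le> Polynomial.degree g" if "g \<noteq> 0" "ev g x = 0" for g
  proof -
    define S where "S = {g. g \<noteq> 0 \<and> ev g x = 0}"
    define m0 where "m0 = arg_min Polynomial.degree (\<lambda>g. g \<in> S)"
    have "P \<in> S" using P0 root by (simp add: S_def)
    hence m0: "m0 \<in> S" "\<And>g. g \<in> S \<Longrightarrow> Polynomial.degree m0 \<le> Polynomial.degree g"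
      unfolding m0_def by (auto intro: arg_min_natI arg_min_nat_le)
    then obtain v m where m: "m0 = Polynomial.smult (\<pi> ^ v) m" "\<not> [:\<pi>:] dvd m"
      using primitive_decomposition[of m0] by (auto simp: S_def)
    have mS: "m \<in> S" "\<And>g. g \<in> S \<Longrightarrow> Polynomial.degree m \<le> Polynomial.degree g"
      using m0 m pi_neq_0 inj[of "\<pi> ^ v"] by (auto simp: S_def ev_smult)
    hence m_neq_0: "m \<noteq> 0" and m_root: "ev m x = 0" by (auto simp: S_def)
    \<comment> \<open>Minimality of \<open>m\<close> forces \<open>m\<close> to divide a constant
      multiple of \<open>P\<close>. Powers of \<pi> are then removed on both sides, leaving a
      constant \<open>d\<close> prime to \<pi>.\<close>
    obtain q r where qr: "pseudo_divmod P m = (q, r)" by fastforce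
    define c where "c = Polynomial.lead_coeff m ^ (Suc (Polynomial.degree P) - Polynomial.degree m)"
    have c0: "c \<noteq> 0" using m_neq_0 by (simp add: c_def)
    have cP: "Polynomial.smult c P = m * q + r" and r: "r = 0 \<or> Polynomial.degree r < Polynomial.degree m"
      using pseudo_divmod[OF m_neq_0 qr] by (auto simp: c_def)
    have "ev r x = 0"
      using arg_cong[OF cP, of "\<lambda>f. ev f x"] root m_root by (simp add: ev_smult ev_add ev_mult)
    hence "r = 0" using r mS(2)[of r] by (cases "r = 0") (auto simp: S_def)
    hence cP: "Polynomial.smult c P = m * q" using cP by simp
    have q0: "q \<noteq> 0" using cP c0 P0 by auto
    obtain u c' where c': "[:c:] = Polynomial.smult (\<pi> ^ u) c'" "\<not> [:\<pi>:] dvd c'"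
      using primitive_decomposition[of "[:c:]"] c0 by auto
    obtain w q' where q': "q = Polynomial.smult (\<pi> ^ w) q'" "\<not> [:\<pi>:] dvd q'"
      using primitive_decomposition[OF q0] by blast
    have "Polynomial.smult (\<pi> ^ u) (c' * P) = Polynomial.smult (\<pi> ^ w) (m * q')"
    proof -
      have "Polynomial.smult (\<pi> ^ u) (c' * P) = [:c:] * P" unfolding c' by simp
      thus ?thesis using cP q' by simp
    qed
    hence eq: "c' * P = m * q'"
      by (rule smult_power_eq_primitive) (intro primitive_mult c' Pprim m q')+
    have "Polynomial.degree [:c:] = Polynomial.degree c'"
      unfolding c'(1) using pi_neq_0 by simp
    then obtain d where d: "c' = [:d:]" by (metis degree_eq_zeroE degree_pCons_0)
    have d_ndvd: "\<not> \<pi> dvd d" using c'(2) by (auto simp: d)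
    have eq: "Polynomial.smult d P = m * q'" using eq by (simp add: d)
    obtain i where i: "\<not> \<pi> dvd Polynomial.coeff m i" "\<And>k. k < i \<Longrightarrow> \<pi> dvd Polynomial.coeff m k"
      "i \<le> Polynomial.degree m" using primitive_least_coeff[OF m(2)] by blast
    obtain j where j: "\<not> \<pi> dvd Polynomial.coeff q' j" "\<And>k. k < j \<Longrightarrow> \<pi> dvd Polynomial.coeff q' k"
      "j \<le> Polynomial.degree q'" using primitive_least_coeff[OF q'(2)] by blast
    have deg: "Polynomial.degree P = Polynomial.degree m + Polynomial.degree q'"
    proof -
      have "d \<noteq> 0" using d_ndvd by auto
      hence "Polynomial.degree P = Polynomial.degree (m * q')" unfolding eq[symmetric] by simp
      thus ?thesis using m_neq_0 q'(2) by (subst (asm) degree_mult_eq) auto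
    qed
    \<comment> \<open>Below its degree all coefficients of \<open>P\<close> are divisible by \<pi>,
      so the first coefficients of \<open>m\<close> and \<open>q'\<close> not divisible by \<pi>
      must be the leading ones.\<close>
    have "\<not> \<pi> dvd Polynomial.coeff (Polynomial.smult d P) (i + j)"
      unfolding eq by (rule least_coeff_mult[OF i(1,2) j(1,2)])
    hence "\<not> i + j < Polynomial.degree P" using eis(1) by auto
    with deg i(3) j(3) have ij: "i = Polynomial.degree m" "j = Polynomial.degree q'" by auto
    \<comment> \<open>If both factors had positive degree, \<pi> would divide both constant terms,
      so its square would divide \<open>d\<close> times the constant term of \<open>P\<close>,
      although \<open>d\<close> is prime to \<pi>.\<close>
    have "i = 0 \<or> j = 0"
    proof (rule ccontr)
      assume "\<not> (i = 0 \<or> j = 0)"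
      hence "\<pi> dvd Polynomial.coeff m 0" "\<pi> dvd Polynomial.coeff q' 0" using i(2) j(2) by auto
      hence "\<pi> * \<pi> dvd Polynomial.coeff (m * q') 0" by (simp add: mult_dvd_mono coeff_mult)
      hence dvd: "\<pi> * \<pi> dvd d * Polynomial.coeff P 0" unfolding eq[symmetric] by simp
      have "\<pi> dvd Polynomial.coeff P 0" using eis(1) deg ij \<open>\<not> (i = 0 \<or> j = 0)\<close> by auto
      then obtain e where e: "Polynomial.coeff P 0 = \<pi> * e" by (elim dvdE)
      have "\<pi> * \<pi> dvd \<pi> * (d * e)" using dvd by (simp add: e mult_ac)
      hence "\<pi> dvd d * e" using pi_neq_0 by simp
      hence "\<pi> dvd e" using pi_dvd_mult d_ndvd by blast
      thus False using eis(2) by (simp add: e power2_eq_square)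
    qed
    moreover have "i \<noteq> 0"
    proof
      assume "i = 0"
      then obtain a where a: "m = [:a:]" using ij(1) by (metis degree_eq_zeroE)
      with m_root have "h a = 0" by simp
      thus False using inj a m_neq_0 by auto
    qed
    ultimately have "Polynomial.degree P = Polynomial.degree m" using deg ij by simp
    thus ?thesis using mS(2)[of g] that by (simp add: S_def)
  qed
  \<comment> \<open>As \<open>P\<close> is monic, pseudo-division is division with
    remainder.\<close>
  obtain q r where qr: "pseudo_divmod f P = (q, r)" by fastforce
  have f_eq: "f = P * q + r" and r: "r = 0 \<or> Polynomial.degree r < Polynomial.degree P"
    using pseudo_divmod[OF P0 qr] by (auto simp: monic)
  have "ev r x = 0"
    using arg_cong[OF f_eq, of "\<lambda>f. ev f x"] root f by (simp add: ev_add ev_mult)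
  hence "r = 0" using r min_degree[of r] by (cases "r = 0") auto
  thus "P dvd f" using f_eq by simp
qed

end

sublocale perfect_char \<subseteq> prime_element "of_nat CHAR('k) :: 'k witt"
  by unfold_locales (use pW_dvd_mult not_pW_dvd_1 witt_separated in auto)

section \<open>Cyclotomic polynomials of prime power order\<close>

text \<open>For prime \<open>p\<close>, the cyclotomic polynomial of order
  \<open>p ^ (n + 1)\<close> evaluated at \<open>1 + X\<close>; the translation by 1 is what makes
  Eisenstein's criterion apply.\<close>

definition cyclo_poly :: "nat \<Rightarrow> nat \<Rightarrow> 'a::idom poly" where
  "cyclo_poly p n = (\<Sum>i<p. ([:1, 1:] ^ (p ^ n)) ^ i)"

lemma cyclo_poly_mult:
  "([:1, 1:] ^ (p ^ n) - 1) * cyclo_poly p n = [:1, 1:] ^ (p ^ Suc n) - (1 :: 'a::idom poly)"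
  unfolding cyclo_poly_def power_diff_1_eq[symmetric] power_mult[symmetric] by (simp add: mult.commute)

lemma monic_power_minus_1:
  fixes n :: nat
  assumes "n > 0"
  shows "Polynomial.degree ([:1, 1:] ^ n - (1 :: 'a::idom poly)) = n"
    "Polynomial.lead_coeff ([:1, 1:] ^ n - (1 :: 'a::idom poly)) = 1"
proof -
  have d: "Polynomial.degree ([:1, 1:] ^ n :: 'a poly) = n"
    using degree_linear_power[of "1 :: 'a" n] by simp
  show deg: "Polynomial.degree ([:1, 1:] ^ n - (1 :: 'a poly)) = n"
    using degree_add_eq_left[of "- 1 :: 'a poly" "[:1, 1:] ^ n"] assms d by simp
  have "Polynomial.lead_coeff ([:1, 1:] ^ n :: 'a poly) = 1"
    by (simp add: lead_coeff_power)
  thus "Polynomial.lead_coeff ([:1, 1:] ^ n - (1 :: 'a poly)) = 1"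
    using assms by (simp add: deg d)
qed

lemma cyclo_poly_degree:
  assumes "p > 0"
  shows "Polynomial.degree (cyclo_poly p n :: 'a::idom poly) = p ^ Suc n - p ^ n"
    and "Polynomial.lead_coeff (cyclo_poly p n :: 'a::idom poly) = 1"
proof -
  note eq = cyclo_poly_mult[of p n, where ?'a = 'a]
  have p: "p ^ n > 0" "p ^ Suc n > 0" using assms by auto
  note 1 = monic_power_minus_1[OF p(1), where ?'a = 'a]
  note 2 = monic_power_minus_1[OF p(2), where ?'a = 'a]
  have "Polynomial.lead_coeff (([:1, 1:] ^ (p ^ n) - 1) * cyclo_poly p n :: 'a poly) = 1"
    unfolding eq by (rule 2(2))
  thus lc: "Polynomial.lead_coeff (cyclo_poly p n :: 'a poly) = 1"
    unfolding lead_coeff_mult 1(2) by simp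
  have "Polynomial.degree (([:1, 1:] ^ (p ^ n) - 1) * cyclo_poly p n :: 'a poly) = p ^ Suc n"
    unfolding eq by (rule 2(1))
  moreover have "[:1, 1:] ^ (p ^ n) - 1 \<noteq> (0 :: 'a poly)" using 1(2) by auto
  moreover have "cyclo_poly p n \<noteq> (0 :: 'a poly)" using lc by auto
  ultimately show "Polynomial.degree (cyclo_poly p n :: 'a poly) = p ^ Suc n - p ^ n"
    using 1(1) by (simp add: degree_mult_eq)
qed

lemma cyclo_poly_coeff_0: "Polynomial.coeff (cyclo_poly p n :: 'a::idom poly) 0 = of_nat p"
proof -
  have "poly (cyclo_poly p n :: 'a poly) 0 = of_nat p"
    by (simp add: cyclo_poly_def poly_sum)
  thus ?thesis by (simp add: poly_0_coeff_0)
qed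

text \<open>Modulo \<open>p\<close> the Frobenius gives
  \<open>(1 + X) ^ (p ^ m) = 1 + X ^ (p ^ m)\<close>. The product formula then reads
  \<open>X ^ (p ^ n) * cyclo_poly p n = X ^ (p ^ Suc n)\<close> modulo \<open>p\<close>, and
  \<open>X ^ (p ^ n)\<close> is cancelled by shifting coefficients.\<close>

lemma cyclo_poly_coeff_dvd:
  assumes p: "Factorial_Ring.prime p" and i: "i \<noteq> p ^ Suc n - p ^ n"
  shows "of_nat p dvd Polynomial.coeff (cyclo_poly p n :: 'a::idom poly) i"
proof -
  define M :: "nat \<Rightarrow> 'a poly" where "M = Polynomial.monom 1"
  have frob: "of_nat p dvd [:1, 1:] ^ (p ^ m) - (1 + M (p ^ m))" for m
  proof (induction m)
    case 0
    show ?case by (simp add: M_def monom_altdef one_pCons)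
  next
    case (Suc m)
    have "of_nat p dvd ([:1, 1:] ^ (p ^ m)) ^ p - (1 + M (p ^ m)) ^ p"
      by (rule dvd_diff_power[OF Suc])
    moreover have "of_nat p dvd (1 + M (p ^ m)) ^ p - (1 + M (p ^ m) ^ p)"
      using of_nat_dvd_frobenius_add[OF p, of 1 "M (p ^ m)"] by (simp add: algebra_simps)
    moreover have "M (p ^ m) ^ p = M (p ^ Suc m)"
      by (simp add: M_def monom_power mult.commute)
    ultimately show ?case
      by (metis dvd_diff_trans power_mult power_Suc2)
  qed
  define d where "d = p ^ Suc n - p ^ n"
  have d: "p ^ n + d = p ^ Suc n" using prime_gt_0_nat[OF p] by (simp add: d_def)
  have "of_nat p dvd ([:1, 1:] ^ (p ^ n) - 1) * cyclo_poly p n - M (p ^ n) * cyclo_poly p n"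
    unfolding left_diff_distrib[symmetric] using frob[of n] by (intro dvd_mult2) (simp add: algebra_simps)
  moreover have "of_nat p dvd ([:1, 1:] ^ (p ^ n) - 1) * cyclo_poly p n - M (p ^ n) * M d"
    unfolding cyclo_poly_mult using frob[of "Suc n"]
    by (simp add: M_def mult_monom d diff_diff_eq del: power_Suc)
  ultimately have "of_nat p dvd M (p ^ n) * cyclo_poly p n - M (p ^ n) * M d"
    by (blast intro: dvd_diff_sym dvd_diff_trans)
  hence "[:of_nat p:] dvd Polynomial.monom 1 (p ^ n) * (cyclo_poly p n - M d)"
    by (simp add: M_def right_diff_distrib of_nat_poly)
  hence "of_nat p dvd Polynomial.coeff (Polynomial.monom 1 (p ^ n) * (cyclo_poly p n - M d)) (p ^ n + i)"
    unfolding const_poly_dvd_iff by blast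
  thus ?thesis using i by (simp add: coeff_monom_mult M_def d_def)
qed

context perfect_char
begin

lemma cyclo_poly_dvd:
  fixes h :: "'k witt \<Rightarrow> 'b::idom"
  assumes "coeff_hom h" "\<And>x. h x = 0 \<Longrightarrow> x = 0"
    and "coeff_hom.ev h (cyclo_poly CHAR('k) n) x = 0" "coeff_hom.ev h f x = 0"
  shows "cyclo_poly CHAR('k) n dvd f"
proof (rule eisenstein_dvd[OF assms(1,2) _ _ _ assms(3,4)])
  have p: "Factorial_Ring.prime CHAR('k)" by (rule CHAR_prime)
  hence p0: "CHAR('k) > 0" by (rule prime_gt_0_nat)
  show "Polynomial.lead_coeff (cyclo_poly CHAR('k) n :: 'k witt poly) = 1"
    by (rule cyclo_poly_degree[OF p0])
  show "pW dvd Polynomial.coeff (cyclo_poly CHAR('k) n) i"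
    if "i < Polynomial.degree (cyclo_poly CHAR('k) n :: 'k witt poly)" for i
    using that by (intro cyclo_poly_coeff_dvd p) (simp add: cyclo_poly_degree[OF p0])
  show "\<not> pW ^ 2 dvd Polynomial.coeff (cyclo_poly CHAR('k) n) 0"
  proof
    assume "pW ^ 2 dvd Polynomial.coeff (cyclo_poly CHAR('k) n) 0"
    hence "pW * pW dvd pW * 1" by (simp add: cyclo_poly_coeff_0 power2_eq_square)
    hence "pW dvd 1" by (subst (asm) dvd_mult_cancel_left) simp
    thus False using not_pW_dvd_1 by blast
  qed
qed

end

section \<open>The cyclotomic tower\<close>

interpretation ac: coeff_hom "to_ac :: 'a::field \<Rightarrow> 'a alg_closure"
  by unfold_locales auto

interpretation em: coeff_hom "\<lambda>w::'a::idom. to_ac (to_fract w)"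
  by unfold_locales auto

lemma clear_denominators:
  fixes f :: "'a::idom fract poly"
  obtains d g where "d \<noteq> 0" "Polynomial.smult (to_fract d) f = map_poly to_fract g"
proof -
  have "\<exists>d g. d \<noteq> 0 \<and> Polynomial.smult (to_fract d) f = map_poly to_fract g"
  proof (induction f)
    case 0
    show ?case by (intro exI[of _ 1] exI[of _ 0]) auto
  next
    case (pCons a f)
    then obtain d g where dg: "d \<noteq> 0" "Polynomial.smult (to_fract d) f = map_poly to_fract g" by blast
    obtain u v where a: "a = Fract u v" "v \<noteq> 0" by (cases a) auto
    have "to_fract v * a = to_fract u"
      using a by (simp add: to_fract_def eq_fract)
    hence a': "to_fract (v * d) * a = to_fract (d * u)" by (simp add: mult_ac)
    have "Polynomial.smult (to_fract (v * d)) f = Polynomial.smult (to_fract v) (map_poly to_fract g)"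
      using dg(2) by (simp flip: dg(2))
    also have "\<dots> = map_poly to_fract (Polynomial.smult v g)"
      by (rule poly_eqI) (simp add: coeff_map_poly)
    finally have "Polynomial.smult (to_fract (v * d)) (pCons a f)
        = map_poly to_fract (pCons (d * u) (Polynomial.smult v g))"
      using a' by (simp add: map_poly_pCons)
    moreover have "v * d \<noteq> 0" using dg a by simp
    ultimately show ?case by blast
  qed
  thus thesis using that by blast
qed

context perfect_char
begin

lemma prime_p: "Factorial_Ring.prime CHAR('k)"
  by (rule CHAR_prime)

lemma p_gt_1: "CHAR('k) > 1"
  using prime_p by (rule prime_gt_1_nat)

lemma of_nat_p_neq_0: "(of_nat CHAR('k) :: 'k frac_closure) \<noteq> 0"
proof -
  have "(of_nat CHAR('k) :: 'k frac_closure) = to_ac (to_fract pW)"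
    by (simp add: em.h_of_nat)
  thus ?thesis by simp
qed

section \<open>A compatible system of p-power roots of unity\<close>

lemma ex_zeta: "\<exists>z :: nat \<Rightarrow> 'k frac_closure. z 0 = 1 \<and> z 1 \<noteq> 1 \<and> (\<forall>n. z (Suc n) ^ CHAR('k) = z n)"
proof -
  have "Polynomial.degree (cyclo_poly CHAR('k) 0 :: 'k frac_closure poly) = CHAR('k) - 1"
    using cyclo_poly_degree(1)[of "CHAR('k)" 0] p_gt_1 by simp
  hence "Polynomial.degree (cyclo_poly CHAR('k) 0 :: 'k frac_closure poly) > 0" using p_gt_1 by simp
  then obtain x :: "'k frac_closure" where x: "poly (cyclo_poly CHAR('k) 0) x = 0"
    using alg_closed_imp_poly_has_root by blast
  \<comment> \<open>The constant coefficient \<open>p\<close> is nonzero in characteristic 0, so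
    \<open>1 + x\<close> is a nontrivial \<open>p\<close>-th root of unity.\<close>
  have "x \<noteq> 0"
    using x cyclo_poly_coeff_0[of "CHAR('k)" 0, where ?'a = "'k frac_closure"] of_nat_p_neq_0
    by (auto simp: poly_0_coeff_0)
  have "(1 + x) ^ CHAR('k) = 1"
    using arg_cong[OF cyclo_poly_mult[of "CHAR('k)" 0], of "\<lambda>f. poly f x"] x by simp
  have "\<forall>x :: 'k frac_closure. \<exists>y. y ^ CHAR('k) = x"
    using nth_root_exists[of "CHAR('k)"] p_gt_1 by auto
  then obtain rt :: "'k frac_closure \<Rightarrow> 'k frac_closure" where rt: "\<And>x. rt x ^ CHAR('k) = x" by metis
  define z where "z n = (if n = 0 then 1 else (rt ^^ (n - 1)) (1 + x))" for n
  have "z (Suc n) ^ CHAR('k) = z n" for n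
    using \<open>(1 + x) ^ CHAR('k) = 1\<close> by (cases n) (auto simp: z_def rt)
  thus ?thesis using \<open>x \<noteq> 0\<close> by (intro exI[of _ z]) (auto simp: z_def)
qed

definition zeta :: "nat \<Rightarrow> 'k frac_closure" where
  "zeta = (SOME z. z 0 = 1 \<and> z 1 \<noteq> 1 \<and> (\<forall>n. z (Suc n) ^ CHAR('k) = z n))"

lemma zeta_0 [simp]: "zeta 0 = 1"
  and zeta_1: "zeta 1 \<noteq> 1"
  and zeta_Suc: "zeta (Suc n) ^ CHAR('k) = zeta n"
  using someI_ex[OF ex_zeta] unfolding zeta_def[symmetric] by blast+

lemma zeta_add: "zeta (n + m) ^ (CHAR('k) ^ m) = zeta n"
proof (induction m)
  case (Suc m)
  have "zeta (n + Suc m) ^ (CHAR('k) ^ Suc m) = (zeta (Suc (n + m)) ^ CHAR('k)) ^ (CHAR('k) ^ m)"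
    by (simp flip: power_mult)
  thus ?case using Suc by (simp add: zeta_Suc)
qed simp

lemma zeta_le: "n \<le> m \<Longrightarrow> zeta m ^ (CHAR('k) ^ (m - n)) = zeta n"
  using zeta_add[of n "m - n"] by simp

lemma zeta_power_order [simp]: "zeta n ^ (CHAR('k) ^ n) = 1"
  using zeta_add[of 0 n] by simp

lemma zeta_neq_0 [simp]: "zeta n \<noteq> 0"
proof
  assume "zeta n = 0"
  hence "zeta n ^ (CHAR('k) ^ n) = 0" using p_gt_1 by (simp add: power_0_left)
  thus False by (simp only: zeta_power_order one_neq_zero)
qed

lemma zeta_power_eq_1_iff: "zeta n ^ d = 1 \<longleftrightarrow> CHAR('k) ^ n dvd d"
proof
  show "zeta n ^ d = 1" if "CHAR('k) ^ n dvd d"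
    using that by (auto elim!: dvdE simp: power_mult)
  show "CHAR('k) ^ n dvd d" if "zeta n ^ d = 1"
    using that
  proof (induction n)
    case (Suc n)
    have "zeta n ^ d = (zeta (Suc n) ^ d) ^ CHAR('k)"
      unfolding zeta_Suc[of n, symmetric] by (simp add: mult.commute flip: power_mult)
    hence "CHAR('k) ^ n dvd d" using Suc by simp
    then obtain e where e: "d = CHAR('k) ^ n * e" by (elim dvdE)
    have "zeta 1 = zeta (Suc n) ^ (CHAR('k) ^ n)" using zeta_add[of 1 n] by simp
    hence z1: "zeta 1 ^ e = 1" using Suc.prems e by (simp flip: power_mult)
    \<comment> \<open>Otherwise \<open>e\<close> is invertible modulo \<open>p\<close>, and
      \<open>zeta 1 ^ e = 1\<close> would give \<open>zeta 1 = 1\<close>.\<close>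
    have "CHAR('k) dvd e"
    proof (rule ccontr)
      assume "\<not> CHAR('k) dvd e"
      hence "coprime e CHAR('k)" using prime_p by (simp add: prime_imp_coprime coprime_commute[of e])
      from cong_solve_coprime_nat[OF this] obtain b where "[e * b = 1] (mod CHAR('k))" by auto
      hence "(e * b) mod CHAR('k) = 1" using p_gt_1 by (simp add: cong_def)
      then obtain c where "e * b = 1 + CHAR('k) * c"
        using mult_div_mod_eq[of "CHAR('k)" "e * b"] by (metis add.commute)
      hence "zeta 1 ^ (e * b) = zeta 1 * (zeta 1 ^ CHAR('k)) ^ c" by (simp add: power_add power_mult)
      hence "zeta 1 = 1" using z1 zeta_power_order[of 1] by (simp add: power_mult)
      thus False using zeta_1 by blast
    qed
    thus ?case by (auto simp: e mult.commute mult_dvd_mono)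
  qed simp
qed

lemma zeta_power_eq_iff: "zeta n ^ a = zeta n ^ b \<longleftrightarrow> [a = b] (mod CHAR('k) ^ n)"
proof -
  have *: "zeta n ^ a = zeta n ^ b \<longleftrightarrow> [a = b] (mod CHAR('k) ^ n)" if "a \<le> b" for a b
  proof -
    have "zeta n ^ b = zeta n ^ a * zeta n ^ (b - a)" using that by (simp flip: power_add)
    hence "zeta n ^ a = zeta n ^ b \<longleftrightarrow> zeta n ^ (b - a) = 1" by auto
    also have "\<dots> \<longleftrightarrow> CHAR('k) ^ n dvd b - a" by (rule zeta_power_eq_1_iff)
    also have "\<dots> \<longleftrightarrow> [a = b] (mod CHAR('k) ^ n)"
      using that by (simp add: cong_altdef_nat cong_sym_eq[of a b])
    finally show ?thesis .
  qed
  show ?thesis using *[of a b] *[of b a] by (cases "a \<le> b") (auto simp: cong_sym_eq)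
qed

text \<open>Counting: the powers of \<open>zeta n\<close> already give \<open>p ^ n\<close> distinct
  roots of a polynomial of degree at most \<open>p ^ n\<close>.\<close>

lemma roots_of_unity: "{z. z ^ (CHAR('k) ^ n) = 1} = (\<lambda>a. zeta n ^ a) ` {..<CHAR('k) ^ n}"
proof -
  define f :: "'k frac_closure poly" where "f = Polynomial.monom 1 (CHAR('k) ^ n) - 1"
  have pn: "CHAR('k) ^ n > 0" using p_gt_1 by simp
  have "Polynomial.coeff f (CHAR('k) ^ n) = 1" using pn by (simp add: f_def)
  hence f0: "f \<noteq> 0" by auto
  have "Polynomial.degree f \<le> CHAR('k) ^ n"
    unfolding f_def by (intro degree_diff_le degree_monom_le) auto
  moreover have eq: "{z. z ^ (CHAR('k) ^ n) = 1} = {z. poly f z = 0}"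
    by (auto simp: f_def poly_monom)
  ultimately have card: "card {z :: 'k frac_closure. z ^ (CHAR('k) ^ n) = 1} \<le> CHAR('k) ^ n"
    using card_poly_roots_bound[OF f0] by simp
  have "inj_on (\<lambda>a. zeta n ^ a) {..<CHAR('k) ^ n}"
    by (auto simp: inj_on_def zeta_power_eq_iff cong_def)
  hence "card ((\<lambda>a. zeta n ^ a) ` {..<CHAR('k) ^ n}) = CHAR('k) ^ n" by (simp add: card_image)
  moreover have "finite {z :: 'k frac_closure. z ^ (CHAR('k) ^ n) = 1}"
    unfolding eq by (rule poly_roots_finite[OF f0])
  moreover have "(\<lambda>a. zeta n ^ a) ` {..<CHAR('k) ^ n} \<subseteq> {z. z ^ (CHAR('k) ^ n) = 1}"
    by (auto simp: mult.commute[of _ "CHAR('k) ^ n"] power_mult simp flip: power_mult[of _ _ "CHAR('k) ^ n"])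
  ultimately show ?thesis using card by (intro card_seteq[symmetric]) auto
qed

text \<open>Polynomial values suffice: algebraicity makes this ring a field
  (\<open>Kn_inverse\<close>), and every element has a representative to which conjugation can be
  applied.\<close>

definition Kn :: "nat \<Rightarrow> 'k frac_closure set" where
  "Kn n = range (\<lambda>f. ac.ev f (zeta n))"

lemma Kn_diff: "x \<in> Kn n \<Longrightarrow> y \<in> Kn n \<Longrightarrow> x - y \<in> Kn n"
  unfolding Kn_def by (auto simp flip: ac.ev_diff)

lemma Kn_add: "x \<in> Kn n \<Longrightarrow> y \<in> Kn n \<Longrightarrow> x + y \<in> Kn n"
  unfolding Kn_def by (auto simp flip: ac.ev_add)

lemma Kn_mult: "x \<in> Kn n \<Longrightarrow> y \<in> Kn n \<Longrightarrow> x * y \<in> Kn n"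
  unfolding Kn_def by (auto simp flip: ac.ev_mult)

lemma Kn_to_ac: "to_ac c \<in> Kn n"
  unfolding Kn_def by (rule range_eqI[of _ _ "[:c:]"]) simp

lemma Kn_zeta: "zeta n \<in> Kn n"
  unfolding Kn_def by (rule range_eqI[of _ _ "[:0, 1:]"]) simp

lemma Kn_power: "x \<in> Kn n \<Longrightarrow> x ^ k \<in> Kn n"
  using Kn_to_ac[of 1 n] by (induction k) (auto intro: Kn_mult)

text \<open>One polynomial serves all exponents \<open>a\<close> at once, so a change of level is
  compatible with conjugation.\<close>

lemma ev_zeta_lift:
  assumes "n \<le> m"
  shows "ac.ev f (zeta n ^ a) = ac.ev (pcompose f (Polynomial.monom 1 (CHAR('k) ^ (m - n)))) (zeta m ^ a)"
proof -
  have "zeta n ^ a = (zeta m ^ a) ^ (CHAR('k) ^ (m - n))"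
    by (simp add: zeta_le[OF assms, symmetric] mult.commute flip: power_mult)
  thus ?thesis by (simp add: ac.ev_pcompose ac.ev_monom)
qed

lemma Kn_mono: "n \<le> m \<Longrightarrow> Kn n \<subseteq> Kn m"
  using ev_zeta_lift[of n m _ 1] by (auto simp: Kn_def)

lemma zeta_in_Kn: "n \<le> m \<Longrightarrow> zeta n \<in> Kn m"
  using Kn_zeta Kn_mono by blast

lemma ev_in_subring:
  assumes "\<And>x y. x \<in> A \<Longrightarrow> y \<in> A \<Longrightarrow> x - y \<in> A" "\<And>x y. x \<in> A \<Longrightarrow> y \<in> A \<Longrightarrow> x * y \<in> A"
    and "range to_ac \<subseteq> A" "x \<in> A"
  shows "ac.ev f x \<in> A"
proof (induction f)
  case 0
  show ?case using assms(3) by (auto simp: image_subset_iff dest: spec[of _ 0])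
next
  case (pCons a f)
  have "to_ac a - (to_ac 0 - x * ac.ev f x) \<in> A"
    by (intro assms(1,2) assms(4) pCons subsetD[OF assms(3)] rangeI)
  thus ?case by simp
qed

lemma cyclotomic_field_eq: "cyclotomic_field (enat n) = Kn n"
proof -
  define S :: "'k frac_closure set" where "S = {z. \<exists>m. enat m \<le> enat n \<and> z ^ (CHAR('k) ^ m) = 1}"
  have S: "z \<in> Kn n" if "z \<in> S" for z
  proof -
    from that obtain m where m: "m \<le> n" "z ^ (CHAR('k) ^ m) = 1" by (auto simp: S_def)
    hence "z \<in> (\<lambda>a. zeta m ^ a) ` {..<CHAR('k) ^ m}" using roots_of_unity[of m] by blast
    thus ?thesis using zeta_in_Kn[OF m(1)] Kn_power by blast
  qed
  have zS: "zeta n \<in> S" unfolding S_def mem_Collect_eq by (intro exI[of _ n]) auto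
  show ?thesis unfolding cyclotomic_field_def ring_adjoin_def S_def[symmetric]
  proof (rule subset_antisym)
    show "\<Inter>{A. range to_ac \<union> S \<subseteq> A \<and> (\<forall>x\<in>A. \<forall>y\<in>A. x - y \<in> A \<and> x * y \<in> A)} \<subseteq> Kn n"
      using S Kn_to_ac Kn_diff Kn_mult by (intro Inter_lower) auto
    show "Kn n \<subseteq> \<Inter>{A. range to_ac \<union> S \<subseteq> A \<and> (\<forall>x\<in>A. \<forall>y\<in>A. x - y \<in> A \<and> x * y \<in> A)}"
    proof (rule Inter_greatest)
      fix A assume "A \<in> {A. range to_ac \<union> S \<subseteq> A \<and> (\<forall>x\<in>A. \<forall>y\<in>A. x - y \<in> A \<and> x * y \<in> A)}"
      hence A: "range to_ac \<subseteq> A" "S \<subseteq> A" "\<And>x y. x \<in> A \<Longrightarrow> y \<in> A \<Longrightarrow> x - y \<in> A"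
        "\<And>x y. x \<in> A \<Longrightarrow> y \<in> A \<Longrightarrow> x * y \<in> A" by auto
      have "zeta n \<in> A" using zS A(2) by blast
      thus "Kn n \<subseteq> A" unfolding Kn_def using ev_in_subring[OF A(3,4,1)] by blast
    qed
  qed
qed

lemma cyclotomic_field_1: "cyclotomic_field 1 = Kn 1"
  using cyclotomic_field_eq[of 1] by (simp add: one_enat_def)

lemma cyclotomic_field_inf: "cyclotomic_field \<infinity> = (\<Union>n. Kn n)"
proof -
  define S :: "'k frac_closure set" where "S = {z. \<exists>m. enat m \<le> \<infinity> \<and> z ^ (CHAR('k) ^ m) = 1}"
  have S: "z \<in> (\<Union>n. Kn n)" if "z \<in> S" for z
  proof -
    from that obtain m where m: "z ^ (CHAR('k) ^ m) = 1" by (auto simp: S_def)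
    hence "z \<in> (\<lambda>a. zeta m ^ a) ` {..<CHAR('k) ^ m}" using roots_of_unity[of m] by blast
    thus ?thesis using Kn_zeta Kn_power by blast
  qed
  have zS: "zeta n \<in> S" for n unfolding S_def mem_Collect_eq by (intro exI[of _ n]) auto
  have join: "\<exists>k. x \<in> Kn k \<and> y \<in> Kn k" if "x \<in> (\<Union>n. Kn n)" "y \<in> (\<Union>n. Kn n)" for x y
  proof -
    from that obtain n m where "x \<in> Kn n" "y \<in> Kn m" by blast
    thus ?thesis using Kn_mono[of n "max n m"] Kn_mono[of m "max n m"] by (intro exI[of _ "max n m"]) auto
  qed
  show ?thesis unfolding cyclotomic_field_def ring_adjoin_def S_def[symmetric]
  proof (rule subset_antisym)
    show "\<Inter>{A. range to_ac \<union> S \<subseteq> A \<and> (\<forall>x\<in>A. \<forall>y\<in>A. x - y \<in> A \<and> x * y \<in> A)} \<subseteq> (\<Union>n. Kn n)"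
    proof (rule Inter_lower, intro CollectI conjI ballI)
      show "range to_ac \<union> S \<subseteq> (\<Union>n. Kn n)" using S Kn_to_ac by blast
      fix x y assume "x \<in> (\<Union>n. Kn n)" "y \<in> (\<Union>n. Kn n)"
      from join[OF this] obtain k where "x \<in> Kn k" "y \<in> Kn k" by blast
      thus "x - y \<in> (\<Union>n. Kn n)" "x * y \<in> (\<Union>n. Kn n)"
        by (auto intro: Kn_diff Kn_mult)
    qed
    show "(\<Union>n. Kn n) \<subseteq> \<Inter>{A. range to_ac \<union> S \<subseteq> A \<and> (\<forall>x\<in>A. \<forall>y\<in>A. x - y \<in> A \<and> x * y \<in> A)}"
    proof (rule Inter_greatest)
      fix A assume "A \<in> {A. range to_ac \<union> S \<subseteq> A \<and> (\<forall>x\<in>A. \<forall>y\<in>A. x - y \<in> A \<and> x * y \<in> A)}"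
      hence A: "range to_ac \<subseteq> A" "S \<subseteq> A" "\<And>x y. x \<in> A \<Longrightarrow> y \<in> A \<Longrightarrow> x - y \<in> A"
        "\<And>x y. x \<in> A \<Longrightarrow> y \<in> A \<Longrightarrow> x * y \<in> A" by auto
      have "zeta n \<in> A" for n using zS A(2) by blast
      thus "(\<Union>n. Kn n) \<subseteq> A" unfolding Kn_def using ev_in_subring[OF A(3,4,1)] by blast
    qed
  qed
qed

abbreviation Kinf :: "'k frac_closure set" where "Kinf \<equiv> cyclotomic_field \<infinity>"

lemma Kn_subset_Kinf: "Kn n \<subseteq> Kinf"
  by (auto simp: cyclotomic_field_inf)

lemma zeta_in_Kinf: "zeta n \<in> Kinf"
  using Kn_zeta Kn_subset_Kinf by blast

lemma Kinf_common:
  assumes "x \<in> Kinf" "y \<in> Kinf"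
  obtains n f g where "n \<ge> 1" "x = ac.ev f (zeta n)" "y = ac.ev g (zeta n)"
proof -
  from assms obtain n m where "x \<in> Kn n" "y \<in> Kn m" by (auto simp: cyclotomic_field_inf)
  hence "x \<in> Kn (n + m + 1)" "y \<in> Kn (n + m + 1)"
    using Kn_mono[of n "n + m + 1"] Kn_mono[of m "n + m + 1"] by auto
  thus thesis using that[of "n + m + 1"] by (auto simp: Kn_def)
qed

lemma Kinf_E:
  assumes "x \<in> Kinf"
  obtains n f where "n \<ge> 1" "x = ac.ev f (zeta n)"
  using Kinf_common[OF assms assms] by blast

lemma ev_in_Kinf: "ac.ev f (zeta n ^ a) \<in> Kinf"
proof -
  have "zeta n ^ a = ac.ev (Polynomial.monom 1 a) (zeta n)" by (simp add: ac.ev_monom)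
  hence "ac.ev f (zeta n ^ a) = ac.ev (pcompose f (Polynomial.monom 1 a)) (zeta n)"
    by (simp add: ac.ev_pcompose)
  thus ?thesis using Kn_subset_Kinf[of n] unfolding Kn_def by blast
qed

text \<open>This is where the irreducibility of the cyclotomic polynomial enters.\<close>

lemma zeta_conjugate:
  assumes n: "n \<ge> 1" and f: "ac.ev f (zeta n) = 0" and a: "\<not> CHAR('k) dvd a"
  shows "ac.ev f (zeta n ^ a) = 0"
proof -
  obtain m where m: "n = Suc m" using n by (cases n) auto
  obtain d g where dg: "d \<noteq> 0" "Polynomial.smult (to_fract d) f = map_poly to_fract g"
    by (rule clear_denominators)
  have ev_g: "em.ev g x = to_ac (to_fract d) * ac.ev f x" for x :: "'k frac_closure"
  proof -
    have "em.ev g x = ac.ev (map_poly to_fract g) x"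
      unfolding em.ev_def ac.ev_def by (subst map_poly_map_poly) (auto simp: comp_def)
    thus ?thesis by (simp flip: dg(2) add: ac.ev_smult)
  qed
  \<comment> \<open>\<open>cyclo_poly\<close> is written in the variable \<open>x - 1\<close>, so
    the integral relation is translated accordingly.\<close>
  define F where "F = pcompose g [:1, 1:]"
  have ev_F: "em.ev F (x - 1) = em.ev g x" for x :: "'k frac_closure"
    by (simp add: F_def em.ev_pcompose)
  \<comment> \<open>For \<open>b\<close> prime to \<open>p\<close> the root
    \<open>zeta n ^ b\<close> has exact order \<open>p ^ n\<close>: it annihilates the product in
    \<open>cyclo_poly_mult\<close> but not the first factor.\<close>
  have root: "em.ev (cyclo_poly CHAR('k) m) (zeta n ^ b - 1) = 0" if "\<not> CHAR('k) dvd b" for b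
  proof -
    let ?x = "zeta n ^ b"
    have "em.ev (([:1, 1:] ^ (CHAR('k) ^ m) - 1) * cyclo_poly CHAR('k) m) (?x - 1)
        = em.ev ([:1, 1:] ^ (CHAR('k) ^ Suc m) - 1) (?x - 1)"
      by (simp only: cyclo_poly_mult)
    hence "(?x ^ (CHAR('k) ^ m) - 1) * em.ev (cyclo_poly CHAR('k) m) (?x - 1) = ?x ^ (CHAR('k) ^ Suc m) - 1"
      by (simp add: em.ev_mult em.ev_diff em.ev_power)
    also have "?x ^ (CHAR('k) ^ Suc m) = (zeta n ^ (CHAR('k) ^ n)) ^ b"
      by (simp only: m mult.commute flip: power_mult)
    also have "\<dots> - 1 = 0" by simp
    finally have "(?x ^ (CHAR('k) ^ m) - 1) * em.ev (cyclo_poly CHAR('k) m) (?x - 1) = 0" .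
    moreover have "?x ^ (CHAR('k) ^ m) \<noteq> 1"
    proof
      assume "?x ^ (CHAR('k) ^ m) = 1"
      hence "CHAR('k) ^ n dvd b * CHAR('k) ^ m" unfolding power_mult[symmetric] zeta_power_eq_1_iff .
      hence "CHAR('k) dvd b" using p_gt_1 by (simp add: m)
      thus False using that by blast
    qed
    ultimately show ?thesis by simp
  qed
  have "\<not> CHAR('k) dvd 1" using p_gt_1 by simp
  have "cyclo_poly CHAR('k) m dvd F"
  proof (rule cyclo_poly_dvd)
    show "coeff_hom (\<lambda>w::'k witt. to_ac (to_fract w))" by (rule em.coeff_hom_axioms)
    show "em.ev (cyclo_poly CHAR('k) m) (zeta n - 1) = 0" using root[of 1] \<open>\<not> CHAR('k) dvd 1\<close> by simp
    show "em.ev F (zeta n - 1) = 0" using f by (simp add: ev_F ev_g)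
  qed auto
  then obtain Q where "F = cyclo_poly CHAR('k) m * Q" by (elim dvdE)
  hence "em.ev F (zeta n ^ a - 1) = 0" using root[OF a] by (simp add: em.ev_mult)
  thus ?thesis using dg(1) by (simp add: ev_F ev_g)
qed

section \<open>Automorphisms raising roots of unity to a power\<close>

definition conj_map :: "nat \<Rightarrow> 'k frac_closure \<Rightarrow> 'k frac_closure" where
  "conj_map a x = (THE y. \<exists>n f. n \<ge> 1 \<and> x = ac.ev f (zeta n) \<and> y = ac.ev f (zeta n ^ a))"

text \<open>Independence of the representation: two of them are lifted to a common level
  \<open>N\<close>, where their difference vanishes at \<open>zeta N\<close> and hence at its
  conjugate.\<close>

lemma conj_map_ev:
  assumes "\<not> CHAR('k) dvd a" "n \<ge> 1"
  shows "conj_map a (ac.ev f (zeta n)) = ac.ev f (zeta n ^ a)"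
  unfolding conj_map_def
proof (rule the_equality)
  show "\<exists>n' f'. n' \<ge> 1 \<and> ac.ev f (zeta n) = ac.ev f' (zeta n') \<and> ac.ev f (zeta n ^ a) = ac.ev f' (zeta n' ^ a)"
    using assms by blast
  fix y assume "\<exists>n' f'. n' \<ge> 1 \<and> ac.ev f (zeta n) = ac.ev f' (zeta n') \<and> y = ac.ev f' (zeta n' ^ a)"
  then obtain n' f' where *: "n' \<ge> 1" "ac.ev f (zeta n) = ac.ev f' (zeta n')" "y = ac.ev f' (zeta n' ^ a)"
    by blast
  define N where "N = n + n'"
  define F where "F = pcompose f (Polynomial.monom 1 (CHAR('k) ^ (N - n)))"
  define F' where "F' = pcompose f' (Polynomial.monom 1 (CHAR('k) ^ (N - n')))"
  have F: "ac.ev f (zeta n ^ b) = ac.ev F (zeta N ^ b)" and F': "ac.ev f' (zeta n' ^ b) = ac.ev F' (zeta N ^ b)" for b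
    unfolding F_def F'_def by (rule ev_zeta_lift; simp add: N_def)+
  have "ac.ev (F' - F) (zeta N) = 0"
    using *(2) F[of 1] F'[of 1] by (simp add: ac.ev_diff)
  hence "ac.ev (F' - F) (zeta N ^ a) = 0"
    using assms by (intro zeta_conjugate) (auto simp: N_def)
  thus "y = ac.ev f (zeta n ^ a)" by (simp add: ac.ev_diff F F' *(3))
qed

abbreviation G :: "('k frac_closure \<Rightarrow> 'k frac_closure) monoid" where "G \<equiv> cyclotomic_galois_group"

lemma G_carrier: "g \<in> carrier G \<longleftrightarrow> g \<in> extensional Kinf \<and> bij_betw g Kinf Kinf \<and>
    (\<forall>x\<in>Kinf. \<forall>y\<in>Kinf. g (x + y) = g x + g y \<and> g (x * y) = g x * g y) \<and> (\<forall>x\<in>Kn 1. g x = x)"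
  by (simp add: galois_group_def cyclotomic_field_1)

lemma conj_map_in_G:
  assumes a: "[a = 1] (mod CHAR('k))"
  shows "restrict (conj_map a) Kinf \<in> carrier G"
proof -
  have cop: "coprime a CHAR('k)" using a by (metis cong_imp_coprime cong_sym coprime_1_left)
  have na: "\<not> CHAR('k) dvd a"
    using cop p_gt_1 by (metis coprime_common_divisor dvd_refl less_irrefl nat_dvd_1_iff_1)
  note ev = conj_map_ev[OF na]
  have 1: "conj_map a (x + y) = conj_map a x + conj_map a y \<and> conj_map a (x * y) = conj_map a x * conj_map a y"
    if "x \<in> Kinf" "y \<in> Kinf" for x y
  proof -
    from that obtain n f g where nfg: "n \<ge> 1" "x = ac.ev f (zeta n)" "y = ac.ev g (zeta n)"
      by (rule Kinf_common)
    thus ?thesis using ev[OF nfg(1), of f] ev[OF nfg(1), of g] ev[OF nfg(1), of "f + g"] ev[OF nfg(1), of "f * g"]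
      by (simp add: ac.ev_add ac.ev_mult)
  qed
  \<comment> \<open>A natural number inverse to \<open>a\<close> exists only modulo
    \<open>p ^ n\<close>, so bijectivity is checked level by level.\<close>
  have inv: "\<exists>b. zeta n ^ (a * b) = zeta n \<and> \<not> CHAR('k) dvd b" if "n \<ge> 1" for n
  proof -
    have "coprime a (CHAR('k) ^ n)" using cop by simp
    from cong_solve_coprime_nat[OF this] obtain b where b: "[a * b = 1] (mod CHAR('k) ^ n)" by auto
    hence "[a * b = 1] (mod CHAR('k))" using that by (metis cong_dvd_modulus_nat dvd_power gr0I not_one_le_zero)
    hence "\<not> CHAR('k) dvd b"
      using p_gt_1 by (metis cong_dvd_iff dvd_mult nat_dvd_1_iff_1 less_irrefl)
    thus ?thesis using b zeta_power_eq_iff[of n "a * b" 1] by auto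
  qed
  have 2: "inj_on (conj_map a) Kinf"
  proof (rule inj_onI)
    fix x y assume xy: "x \<in> Kinf" "y \<in> Kinf" "conj_map a x = conj_map a y"
    from xy(1,2) obtain n f g where nfg: "n \<ge> 1" "x = ac.ev f (zeta n)" "y = ac.ev g (zeta n)"
      by (rule Kinf_common)
    obtain b where b: "zeta n ^ (a * b) = zeta n" "\<not> CHAR('k) dvd b" using inv[OF nfg(1)] by blast
    have "ac.ev (f - g) (zeta n ^ a) = 0"
      using xy(3) ev[OF nfg(1)] nfg(2,3) by (simp add: ac.ev_diff)
    hence "ac.ev (pcompose (f - g) (Polynomial.monom 1 a)) (zeta n) = 0"
      by (simp add: ac.ev_pcompose ac.ev_monom)
    from zeta_conjugate[OF nfg(1) this b(2)] have "ac.ev (f - g) (zeta n ^ (a * b)) = 0"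
      by (simp add: ac.ev_pcompose ac.ev_monom mult.commute flip: power_mult)
    thus "x = y" using b nfg by (simp add: ac.ev_diff)
  qed
  have 3: "conj_map a ` Kinf = Kinf"
  proof (intro subset_antisym subsetI)
    fix y assume "y \<in> conj_map a ` Kinf"
    then obtain x where "x \<in> Kinf" "y = conj_map a x" by blast
    thus "y \<in> Kinf" using ev ev_in_Kinf by (metis Kinf_E)
  next
    fix y assume "y \<in> Kinf"
    then obtain n f where nf: "n \<ge> 1" "y = ac.ev f (zeta n)" by (rule Kinf_E)
    obtain b where b: "zeta n ^ (a * b) = zeta n" "\<not> CHAR('k) dvd b" using inv[OF nf(1)] by blast
    define F where "F = pcompose f (Polynomial.monom 1 b)"
    have "conj_map a (ac.ev F (zeta n)) = ac.ev F (zeta n ^ a)" by (rule ev[OF nf(1)])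
    also have "\<dots> = y" using b(1) by (simp add: F_def ac.ev_pcompose ac.ev_monom nf(2) flip: power_mult)
    finally show "y \<in> conj_map a ` Kinf" using ev_in_Kinf[of F n 1] by force
  qed
  \<comment> \<open>The congruence of \<open>a\<close> to 1 modulo \<open>p\<close> is what makes
    the map fix \<open>zeta 1\<close>.\<close>
  have 4: "conj_map a x = x" if "x \<in> Kn 1" for x
  proof -
    from that obtain f where f: "x = ac.ev f (zeta 1)" by (auto simp: Kn_def)
    have "zeta 1 ^ a = zeta 1" using zeta_power_eq_iff[of 1 a 1] a by simp
    thus ?thesis using ev[of 1 f] f by simp
  qed
  have closed: "x + y \<in> Kinf \<and> x * y \<in> Kinf" if "x \<in> Kinf" "y \<in> Kinf" for x y
  proof -
    from that obtain n f g where "n \<ge> 1" "x = ac.ev f (zeta n)" "y = ac.ev g (zeta n)"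
      by (rule Kinf_common)
    thus ?thesis using ev_in_Kinf[of "f + g" n 1] ev_in_Kinf[of "f * g" n 1]
      by (simp add: ac.ev_add ac.ev_mult)
  qed
  have "inj_on (restrict (conj_map a) Kinf) Kinf" using 2 by (simp add: inj_on_def)
  moreover have "restrict (conj_map a) Kinf ` Kinf = Kinf" using 3 by (simp add: image_def)
  moreover have "x \<in> Kinf" if "x \<in> Kn 1" for x using that Kn_subset_Kinf by blast
  ultimately show ?thesis using 1 4 closed unfolding G_carrier bij_betw_def by auto
qed

end

section \<open>Powers of \<open>1 + p\<close>\<close>

lemma one_plus_power_mod_square: "\<exists>r. (1 + t :: int) ^ i = 1 + int i * t + t ^ 2 * r"
proof (induction i)
  case (Suc i)
  then obtain r where "(1 + t) ^ i = 1 + int i * t + t ^ 2 * r" by blast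
  hence "(1 + t) ^ Suc i = 1 + int (Suc i) * t + t ^ 2 * (int i + r + t * r)"
    by (simp add: algebra_simps power2_eq_square)
  thus ?case by blast
qed auto

text \<open>Raising to the power \<open>p\<close> increases the valuation of \<open>t\<close> by
  exactly one, because the cofactor of \<open>t\<close> in \<open>(1 + t) ^ p - 1\<close> is
  \<open>p\<close> times a number congruent to 1. For \<open>p = 2\<close> the cofactor is
  \<open>2 + t\<close>, hence the condition \<open>c \<ge> 2\<close>.\<close>

lemma power_p_step:
  fixes t :: int
  assumes p: "Factorial_Ring.prime (p::nat)" and t: "t = int p ^ c * u" "\<not> int p dvd u"
    and c: "c \<ge> 1" "p = 2 \<Longrightarrow> c \<ge> 2"
  obtains u' where "(1 + t) ^ p = 1 + int p ^ Suc c * u'" "\<not> int p dvd u'"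
proof -
  obtain s where s: "t = int p * s" using c(1) t(1) by (cases c) auto
  have "\<exists>w. (\<Sum>i<p. (1 + t) ^ i) = int p * (1 + int p * w)"
  proof (cases "p = 2")
    case True
    then obtain s' where "t = 4 * s'"
      using c(2) t(1) le_imp_power_dvd[of 2 c "2 :: int"] by (auto elim!: dvdE)
    thus ?thesis using True by (intro exI[of _ s']) (simp add: numeral_2_eq_2)
  next
    case False
    hence "odd p" using p prime_odd_nat[of p] prime_ge_2_nat[OF p] by force
    then obtain j where j: "p = 2 * j + 1" by (elim oddE)
    obtain r where r: "\<And>i. (1 + t) ^ i = 1 + int i * t + t ^ 2 * r i"
      using one_plus_power_mod_square[of t] by metis
    \<comment> \<open>For odd \<open>p\<close> the linear term of the cofactor carries
      \<open>p * t\<close> and the remainder carries \<open>t ^ 2\<close>; both are divisible by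
      \<open>p ^ 2\<close>.\<close>
    have "(\<Sum>i<p. int i) = int p * int j"
    proof -
      have "2 * (\<Sum>i<n. int i) = int n * (int n - 1)" for n
        by (induction n) (auto simp: algebra_simps)
      from this[of p] show ?thesis by (simp add: j)
    qed
    hence "(\<Sum>i<p. (1 + t) ^ i) = int p + int p * int j * t + t ^ 2 * (\<Sum>i<p. r i)"
      unfolding r by (simp add: sum.distrib flip: sum_distrib_right sum_distrib_left)
    also have "\<dots> = int p * (1 + int p * (int j * s + s ^ 2 * (\<Sum>i<p. r i)))"
      by (simp add: s algebra_simps power2_eq_square)
    finally show ?thesis by blast
  qed
  then obtain w where w: "(\<Sum>i<p. (1 + t) ^ i) = int p * (1 + int p * w)" by blast
  have "(1 + t) ^ p - 1 = t * (\<Sum>i<p. (1 + t) ^ i)"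
    using power_diff_1_eq[of "1 + t" p] by simp
  hence "(1 + t) ^ p = 1 + int p ^ Suc c * (u * (1 + int p * w))"
    unfolding w by (simp add: t(1) algebra_simps)
  moreover have "\<not> int p dvd u * (1 + int p * w)"
  proof
    assume "int p dvd u * (1 + int p * w)"
    hence "int p dvd 1 + int p * w" using p t(2) by (simp add: prime_dvd_mult_iff)
    hence "int p dvd 1" by (metis dvd_add_left_iff dvd_triv_left)
    thus False using prime_gt_1_nat[OF p] by simp
  qed
  ultimately show thesis by (rule that)
qed

text \<open>Each factor \<open>p\<close> of \<open>d\<close> is traded for one more in
  \<open>c\<close> by replacing \<open>1 + t\<close> with its \<open>p\<close>-th power. Phrasing
  the conclusion as a divisibility covers \<open>d = 0\<close> as well.\<close>

lemma lifting_the_exponent: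
  fixes t :: int
  assumes p: "Factorial_Ring.prime (p::nat)" and "t = int p ^ c * u" "\<not> int p dvd u"
    and "c \<ge> 1" "p = 2 \<Longrightarrow> c \<ge> 2" and "int p ^ N dvd (1 + t) ^ d - 1"
  shows "int p ^ N dvd int p ^ c * int d"
  using assms(2-)
proof (induction d arbitrary: t c u rule: less_induct)
  case (less d)
  show ?case
  proof (cases "p dvd d")
    case True
    then obtain e where e: "d = p * e" by (elim dvdE)
    show ?thesis
    proof (cases "e = 0")
      case False
      hence "e < d" using e prime_gt_1_nat[OF p] by simp
      obtain u' where u': "(1 + t) ^ p = 1 + int p ^ Suc c * u'" "\<not> int p dvd u'"
        using power_p_step[OF p less.prems(1-4)] by metis
      have "(1 + t) ^ d = (1 + int p ^ Suc c * u') ^ e"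
        by (simp add: e power_mult u')
      hence "int p ^ N dvd int p ^ Suc c * int e"
        using less.prems by (intro less.IH[OF \<open>e < d\<close> refl u'(2)]) auto
      thus ?thesis by (simp add: e mult_ac)
    qed (simp add: e)
  next
    case False
    obtain s where s: "t = int p * s" using less.prems(1,3) by (cases c) auto
    \<comment> \<open>The cofactor of \<open>t\<close> is congruent to \<open>d\<close> modulo
      \<open>p\<close>, so it is prime to \<open>p\<close> and adds no valuation.\<close>
    have "int p dvd (\<Sum>i<d. (1 + t) ^ i) - (\<Sum>i<d. 1 ^ i)"
      by (intro dvd_diff_sum dvd_diff_power) (simp add: s)
    hence "\<not> int p dvd (\<Sum>i<d. (1 + t) ^ i)"
      using False by (simp add: int_dvd_int_iff) (metis dvd_diff_right_iff int_dvd_int_iff)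
    hence "\<not> int p dvd u * (\<Sum>i<d. (1 + t) ^ i)" using p less.prems(2) by (simp add: prime_dvd_mult_iff)
    hence "coprime (int p) (u * (\<Sum>i<d. (1 + t) ^ i))"
      using p by (intro prime_imp_coprime) simp_all
    hence "coprime (int p ^ N) (u * (\<Sum>i<d. (1 + t) ^ i))" by (rule coprime_power_left_iff[THEN iffD2, OF disjI1])
    moreover have "(1 + t) ^ d - 1 = int p ^ c * (u * (\<Sum>i<d. (1 + t) ^ i))"
      using power_diff_1_eq[of "1 + t" d] less.prems(1) by simp
    ultimately have "int p ^ N dvd int p ^ c"
      using less.prems(5) by (simp add: coprime_dvd_mult_left_iff)
    thus ?thesis by simp
  qed
qed

lemma power_Suc_p_cong_imp_dvd:
  assumes p: "Factorial_Ring.prime (p::nat)" and "m' \<le> m"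
    and "[(p + 1) ^ m = (p + 1) ^ m'] (mod p ^ N)"
  shows "int p ^ N dvd (1 + int p) ^ (m - m') - 1"
proof -
  have "int (p ^ N) dvd int ((p + 1) ^ m) - int ((p + 1) ^ m')"
    using assms(3) cong_iff_dvd_diff cong_int_iff by blast
  also have "int ((p + 1) ^ m) - int ((p + 1) ^ m') = (1 + int p) ^ m' * ((1 + int p) ^ (m - m') - 1)"
    using assms(2) by (simp add: algebra_simps flip: power_add)
  finally have "int p ^ N dvd (1 + int p) ^ m' * ((1 + int p) ^ (m - m') - 1)" by simp
  moreover have "coprime (int p) (1 + int p)"
    using coprime_Suc_right_nat[of p] by (metis coprime_int_iff of_nat_Suc add.commute)
  hence "coprime (int p ^ N) ((1 + int p) ^ m')" by simp
  ultimately show ?thesis by (simp add: coprime_dvd_mult_right_iff)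
qed

lemma power_Suc_p_cong_odd:
  assumes p: "Factorial_Ring.prime (p::nat)" "p \<noteq> 2"
    and cong: "[(p + 1) ^ m = (p + 1) ^ m'] (mod p ^ Suc n)"
  shows "[m = m'] (mod p ^ n)"
proof -
  have *: "[m = m'] (mod p ^ n)" if "m' \<le> m" "[(p + 1) ^ m = (p + 1) ^ m'] (mod p ^ Suc n)" for m m'
  proof -
    have "int p ^ Suc n dvd int p ^ 1 * int (m - m')"
      by (rule lifting_the_exponent[OF p(1) _ _ _ _ power_Suc_p_cong_imp_dvd[OF p(1) that], where u = 1])
         (use p prime_gt_1_nat[OF p(1)] in auto)
    hence "int p ^ n dvd int (m - m')" using prime_gt_0_nat[OF p(1)] by simp
    hence "p ^ n dvd m - m'" by (metis int_dvd_int_iff of_nat_power)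
    thus ?thesis using that(1) by (simp add: cong_altdef_nat)
  qed
  show ?thesis using *[of m' m] *[of m m'] cong by (cases "m' \<le> m") (auto simp: cong_sym_eq)
qed

text \<open>The loss of two levels is dictated by \<open>p = 2\<close>, where
  \<open>3 = 1 + 2\<close> violates the condition \<open>c \<ge> 2\<close> and its square
  \<open>9 = 1 + 2 ^ 3\<close> is used instead.\<close>

lemma power_Suc_p_cong:
  assumes p: "Factorial_Ring.prime (p::nat)"
    and cong: "[(p + 1) ^ m = (p + 1) ^ m'] (mod p ^ (n + 2))"
  shows "[m = m'] (mod p ^ n)"
proof (cases "p = 2")
  case False
  have "[(p + 1) ^ m = (p + 1) ^ m'] (mod p ^ Suc n)"
    using cong by (rule cong_dvd_modulus_nat) (simp add: le_imp_power_dvd)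
  thus ?thesis by (rule power_Suc_p_cong_odd[OF p False])
next
  case True
  have *: "[m = m'] (mod p ^ n)" if "m' \<le> m" "[(p + 1) ^ m = (p + 1) ^ m'] (mod p ^ (n + 2))" for m m'
  proof -
    define d where "d = m - m'"
    have dvd: "2 ^ (n + 2) dvd (3 :: int) ^ d - 1"
      using power_Suc_p_cong_imp_dvd[OF p that] True by (simp add: d_def)
    have "even d"
    proof (rule ccontr)
      assume "odd d"
      then obtain e where e: "d = 2 * e + 1" by (elim oddE)
      have "(4 :: int) dvd 3 ^ d - 1" using dvd by (auto simp: power_add elim: dvd_mult_left)
      moreover have "(3 :: int) ^ d - 1 = 3 * (9 ^ e - 1) + 2" by (simp add: e power_mult)
      moreover have "(4 :: int) dvd 9 ^ e - 1"
        using dvd_diff_power[of 4 9 "1 :: int" e] by simp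
      ultimately have "(4 :: int) dvd 2" by (metis dvd_add_right_iff dvd_mult)
      thus False by simp
    qed
    then obtain e where e: "d = 2 * e" by (elim evenE)
    \<comment> \<open>The factor \<open>2 ^ 3\<close> times \<open>e = d / 2\<close> equals
      \<open>4 * d\<close>, so two of the \<open>n + 2\<close> factors are lost.\<close>
    have "int 2 ^ (n + 2) dvd int 2 ^ 3 * int e"
    proof (rule lifting_the_exponent)
      show "Factorial_Ring.prime (2 :: nat)" by simp
      show "(8 :: int) = int 2 ^ 3 * 1" by simp
      show "int 2 ^ (n + 2) dvd (1 + 8) ^ e - 1" using dvd by (simp add: e power_mult)
    qed auto
    hence "(4 :: int) * 2 ^ n dvd 4 * int d" by (simp add: e power_add mult_ac)
    hence "int (2 ^ n) dvd int d" by simp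
    hence "2 ^ n dvd d" by (simp only: int_dvd_int_iff)
    thus ?thesis using that(1) True by (simp add: cong_altdef_nat d_def)
  qed
  show ?thesis using *[of m' m] *[of m m'] cong by (cases "m' \<le> m") (auto simp: cong_sym_eq)
qed

text \<open>Counting: injectivity modulo \<open>p ^ n\<close> makes the exponents
  \<open>m < p ^ n\<close> exhaust the \<open>p ^ n\<close> residues congruent to 1 modulo
  \<open>p\<close>.\<close>

lemma power_Suc_p_surj:
  assumes p: "Factorial_Ring.prime (p::nat)" "p \<noteq> 2" and c: "[c = 1] (mod p)"
  shows "\<exists>m. [(p + 1) ^ m = c] (mod p ^ Suc n)"
proof -
  \<comment> \<open>A residue congruent to 1 modulo \<open>p\<close> is recorded by its quotient by
    \<open>p\<close>, which makes \<open>f\<close> a self-map of \<open>{..<p ^ n}\<close>.\<close>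
  define f where "f m = ((p + 1) ^ m mod p ^ Suc n) div p" for m
  have p1: "p > 1" using p(1) by (rule prime_gt_1_nat)
  have res: "x mod p ^ Suc n = p * (x mod p ^ Suc n div p) + 1" if "[x = 1] (mod p)" for x
  proof -
    have "x mod p ^ Suc n mod p = 1"
      using that p1 by (simp add: cong_def mod_mod_cancel)
    thus ?thesis by (metis mult_div_mod_eq)
  qed
  have rng: "x mod p ^ Suc n div p < p ^ n" for x
    using p1 by (simp add: less_mult_imp_div_less mult.commute)
  have pw: "[(p + 1) ^ m = 1] (mod p)" for m
  proof -
    have "[p + 1 = 1] (mod p)" by (simp only: cong_def mod_add_self1)
    from cong_pow[OF this, of m] show ?thesis by simp
  qed
  have "inj_on f {..<p ^ n}"
  proof (rule inj_onI)
    fix m m' assume m: "m \<in> {..<p ^ n}" "m' \<in> {..<p ^ n}" "f m = f m'"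
    hence "[(p + 1) ^ m = (p + 1) ^ m'] (mod p ^ Suc n)"
      unfolding cong_def using res[OF pw] unfolding f_def by metis
    from power_Suc_p_cong_odd[OF p this] show "m = m'" using m by (simp add: cong_def)
  qed
  hence "f ` {..<p ^ n} = {..<p ^ n}"
    by (intro endo_inj_surj) (use rng in \<open>auto simp: f_def\<close>)
  then obtain m where "f m = c mod p ^ Suc n div p"
    using rng[of c] by (metis imageE lessThan_iff)
  hence "(p + 1) ^ m mod p ^ Suc n = c mod p ^ Suc n"
    using res[OF pw[of m]] res[OF c] by (simp only: f_def)
  thus ?thesis by (auto simp: cong_def)
qed

section \<open>The Galois group of the cyclotomic tower\<close>

context perfect_char
begin

lemma Kinf_add: "x \<in> Kinf \<Longrightarrow> y \<in> Kinf \<Longrightarrow> x + y \<in> Kinf"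
  and Kinf_mult: "x \<in> Kinf \<Longrightarrow> y \<in> Kinf \<Longrightarrow> x * y \<in> Kinf"
  and Kinf_diff: "x \<in> Kinf \<Longrightarrow> y \<in> Kinf \<Longrightarrow> x - y \<in> Kinf"
proof -
  assume "x \<in> Kinf" "y \<in> Kinf"
  then obtain n f g where "x = ac.ev f (zeta n)" "y = ac.ev g (zeta n)"
    by (rule Kinf_common)
  hence "x + y = ac.ev (f + g) (zeta n ^ 1)" "x * y = ac.ev (f * g) (zeta n ^ 1)"
    "x - y = ac.ev (f - g) (zeta n ^ 1)"
    by (simp_all add: ac.ev_add ac.ev_mult ac.ev_diff)
  thus "x + y \<in> Kinf" "x * y \<in> Kinf" "x - y \<in> Kinf" by (simp_all only: ev_in_Kinf)
qed

lemma Kinf_to_ac: "to_ac c \<in> Kinf"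
  using Kn_to_ac Kn_subset_Kinf by blast

lemma Kinf_1: "1 \<in> Kinf"
  using Kinf_to_ac[of 1] by simp

lemma Kinf_power: "x \<in> Kinf \<Longrightarrow> x ^ k \<in> Kinf"
  by (induction k) (auto intro: Kinf_mult Kinf_1)

lemma Kinf_ev: "x \<in> Kinf \<Longrightarrow> ac.ev f x \<in> Kinf"
  by (rule ev_in_subring) (auto intro: Kinf_diff Kinf_mult Kinf_to_ac)

lemma G_closed: "g \<in> carrier G \<Longrightarrow> x \<in> Kinf \<Longrightarrow> g x \<in> Kinf"
  unfolding G_carrier by (auto simp: bij_betw_def)

lemma G_add: "g \<in> carrier G \<Longrightarrow> x \<in> Kinf \<Longrightarrow> y \<in> Kinf \<Longrightarrow> g (x + y) = g x + g y"
  and G_mult: "g \<in> carrier G \<Longrightarrow> x \<in> Kinf \<Longrightarrow> y \<in> Kinf \<Longrightarrow> g (x * y) = g x * g y"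
  and G_fix: "g \<in> carrier G \<Longrightarrow> x \<in> Kn 1 \<Longrightarrow> g x = x"
  and G_extensional: "g \<in> carrier G \<Longrightarrow> g \<in> extensional Kinf"
  and G_bij: "g \<in> carrier G \<Longrightarrow> bij_betw g Kinf Kinf"
  unfolding G_carrier by auto

lemma G_to_ac: "g \<in> carrier G \<Longrightarrow> g (to_ac c) = to_ac c"
  by (rule G_fix) (auto intro: Kn_to_ac)

lemma G_power: "g \<in> carrier G \<Longrightarrow> x \<in> Kinf \<Longrightarrow> g (x ^ k) = g x ^ k"
  using G_to_ac[of g 1] by (induction k) (auto simp: G_mult Kinf_power)

lemma G_ev: "g \<in> carrier G \<Longrightarrow> x \<in> Kinf \<Longrightarrow> g (ac.ev f x) = ac.ev f (g x)"
proof (induction f)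
  case 0
  thus ?case using G_to_ac[of g 0] by simp
next
  case (pCons a f)
  thus ?case by (simp add: G_add G_mult G_to_ac Kinf_to_ac Kinf_mult Kinf_ev)
qed

lemma G_zeta_ex: "g \<in> carrier G \<Longrightarrow> \<exists>a<CHAR('k) ^ n. g (zeta n) = zeta n ^ a"
proof -
  assume g: "g \<in> carrier G"
  have "g (zeta n) ^ (CHAR('k) ^ n) = g (zeta n ^ (CHAR('k) ^ n))"
    using g by (simp only: G_power zeta_in_Kinf)
  also have "\<dots> = 1" using G_to_ac[OF g, of 1] by simp
  finally have "g (zeta n) \<in> {z. z ^ (CHAR('k) ^ n) = 1}" by simp
  thus ?thesis unfolding roots_of_unity by blast
qed

lemma G_agree:
  assumes "g \<in> carrier G" "h \<in> carrier G" "g (zeta n) = h (zeta n)" "x \<in> Kn n"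
  shows "g x = h x"
proof -
  from assms(4) obtain f where "x = ac.ev f (zeta n)" by (auto simp: Kn_def)
  thus ?thesis using assms by (simp add: G_ev zeta_in_Kinf)
qed

lemma G_ext:
  assumes "g \<in> carrier G" "h \<in> carrier G" "\<And>n. g (zeta n) = h (zeta n)"
  shows "g = h"
proof (rule extensionalityI[of _ Kinf])
  show "g x = h x" if "x \<in> Kinf" for x
    using that G_agree[OF assms(1,2) assms(3)] by (auto simp: cyclotomic_field_inf)
qed (use assms in \<open>auto intro: G_extensional\<close>)

lemma G_zeta_le:
  assumes "g \<in> carrier G" "h \<in> carrier G" "g (zeta n) = h (zeta n)" "m \<le> n"
  shows "g (zeta m) = h (zeta m)"
  using assms zeta_in_Kn by (intro G_agree[OF assms(1-3)])

lemma G_zeta_exponent_le: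
  assumes "g \<in> carrier G" "g (zeta n) = zeta n ^ a" "m \<le> n"
  shows "g (zeta m) = zeta m ^ a"
proof -
  have "g (zeta m) = g (zeta n ^ (CHAR('k) ^ (n - m)))" using zeta_le[OF assms(3)] by simp
  also have "\<dots> = (zeta n ^ (CHAR('k) ^ (n - m))) ^ a"
    by (simp only: G_power[OF assms(1) zeta_in_Kinf] assms(2) mult.commute flip: power_mult)
  finally show ?thesis using zeta_le[OF assms(3)] by simp
qed

section \<open>The cyclotomic character\<close>

abbreviation chi :: "('k frac_closure \<Rightarrow> 'k frac_closure) \<Rightarrow> nat \<Rightarrow> nat" where
  "chi \<equiv> cyclotomic_character"

lemma chi_eq:
  assumes g: "g \<in> carrier G" and a: "g (zeta n) = zeta n ^ a"
  shows "chi g n = a mod CHAR('k) ^ n"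
  unfolding cyclotomic_character_def
proof (rule the_equality, intro conjI allI impI)
  show "a mod CHAR('k) ^ n < CHAR('k) ^ n" using p_gt_1 by simp
  have mod: "zeta n ^ (a mod CHAR('k) ^ n) = zeta n ^ a"
    by (simp add: zeta_power_eq_iff)
  fix z :: "'k frac_closure" assume "z ^ (CHAR('k) ^ n) = 1"
  hence "z \<in> (\<lambda>a. zeta n ^ a) ` {..<CHAR('k) ^ n}" unfolding roots_of_unity[symmetric] by simp
  then obtain b where b: "z = zeta n ^ b" by blast
  have "g z = (zeta n ^ a) ^ b" using G_power[OF g zeta_in_Kinf] a b by simp
  also have "\<dots> = (zeta n ^ (a mod CHAR('k) ^ n)) ^ b" by (simp only: mod)
  finally show "g z = z ^ (a mod CHAR('k) ^ n)" by (simp add: b mult.commute flip: power_mult)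
next
  fix b assume "b < CHAR('k) ^ n \<and> (\<forall>z. z ^ (CHAR('k) ^ n) = 1 \<longrightarrow> g z = z ^ b)"
  hence b: "b < CHAR('k) ^ n" "zeta n ^ b = zeta n ^ a" using a by auto
  thus "b = a mod CHAR('k) ^ n" by (simp add: zeta_power_eq_iff cong_def)
qed

lemma chi_zeta: "g \<in> carrier G \<Longrightarrow> g (zeta n) = zeta n ^ chi g n"
  using G_zeta_ex[of g n] chi_eq[of g n] by fastforce

lemma chi_coherent:
  assumes "g \<in> carrier G"
  shows "[chi g (Suc n) = chi g n] (mod CHAR('k) ^ n)"
proof -
  have "g (zeta n) = zeta n ^ chi g (Suc n)"
    by (rule G_zeta_exponent_le[OF assms chi_zeta[OF assms]]) simp
  thus ?thesis using chi_zeta[OF assms, of n] by (simp flip: zeta_power_eq_iff)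
qed

lemma mult_G [simp]: "g \<otimes>\<^bsub>G\<^esub> h = compose Kinf g h"
  and one_G: "\<one>\<^bsub>G\<^esub> = (\<lambda>x\<in>Kinf. x)"
  by (simp_all add: galois_group_def)

lemma compose_in_G:
  assumes "g \<in> carrier G" "h \<in> carrier G"
  shows "compose Kinf g h \<in> carrier G"
  unfolding G_carrier
proof (intro conjI ballI)
  show "bij_betw (compose Kinf g h) Kinf Kinf"
    using bij_betw_compose[OF G_bij[OF assms(2)] G_bij[OF assms(1)]] .
qed (use assms Kn_subset_Kinf[of 1] in
    \<open>auto simp: compose_def G_add G_mult G_fix G_closed Kinf_add Kinf_mult\<close>)

lemma group_G: "group G"
proof (rule groupI)
  show "\<one>\<^bsub>G\<^esub> \<in> carrier G"
    using Kn_subset_Kinf[of 1] unfolding G_carrier one_G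
    by (auto simp: Kinf_add Kinf_mult bij_betw_def inj_on_def)
  show "\<exists>h\<in>carrier G. h \<otimes>\<^bsub>G\<^esub> g = \<one>\<^bsub>G\<^esub>" if g: "g \<in> carrier G" for g
  proof
    define h where "h = restrict (inv_into Kinf g) Kinf"
    have inj: "inj_on g Kinf" and im: "g ` Kinf = Kinf" using G_bij[OF g] by (auto simp: bij_betw_def)
    have gh: "g (h x) = x" "h x \<in> Kinf" if "x \<in> Kinf" for x
      using that im by (auto simp: h_def f_inv_into_f inv_into_into)
    have hg: "h (g x) = x" if "x \<in> Kinf" for x
      using that inj im by (auto simp: h_def inv_into_f_f)
    have eq: "h y = x" if "x \<in> Kinf" "g x = y" for x y using hg that by blast
    show "h \<in> carrier G"
      unfolding G_carrier
    proof (intro conjI ballI)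
      show "bij_betw h Kinf Kinf"
        unfolding h_def using bij_betw_inv_into[OF G_bij[OF g]] by (simp cong: bij_betw_cong)
      show "h (x + y) = h x + h y" "h (x * y) = h x * h y" if "x \<in> Kinf" "y \<in> Kinf" for x y
        using that g gh by (auto intro!: eq simp: G_add G_mult Kinf_add Kinf_mult)
      show "h x = x" if "x \<in> Kn 1" for x
        using that g Kn_subset_Kinf by (intro eq) (auto simp: G_fix)
    qed (auto simp: h_def)
    show "h \<otimes>\<^bsub>G\<^esub> g = \<one>\<^bsub>G\<^esub>" unfolding mult_G one_G compose_def using hg by (auto simp: restrict_def)
  qed
qed (auto simp: compose_in_G compose_assoc one_G Id_compose G_closed G_extensional
    intro!: compose_assoc[symmetric] simp: Pi_iff)

text \<open>Existence comes from conjugation with exponent \<open>p + 1\<close>; uniqueness holds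
  because the character prescribes the image of every \<open>zeta n\<close>.\<close>

lemma gamma_elem_spec: "gamma_elem \<in> carrier G" "chi gamma_elem = zp_of_nat CHAR('k) (CHAR('k) + 1)"
proof -
  let ?a = "CHAR('k) + 1"
  define g where "g = restrict (conj_map ?a) Kinf"
  have a: "[?a = 1] (mod CHAR('k))" by (simp only: cong_def mod_add_self1)
  have g: "g \<in> carrier G" unfolding g_def by (rule conj_map_in_G[OF a])
  have na: "\<not> CHAR('k) dvd ?a"
    unfolding dvd_add_right_iff[OF dvd_refl] using p_gt_1 by simp
  have gz: "g (zeta n) = zeta n ^ ?a" if "n \<ge> 1" for n
    using conj_map_ev[OF na that, of "[:0, 1:]"] zeta_in_Kinf by (simp add: g_def)
  have "g (zeta n) = zeta n ^ ?a" for n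
    using gz[of n] G_to_ac[OF g, of 1] by (cases n) auto
  hence chi_g: "chi g = zp_of_nat CHAR('k) ?a"
    using chi_eq[OF g] by (auto simp: zp_of_nat_def fun_eq_iff)
  have unique: "h = g" if h: "h \<in> carrier G" "chi h = zp_of_nat CHAR('k) ?a" for h
  proof (rule G_ext[OF h(1) g])
    fix n
    have "h (zeta n) = zeta n ^ chi h n" by (rule chi_zeta[OF h(1)])
    also have "chi h n = chi g n" unfolding chi_g h(2) ..
    also have "zeta n ^ chi g n = g (zeta n)" by (rule chi_zeta[OF g, symmetric])
    finally show "h (zeta n) = g (zeta n)" .
  qed
  have "gamma_elem \<in> carrier G \<and> chi gamma_elem = zp_of_nat CHAR('k) ?a"
    unfolding gamma_elem_def
  proof (rule theI[where P = "\<lambda>g. g \<in> carrier G \<and> chi g = zp_of_nat CHAR('k) ?a"])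
    show "g \<in> carrier G \<and> chi g = zp_of_nat CHAR('k) ?a" using g chi_g ..
  next
    fix h assume "h \<in> carrier G \<and> chi h = zp_of_nat CHAR('k) ?a"
    thus "h = g" by (elim conjE) (rule unique)
  qed
  thus "gamma_elem \<in> carrier G" "chi gamma_elem = zp_of_nat CHAR('k) ?a" by (rule conjunct1, rule conjunct2)
qed

abbreviation \<gamma> :: "'k frac_closure \<Rightarrow> 'k frac_closure" where "\<gamma> \<equiv> gamma_elem"

lemma gamma_zeta: "\<gamma> (zeta n) = zeta n ^ (CHAR('k) + 1)"
  using chi_zeta[OF gamma_elem_spec(1), of n]
  unfolding gamma_elem_spec(2) zp_of_nat_def by (simp only: zeta_power_eq_iff cong_mod_left cong_refl)

primrec gamma_pow :: "nat \<Rightarrow> 'k frac_closure \<Rightarrow> 'k frac_closure" where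
  "gamma_pow 0 = (\<lambda>x\<in>Kinf. x)"
| "gamma_pow (Suc m) = compose Kinf \<gamma> (gamma_pow m)"

lemma gamma_pow_in_G: "gamma_pow m \<in> carrier G"
  using group.is_monoid[OF group_G] by (induction m) (auto simp: compose_in_G gamma_elem_spec one_G[symmetric] monoid.one_closed)

lemma gamma_pow_zeta: "gamma_pow m (zeta n) = zeta n ^ ((CHAR('k) + 1) ^ m)"
proof (induction m)
  case (Suc m)
  have "gamma_pow (Suc m) (zeta n) = \<gamma> (zeta n ^ ((CHAR('k) + 1) ^ m))"
    by (simp add: compose_def zeta_in_Kinf Suc)
  also have "\<dots> = zeta n ^ ((CHAR('k) + 1) ^ Suc m)"
    by (simp only: G_power[OF gamma_elem_spec(1) zeta_in_Kinf] gamma_zeta power_Suc flip: power_mult)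
  finally show ?case .
qed (simp add: zeta_in_Kinf)

end

section \<open>The topological group \<open>\<Gamma>\<close>\<close>

interpretation acv: vector_space "\<lambda>(c::'a::field) (x::'a alg_closure). to_ac c * x"
  by unfold_locales (auto simp: algebra_simps)

context perfect_char
begin

text \<open>In an algebraic equation for a nonzero \<open>x\<close>, factors of the variable are
  stripped until the constant term is nonzero. The equation then exhibits the inverse as a
  polynomial in \<open>x\<close>.\<close>

lemma Kn_inverse:
  assumes "x \<in> Kn n"
  shows "inverse x \<in> Kn n"
proof -
  have "inverse x \<in> Kn n" if "f \<noteq> 0" "ac.ev f x = 0" for f
    using that
  proof (induction f)
    case (pCons a f)
    have evKn: "ac.ev f x \<in> Kn n"
      by (rule ev_in_subring) (use assms Kn_diff Kn_mult Kn_to_ac in auto)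
    show ?case
    proof (cases "a = 0 \<and> x \<noteq> 0")
      case True
      thus ?thesis using pCons by auto
    next
      case False
      show ?thesis
      proof (cases "x = 0")
        case True
        thus ?thesis using Kn_to_ac[of 0 n] by simp
      next
        case x: False
        hence a: "a \<noteq> 0" using False by blast
        have "x * ac.ev f x = - to_ac a"
          using pCons.prems by (simp add: eq_neg_iff_add_eq_0 add.commute)
        hence "to_ac (- inverse a) * (x * ac.ev f x) = to_ac (inverse a * a)"
          by (simp only: to_ac_mult to_ac_minus mult_minus_left mult_minus_right minus_minus)
        hence "x * (to_ac (- inverse a) * ac.ev f x) = 1"
          using a by (simp only: mult.left_commute left_inverse to_ac_1 not_False_eq_True)
        hence "inverse x = to_ac (- inverse a) * ac.ev f x" by (rule inverse_unique)
        thus ?thesis using evKn Kn_mult Kn_to_ac by metis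
      qed
    qed
  qed auto
  moreover obtain f :: "'k witt fract poly" where "f \<noteq> 0" "ac.ev f x = 0"
    using alg_closure_algebraic[of x] unfolding ac.ev_def by blast
  ultimately show ?thesis by blast
qed

lemma ev_altdef: "ac.ev f x = (\<Sum>i\<le>Polynomial.degree f. to_ac (Polynomial.coeff f i) * x ^ i)"
  unfolding ac.ev_def by (simp add: poly_altdef degree_map_poly coeff_map_poly)

lemma Kn_span: "Kn n \<subseteq> acv.span ((\<lambda>i. zeta n ^ i) ` {..<CHAR('k) ^ n})"
proof
  fix x assume "x \<in> Kn n"
  then obtain f where f: "x = ac.ev f (zeta n)" by (auto simp: Kn_def)
  have "zeta n ^ i \<in> (\<lambda>i. zeta n ^ i) ` {..<CHAR('k) ^ n}" for i
  proof (rule image_eqI)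
    show "zeta n ^ i = zeta n ^ (i mod CHAR('k) ^ n)" by (simp add: zeta_power_eq_iff)
    show "i mod CHAR('k) ^ n \<in> {..<CHAR('k) ^ n}" using p_gt_1 by simp
  qed
  thus "x \<in> acv.span ((\<lambda>i. zeta n ^ i) ` {..<CHAR('k) ^ n})"
    unfolding f ev_altdef by (intro acv.span_sum acv.span_scale acv.span_base)
qed

lemma Kn_subspace: "acv.subspace (Kn n)"
  using Kn_to_ac[of 0 n] by (intro acv.subspaceI) (auto intro: Kn_add Kn_mult Kn_to_ac)

lemma finite_intermediate_Kn:
  assumes "n \<ge> 1"
  shows "finite_intermediate_field Kinf (cyclotomic_field 1) (Kn n)"
  unfolding finite_intermediate_field_def cyclotomic_field_1
proof (intro conjI ballI exI)
  define B where "B = (\<lambda>i. zeta n ^ i) ` {..<CHAR('k) ^ n}"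
  show "finite B" by (simp add: B_def)
  show "Kn n \<subseteq> {\<Sum>b\<in>B. c b * b | c. c \<in> B \<rightarrow> Kn 1}"
  proof
    fix x assume "x \<in> Kn n"
    hence "x \<in> acv.span B" using Kn_span by (auto simp: B_def)
    then obtain u where "x = (\<Sum>b\<in>B. to_ac (u b) * b)"
      unfolding acv.span_finite[OF \<open>finite B\<close>] by blast
    thus "x \<in> {\<Sum>b\<in>B. c b * b | c. c \<in> B \<rightarrow> Kn 1}"
      using Kn_to_ac by (intro CollectI exI[of _ "\<lambda>b. to_ac (u b)"]) auto
  qed
  show "Kn 1 \<subseteq> Kn n" by (rule Kn_mono[OF assms])
  show "Kn n \<subseteq> Kinf" by (rule Kn_subset_Kinf)
qed (rule Kn_diff Kn_mult Kn_inverse; assumption)+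

lemma finite_intermediate_bounded:
  assumes "finite_intermediate_field Kinf (cyclotomic_field 1) E"
  shows "\<exists>n\<ge>1. E \<subseteq> Kn n"
proof -
  from assms obtain B where B: "finite B" "E \<subseteq> {\<Sum>b\<in>B. c b * b | c. c \<in> B \<rightarrow> Kn 1}" and E: "E \<subseteq> Kinf"
    unfolding finite_intermediate_field_def cyclotomic_field_1 by blast
  define Z where "Z = (\<lambda>i. zeta 1 ^ i) ` {..<CHAR('k) ^ 1}"
  \<comment> \<open>Tower law: products of generators span \<open>E\<close> over the fraction field
    of \<open>W\<close>, so \<open>E\<close> has finite dimension over it.\<close>
  define S where "S = (\<lambda>(z, b). z * b) ` (Z \<times> B)"
  have "finite S" using B(1) by (simp add: S_def Z_def)
  have "c * b \<in> acv.span S" if "c \<in> Kn 1" "b \<in> B" for c b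
  proof -
    have "finite Z" by (simp add: Z_def)
    have "c \<in> acv.span Z" using that(1) Kn_span[of 1] unfolding Z_def by blast
    then obtain u where "c = (\<Sum>z\<in>Z. to_ac (u z) * z)"
      unfolding acv.span_finite[OF \<open>finite Z\<close>] by blast
    hence "c * b = (\<Sum>z\<in>Z. to_ac (u z) * (z * b))" by (simp add: sum_distrib_right mult.assoc)
    moreover have "z * b \<in> S" if "z \<in> Z" for z
      using that \<open>b \<in> B\<close> by (force simp: S_def)
    ultimately show ?thesis by (simp only:) (intro acv.span_sum acv.span_scale acv.span_base)
  qed
  hence "E \<subseteq> acv.span S" using B(2) by (fastforce intro: acv.span_sum)
  \<comment> \<open>The given spanning set \<open>B\<close> need not lie in \<open>Kinf\<close>. A
    basis inside \<open>E\<close> does, and being finite it lies in a single layer of the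
    tower.\<close>
  obtain B' where B': "B' \<subseteq> E" "acv.independent B'" "E \<subseteq> acv.span B'"
    by (rule acv.maximal_independent_subset)
  have "finite B'"
    using acv.independent_span_bound[OF \<open>finite S\<close> B'(2)] B'(1) \<open>E \<subseteq> acv.span S\<close> by blast
  moreover have "\<exists>n. b \<in> Kn n" if "b \<in> B'" for b
    using that B'(1) E by (auto simp: cyclotomic_field_inf)
  ultimately have "\<exists>n. B' \<subseteq> Kn n"
  proof (induction B')
    case (insert b B')
    then obtain n m where "B' \<subseteq> Kn n" "b \<in> Kn m" by blast
    thus ?case using Kn_mono[of n "max n m"] Kn_mono[of m "max n m"] by (intro exI[of _ "max n m"]) auto
  qed auto
  then obtain n where "B' \<subseteq> Kn n" by blast
  hence "B' \<subseteq> Kn (Suc n)" using Kn_mono[of n "Suc n"] by auto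
  hence "acv.span B' \<subseteq> Kn (Suc n)" using Kn_subspace by (rule acv.span_minimal)
  thus ?thesis using B'(3) by (intro exI[of _ "Suc n"]) auto
qed

section \<open>The Krull topology in terms of the roots \<open>zeta n\<close>\<close>

abbreviation \<T> :: "('k frac_closure \<Rightarrow> 'k frac_closure) topology" where "\<T> \<equiv> cyclotomic_krull_topology"

lemma agree_Kn_iff:
  assumes "g \<in> carrier G" "h \<in> carrier G"
  shows "(\<forall>x\<in>Kn n. h x = g x) \<longleftrightarrow> h (zeta n) = g (zeta n)"
  using G_agree[OF assms(2,1)] Kn_zeta by blast

lemma openin_krull_agree:
  assumes "g \<in> carrier G" "n \<ge> 1"
  shows "openin \<T> {h \<in> carrier G. h (zeta n) = g (zeta n)}"
proof -
  have "{h \<in> carrier G. h (zeta n) = g (zeta n)} = {h \<in> carrier G. \<forall>x\<in>Kn n. h x = g x}"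
    using agree_Kn_iff[OF assms(1)] by blast
  thus ?thesis unfolding krull_topology_def
    using assms finite_intermediate_Kn by (intro topology_generated_by_Basis) blast
qed

lemma topspace_krull: "topspace \<T> = carrier G"
  unfolding krull_topology_def topology_generated_by_topspace
  using finite_intermediate_Kn[of 1] by blast

text \<open>The layers \<open>Kn n\<close> are cofinal among the finite intermediate fields, so
  agreement at a single \<open>zeta n\<close> gives a neighbourhood base; finite intersections are
  handled by the larger level.\<close>

lemma krull_neighbourhood:
  assumes "openin \<T> U" "g \<in> U"
  shows "\<exists>n\<ge>1. \<forall>h\<in>carrier G. h (zeta n) = g (zeta n) \<longrightarrow> h \<in> U"
  using openin_topology_generated_by[OF assms(1)[unfolded krull_topology_def]] assms(2)
proof (induction arbitrary: g rule: generate_topology_on.induct)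
  case (Int a b)
  have ab: "g \<in> a" "g \<in> b" using Int.prems by auto
  obtain n where n: "n \<ge> 1" "\<forall>h\<in>carrier G. h (zeta n) = g (zeta n) \<longrightarrow> h \<in> a"
    using Int.IH(1)[OF ab(1)] by blast
  obtain m where m: "\<forall>h\<in>carrier G. h (zeta m) = g (zeta m) \<longrightarrow> h \<in> b"
    using Int.IH(2)[OF ab(2)] by blast
  have "g \<in> carrier G"
  proof -
    have "openin \<T> a" using Int.hyps(1) unfolding krull_topology_def openin_topology_generated_by_iff .
    from openin_subset[OF this] ab(1) show ?thesis unfolding topspace_krull by (rule subsetD)
  qed
  note le = G_zeta_le[OF _ this]
  have "h \<in> a \<inter> b" if "h \<in> carrier G" "h (zeta (max n m)) = g (zeta (max n m))" for h
    using n(2) m le[OF that max.cobounded1] le[OF that max.cobounded2] that(1) by auto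
  thus ?case using n(1) by (intro exI[of _ "max n m"]) auto
next
  case (UN K)
  then obtain a where "a \<in> K" "g \<in> a" by blast
  from UN.IH[OF this] show ?case using \<open>a \<in> K\<close> by blast
next
  case (Basis s)
  then obtain g' E where s: "s = {h \<in> carrier G. \<forall>x\<in>E. h x = g' x}" "g' \<in> carrier G"
    "finite_intermediate_field Kinf (cyclotomic_field 1) E" by blast
  from finite_intermediate_bounded[OF s(3)] obtain n where n: "n \<ge> 1" "E \<subseteq> Kn n" by blast
  have "h \<in> s" if "h \<in> carrier G" "h (zeta n) = g (zeta n)" for h
    using that Basis.prems n(2) agree_Kn_iff[of g h n] unfolding s(1) by auto
  thus ?case using n(1) by blast
qed auto

lemma carrier_Gamma_subset: "carrier Gamma_group \<subseteq> carrier G"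
proof (cases "CHAR('k) = 2")
  case True
  thus ?thesis using closure_of_subset_topspace[of \<T>] by (simp add: Gamma_group_def topspace_krull)
qed (simp add: Gamma_group_def)

lemma mult_Gamma: "g \<otimes>\<^bsub>Gamma_group\<^esub> h = compose Kinf g h"
  and one_Gamma: "\<one>\<^bsub>Gamma_group\<^esub> = (\<lambda>x\<in>Kinf. x)"
  by (auto simp: Gamma_group_def one_G)

text \<open>The shift by two makes the exponent unique modulo \<open>p ^ n\<close> also for \<open>p = 2\<close>, where
  the order of \<open>3\<close> modulo \<open>2 ^ (n + 2)\<close> is only \<open>2 ^ n\<close>.\<close>

definition approx :: "('k frac_closure \<Rightarrow> 'k frac_closure) \<Rightarrow> nat \<Rightarrow> nat \<Rightarrow> bool" where
  "approx g n m \<longleftrightarrow> g (zeta (n + 2)) = zeta (n + 2) ^ ((CHAR('k) + 1) ^ m)"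

lemma approx_iff_gamma_pow: "approx g n m \<longleftrightarrow> g (zeta (n + 2)) = gamma_pow m (zeta (n + 2))"
  by (simp add: approx_def gamma_pow_zeta)

lemma approx_unique:
  assumes "approx g n m" "approx g n m'"
  shows "[m = m'] (mod CHAR('k) ^ n)"
proof (rule power_Suc_p_cong[OF prime_p])
  show "[(CHAR('k) + 1) ^ m = (CHAR('k) + 1) ^ m'] (mod CHAR('k) ^ (n + 2))"
    unfolding zeta_power_eq_iff[symmetric] using assms unfolding approx_def by argo
qed

lemma approx_le: "g \<in> carrier G \<Longrightarrow> approx g n m \<Longrightarrow> n' \<le> n \<Longrightarrow> approx g n' m"
  unfolding approx_iff_gamma_pow by (rule G_zeta_le[OF _ gamma_pow_in_G]) auto

lemma approx_gamma_pow: "approx (gamma_pow m) n m"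
  by (simp add: approx_iff_gamma_pow)

lemma approx_compose:
  assumes "g \<in> carrier G" "approx g n m" "approx h n m'"
  shows "approx (compose Kinf g h) n (m + m')"
proof -
  have "compose Kinf g h (zeta (n + 2)) = g (zeta (n + 2)) ^ ((CHAR('k) + 1) ^ m')"
    using assms(3) G_power[OF assms(1) zeta_in_Kinf] by (simp only: compose_eq zeta_in_Kinf approx_def)
  thus ?thesis using assms(2) by (simp only: approx_def power_add flip: power_mult)
qed

lemma approx_gamma: "approx \<gamma> n 1"
  by (simp only: approx_def gamma_zeta power_one_right)

lemma gamma_power_order: "\<exists>d>0. [(CHAR('k) + 1) ^ d = 1] (mod CHAR('k) ^ n)"
proof -
  have "coprime (CHAR('k) + 1) (CHAR('k) ^ n)" by simp
  thus ?thesis using euler_theorem[of "CHAR('k) + 1" "CHAR('k) ^ n"] p_gt_1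
    by (intro exI[of _ "totient (CHAR('k) ^ n)"]) auto
qed

text \<open>At a fixed level \<gamma> has finite order, so its inverse acts there as a power with
  natural exponent, the only kind that \<open>approx\<close> admits.\<close>

lemma approx_inv_gamma: "\<exists>m. approx (inv\<^bsub>G\<^esub> \<gamma>) n m"
proof -
  interpret group G by (rule group_G)
  note \<gamma> = gamma_elem_spec(1)
  obtain d where d: "d > 0" "[(CHAR('k) + 1) ^ d = 1] (mod CHAR('k) ^ (n + 2))"
    using gamma_power_order by blast
  obtain e where e: "d = Suc e" using d(1) by (cases d) auto
  obtain a where a: "(inv\<^bsub>G\<^esub> \<gamma>) (zeta (n + 2)) = zeta (n + 2) ^ a"
    using G_zeta_ex[OF inv_closed[OF \<gamma>]] by blast
  have "(inv\<^bsub>G\<^esub> \<gamma> \<otimes>\<^bsub>G\<^esub> \<gamma>) (zeta (n + 2)) = zeta (n + 2)"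
    using l_inv[OF \<gamma>] by (simp add: one_G zeta_in_Kinf)
  hence "(inv\<^bsub>G\<^esub> \<gamma>) (zeta (n + 2) ^ (CHAR('k) + 1)) = zeta (n + 2)"
    by (simp only: mult_G compose_eq[OF zeta_in_Kinf] gamma_zeta)
  hence "zeta (n + 2) ^ (a * (CHAR('k) + 1)) = zeta (n + 2) ^ 1"
    by (simp only: G_power[OF inv_closed[OF \<gamma>] zeta_in_Kinf] a power_one_right flip: power_mult)
  hence "[a * (CHAR('k) + 1) = 1] (mod CHAR('k) ^ (n + 2))" unfolding zeta_power_eq_iff .
  from cong_mult[OF this cong_refl[of "(CHAR('k) + 1) ^ e"]]
  have "[a * (CHAR('k) + 1) ^ d = (CHAR('k) + 1) ^ e] (mod CHAR('k) ^ (n + 2))"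
    by (simp only: e power_Suc mult.assoc mult_1)
  moreover have "[a * (CHAR('k) + 1) ^ d = a * 1] (mod CHAR('k) ^ (n + 2))"
    by (intro cong_mult cong_refl d(2))
  ultimately have "[a = (CHAR('k) + 1) ^ e] (mod CHAR('k) ^ (n + 2))"
    by (metis cong_sym cong_trans mult_1_right)
  thus ?thesis unfolding approx_def a zeta_power_eq_iff by blast
qed

lemma approx_generate:
  assumes "g \<in> generate G {\<gamma>}"
  shows "\<exists>m. approx g n m"
  using assms
proof (induction rule: generate.induct)
  case one
  show ?case using approx_gamma_pow[of 0 n] unfolding one_G gamma_pow.simps by blast
next
  case (incl h)
  thus ?case using approx_gamma by blast
next
  case (inv h)
  thus ?case using approx_inv_gamma by blast
next
  case (eng h1 h2)
  have "h1 \<in> carrier G"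
    using group.generate_in_carrier[OF group_G, of "{\<gamma>}"] eng.hyps gamma_elem_spec(1) by blast
  thus ?case using eng.IH approx_compose by (metis mult_G)
qed

lemma gamma_pow_in_generate: "gamma_pow m \<in> generate G {\<gamma>}"
proof (induction m)
  case 0
  show ?case using generate.one[of G "{\<gamma>}"] unfolding one_G gamma_pow.simps .
next
  case (Suc m)
  show ?case using generate.eng[OF generate.incl[of \<gamma> "{\<gamma>}" G] Suc] by simp
qed

text \<open>Makes the two cases of \<open>Gamma_group\<close> uniform. For odd \<open>p\<close>
  every \<open>g\<close> fixes \<open>zeta 1\<close>, so its character is 1 modulo \<open>p\<close>
  and a power of \<open>1 + p\<close> at each level; for \<open>p = 2\<close>, lying in the closure
  means agreeing at each level with an element generated by \<gamma>.\<close>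

lemma carrier_Gamma: "carrier Gamma_group = {g \<in> carrier G. \<forall>n. \<exists>m. approx g n m}"
proof (cases "CHAR('k) = 2")
  case False
  have "\<exists>m. approx g n m" if g: "g \<in> carrier G" for g n
  proof -
    have "zeta 1 ^ chi g (n + 2) = g (zeta 1)"
      by (rule G_zeta_exponent_le[OF g chi_zeta[OF g], symmetric]) simp
    also have "\<dots> = zeta 1 ^ 1" using G_fix[OF g Kn_zeta[of 1]] by simp
    finally have "[chi g (n + 2) = 1] (mod CHAR('k))" unfolding zeta_power_eq_iff by simp
    from power_Suc_p_surj[OF prime_p False this, of "Suc n"] obtain m where
      "[(CHAR('k) + 1) ^ m = chi g (n + 2)] (mod CHAR('k) ^ (n + 2))" by auto
    thus ?thesis unfolding approx_def chi_zeta[OF g] zeta_power_eq_iff by (blast intro: cong_sym)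
  qed
  thus ?thesis using False by (auto simp: Gamma_group_def)
next
  case True
  define C where "C = \<T> closure_of generate G {\<gamma>}"
  have car: "carrier Gamma_group = C" using True by (simp add: Gamma_group_def C_def)
  show ?thesis unfolding car
  proof (intro subset_antisym subsetI)
    fix g assume g: "g \<in> C"
    have gG: "g \<in> carrier G" using g car carrier_Gamma_subset by blast
    have "\<exists>m. approx g n m" for n
    proof -
      have "openin \<T> {h \<in> carrier G. h (zeta (n + 2)) = g (zeta (n + 2))}"
        by (rule openin_krull_agree[OF gG]) simp
      moreover have "g \<in> {h \<in> carrier G. h (zeta (n + 2)) = g (zeta (n + 2))}" using gG by simp
      ultimately have "\<exists>h. h \<in> generate G {\<gamma>} \<and> h \<in> {h \<in> carrier G. h (zeta (n + 2)) = g (zeta (n + 2))}"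
        using g[unfolded C_def in_closure_of] by (elim conjE allE impE) (rule conjI; assumption)
      then obtain h where h: "h \<in> generate G {\<gamma>}" "h (zeta (n + 2)) = g (zeta (n + 2))"
        by auto
      from approx_generate[OF h(1), of n] show ?thesis using h(2) by (simp add: approx_def)
    qed
    thus "g \<in> {g \<in> carrier G. \<forall>n. \<exists>m. approx g n m}" using gG by blast
  next
    fix g assume "g \<in> {g \<in> carrier G. \<forall>n. \<exists>m. approx g n m}"
    hence gG: "g \<in> carrier G" and ap: "\<And>n. \<exists>m. approx g n m" by auto
    show "g \<in> C" unfolding C_def in_closure_of topspace_krull
    proof (intro conjI allI impI gG)
      fix U assume "g \<in> U \<and> openin \<T> U"
      then obtain n where n: "\<forall>h\<in>carrier G. h (zeta n) = g (zeta n) \<longrightarrow> h \<in> U"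
        using krull_neighbourhood by blast
      obtain m where m: "approx g n m" using ap by blast
      have "gamma_pow m (zeta (n + 2)) = g (zeta (n + 2))" using m by (simp add: approx_iff_gamma_pow)
      hence "gamma_pow m (zeta n) = g (zeta n)" by (rule G_zeta_le[OF gamma_pow_in_G gG]) simp
      thus "\<exists>y. y \<in> generate G {\<gamma>} \<and> y \<in> U" using n gamma_pow_in_G gamma_pow_in_generate by blast
    qed
  qed
qed

lemma Gamma_approx: "g \<in> carrier Gamma_group \<Longrightarrow> \<exists>m. approx g n m"
  by (simp add: carrier_Gamma)

lemma gamma_pow_in_Gamma: "gamma_pow m \<in> carrier Gamma_group"
  using approx_gamma_pow by (auto simp: carrier_Gamma gamma_pow_in_G)

lemma gamma_in_Gamma: "\<gamma> \<in> carrier Gamma_group"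
  using approx_gamma by (auto simp: carrier_Gamma gamma_elem_spec)

lemma compose_in_Gamma:
  assumes "g \<in> carrier Gamma_group" "h \<in> carrier Gamma_group"
  shows "compose Kinf g h \<in> carrier Gamma_group"
  using assms approx_compose compose_in_G unfolding carrier_Gamma by blast

lemma openin_Gamma_approx: "openin Gamma_topology {g \<in> carrier Gamma_group. approx g n m}"
proof -
  have "openin \<T> {h \<in> carrier G. h (zeta (n + 2)) = gamma_pow m (zeta (n + 2))}"
    by (rule openin_krull_agree[OF gamma_pow_in_G]) simp
  moreover have "{g \<in> carrier Gamma_group. approx g n m}
      = {h \<in> carrier G. h (zeta (n + 2)) = gamma_pow m (zeta (n + 2))} \<inter> carrier Gamma_group"
    using carrier_Gamma_subset by (auto simp: approx_iff_gamma_pow)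
  ultimately show ?thesis unfolding Gamma_topology_def openin_subtopology by blast
qed

lemma Gamma_neighbourhood:
  assumes "openin Gamma_topology U" "g \<in> U"
  shows "\<exists>N. \<forall>n\<ge>N. \<forall>m. approx g n m \<longrightarrow> gamma_pow m \<in> U"
proof -
  from assms obtain V where V: "openin \<T> V" "U = V \<inter> carrier Gamma_group"
    unfolding Gamma_topology_def openin_subtopology by blast
  from krull_neighbourhood[OF V(1)] assms(2) V(2) obtain N where
    N: "\<forall>h\<in>carrier G. h (zeta N) = g (zeta N) \<longrightarrow> h \<in> V" by blast
  have gG: "g \<in> carrier G" using assms(2) V(2) carrier_Gamma_subset by blast
  have "gamma_pow m \<in> U" if "n \<ge> N" "approx g n m" for n m
  proof -
    have "gamma_pow m (zeta (n + 2)) = g (zeta (n + 2))" using that(2) by (simp add: approx_iff_gamma_pow)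
    hence "gamma_pow m (zeta N) = g (zeta N)" by (rule G_zeta_le[OF gamma_pow_in_G gG]) (use that(1) in simp)
    thus ?thesis using N gamma_pow_in_G gamma_pow_in_Gamma V(2) by blast
  qed
  thus ?thesis by blast
qed

lemma topspace_Gamma: "topspace Gamma_topology = (carrier Gamma_group :: ('k frac_closure \<Rightarrow> _) set)"
  using carrier_Gamma_subset by (auto simp: Gamma_topology_def topspace_krull)

end

section \<open>The action of \<open>\<gamma>\<close> on \<open>R\<close>\<close>

context perfect_char
begin

text \<open>The action of \<gamma> on \<open>R\<close> with a natural exponent of \<open>q\<close>
  in place of a p-adic limit; \<open>Gamma_act_gamma\<close> identifies the two.\<close>

definition gamma_R :: "'k witt fps \<Rightarrow> 'k witt fps" where
  "gamma_R r = fps_compose r (qvar ^ (CHAR('k) + 1) - 1)"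

lemma qvar_power_minus_1_nth_0: "fps_nth (qvar ^ a - 1 :: 'k witt fps) 0 = 0"
  by (simp add: fps_power_zeroth qvar_def)

lemma gamma_R_add: "gamma_R (r + s) = gamma_R r + gamma_R s"
  by (simp add: gamma_R_def fps_compose_add_distrib)

lemma gamma_R_mult: "gamma_R (r * s) = gamma_R r * gamma_R s"
  unfolding gamma_R_def by (rule fps_compose_mult_distrib[OF qvar_power_minus_1_nth_0])

lemma gamma_R_const: "gamma_R (fps_const c) = fps_const c"
  by (simp add: gamma_R_def)

lemma gamma_R_X: "gamma_R fps_X = qvar ^ (CHAR('k) + 1) - 1"
  unfolding gamma_R_def by (rule fps_X_fps_compose_startby0[OF qvar_power_minus_1_nth_0])

lemma qvar_power_compose:
  assumes "fps_nth c 0 = 0"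
  shows "fps_compose (qvar ^ a) c = (1 + c :: 'k witt fps) ^ a"
  using assms by (simp add: fps_compose_power[OF assms, symmetric] qvar_def fps_compose_add_distrib)

lemma gamma_R_power: "(gamma_R ^^ m) r = fps_compose r (qvar ^ ((CHAR('k) + 1) ^ m) - 1)"
proof (induction m)
  case 0
  have "fps_compose r (fps_X :: 'k witt fps) = r" by simp
  thus ?case by (simp add: qvar_minus_1)
next
  case (Suc m)
  let ?a = "(CHAR('k) + 1) ^ m" and ?c = "qvar ^ (CHAR('k) + 1) - 1 :: 'k witt fps"
  have "(gamma_R ^^ Suc m) r = fps_compose (fps_compose r (qvar ^ ?a - 1)) ?c"
    by (simp only: funpow.simps comp_def Suc gamma_R_def[of "fps_compose r (qvar ^ ?a - 1)"])
  also have "\<dots> = fps_compose r (fps_compose (qvar ^ ?a - 1) ?c)"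
    by (rule fps_compose_assoc[symmetric]; rule qvar_power_minus_1_nth_0)
  also have "fps_compose (qvar ^ ?a - 1) ?c = (1 + ?c) ^ ?a - 1"
    by (simp only: fps_compose_sub_distrib fps_compose_1 qvar_power_compose[OF qvar_power_minus_1_nth_0])
  also have "\<dots> = qvar ^ ((CHAR('k) + 1) ^ Suc m) - 1"
    by (simp only: add_diff_cancel_left' diff_add_cancel add.commute[of 1] power_Suc flip: power_mult)
  finally show ?case .
qed

lemma Gamma_act_approx:
  assumes "g \<in> carrier G" "approx g n m"
  shows "(gamma_R ^^ m) r - Gamma_act g r \<in> I n"
proof -
  have "chi g (n + 2) = (CHAR('k) + 1) ^ m mod CHAR('k) ^ (n + 2)"
    using assms by (intro chi_eq) (simp_all only: approx_def)
  hence "[(CHAR('k) + 1) ^ m = chi g (n + 2)] (mod CHAR('k) ^ (n + 2))"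
    by (simp only: cong_mod_right cong_refl)
  hence "qvar ^ ((CHAR('k) + 1) ^ m) - qvar ^ chi g (n + 2) \<in> I (n + 2)" by (rule qvar_power_cong)
  moreover have "qvar ^ chi g (n + 2) - qpower (chi g) \<in> I (n + 2)"
    by (rule qpower_approx[OF chi_coherent[OF assms(1)]])
  ultimately have "(qvar ^ ((CHAR('k) + 1) ^ m) - qvar ^ chi g (n + 2))
      + (qvar ^ chi g (n + 2) - qpower (chi g)) \<in> I (n + 2)" by (rule pq_add)
  hence "(qvar ^ ((CHAR('k) + 1) ^ m) - 1) - (qpower (chi g) - 1) \<in> I (n + 2)" by simp
  from fps_compose_cong_pq[OF this, of r] have "(gamma_R ^^ m) r - Gamma_act g r \<in> I (n + 2)"
    unfolding gamma_R_power Gamma_act_def .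
  thus ?thesis by (rule pq_antimono) simp
qed

lemma Gamma_act_gamma: "Gamma_act \<gamma> r = gamma_R r"
proof -
  have "gamma_R r - Gamma_act \<gamma> r \<in> I n" for n
    using Gamma_act_approx[OF gamma_elem_spec(1) approx_gamma, of r n] by simp
  from pq_separated[OF this] show ?thesis by simp
qed

abbreviation qq :: "'k witt fps" where "qq \<equiv> qvar\<^sup>2 - qvar"

lemma qq_eq: "qq = qvar * fps_X"
  by (simp add: qvar_minus_1[symmetric] algebra_simps power2_eq_square)

lemma qvar_unit: "\<exists>v. qvar * v = (1 :: 'k witt fps)"
proof -
  have "(1 + fps_X) * Abs_fps (\<lambda>n. (-1) ^ n) = (1 :: 'k witt fps)"
    by (rule fps_ext) (auto simp: distrib_right gr0_conv_Suc)
  thus ?thesis unfolding qvar_def by blast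
qed

lemma qq_neq_0: "qq \<noteq> 0"
proof -
  have "qvar \<noteq> (0 :: 'k witt fps)" using qvar_unit by force
  thus ?thesis by (simp add: qq_eq)
qed

lemma qq_in_pq: "qq \<in> I 1"
  unfolding qq_eq by (rule pq_mult_left[OF X_in_pq])

text \<open>The identity that turns the Leibniz rule for \<open>q\<close> into semilinearity and
  back.\<close>

lemma qq_q_analog: "qq * q_analog_p = qvar ^ (CHAR('k) + 1) - qvar"
proof -
  have "fps_X * q_analog_p = (qvar ^ CHAR('k) - 1 :: 'k witt fps)"
    unfolding q_analog_p_def qvar_minus_1[symmetric] by (rule power_diff_1_eq[symmetric])
  hence "qvar * (fps_X * q_analog_p) = qvar * (qvar ^ CHAR('k) - 1 :: 'k witt fps)"
    by (simp only:)
  thus ?thesis by (simp add: qq_eq mult.assoc right_diff_distrib)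
qed

text \<open>The q-analogue of \<open>p + 1\<close>, the factor by which \<gamma> rescales
  \<open>q - 1\<close>. Since it is 1 modulo \<open>(p, q - 1)\<close>, subtracting the identity
  raises the filtration.\<close>

definition q_analog_Suc_p :: "'k witt fps" where "q_analog_Suc_p = (\<Sum>i<CHAR('k) + 1. qvar ^ i)"

lemma gamma_R_X_eq: "gamma_R fps_X = fps_X * q_analog_Suc_p"
  unfolding gamma_R_X q_analog_Suc_p_def unfolding qvar_minus_1[symmetric] by (rule power_diff_1_eq)

lemma q_analog_Suc_p_minus_1: "q_analog_Suc_p - 1 \<in> I 1"
proof -
  have "qvar ^ i - 1 \<in> I 1" for i
    by (rule power_minus_1_in_pq) (simp add: qvar_minus_1 X_in_pq del: One_nat_def)
  hence "(\<Sum>i<CHAR('k) + 1. qvar ^ i - 1) + of_nat CHAR('k) \<in> I 1"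
    by (intro pq_add pq_sum p_in_pq)
  also have "(\<Sum>i<CHAR('k) + 1. qvar ^ i - 1) + of_nat CHAR('k) = q_analog_Suc_p - (1 :: 'k witt fps)"
    by (simp only: q_analog_Suc_p_def sum_subtractf) simp
  finally show ?thesis .
qed

end

section \<open>Free modules in coordinates\<close>

lemma R_ring_simps [simp]:
  "carrier R_ring = UNIV" "r \<oplus>\<^bsub>R_ring\<^esub> s = r + s" "r \<otimes>\<^bsub>R_ring\<^esub> s = r * s"
  "\<one>\<^bsub>R_ring\<^esub> = 1" "\<zero>\<^bsub>R_ring\<^esub> = 0"
  by (simp_all add: ring_of_type_algebra_def)

text \<open>\<open>M\<close> is presented as a product of copies of \<open>R\<close> indexed by
  \<open>B\<close>, with coordinate functions in place of a basis. Filtration, completeness and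
  cancellation are then inherited coordinatewise.\<close>

locale free_module = perfect_char TYPE_k for TYPE_k :: "'k::field_prime_char itself" +
  fixes M :: "('k witt fps, 'm) module" (structure)
    and B :: "'b set" and crd :: "'m \<Rightarrow> 'b \<Rightarrow> 'k witt fps"
  assumes module_M: "Module.module R_ring M"
    and crd_add: "x \<in> carrier M \<Longrightarrow> y \<in> carrier M \<Longrightarrow> b \<in> B \<Longrightarrow> crd (x \<oplus> y) b = crd x b + crd y b"
    and crd_smult: "x \<in> carrier M \<Longrightarrow> b \<in> B \<Longrightarrow> crd (r \<odot> x) b = r * crd x b"
    and crd_eqI: "x \<in> carrier M \<Longrightarrow> y \<in> carrier M \<Longrightarrow> (\<And>b. b \<in> B \<Longrightarrow> crd x b = crd y b) \<Longrightarrow> x = y"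
    and crd_surj: "\<exists>x\<in>carrier M. \<forall>b\<in>B. crd x b = f b"
begin

sublocale Mod: Module.module R_ring M
  by (rule module_M)

lemma smult_closed [simp]: "x \<in> carrier M \<Longrightarrow> r \<odot> x \<in> carrier M"
  by (rule Mod.smult_closed) auto

lemma crd_zero:
  assumes "b \<in> B"
  shows "crd \<zero> b = 0"
proof -
  have "crd \<zero> b = crd \<zero> b + crd \<zero> b" using crd_add[of \<zero> \<zero> b] assms by simp
  thus ?thesis by (simp only: add_cancel_right_right)
qed

lemma crd_minus:
  assumes "x \<in> carrier M" "y \<in> carrier M" "b \<in> B"
  shows "crd (x \<ominus> y) b = crd x b - crd y b"
proof -
  have "crd (x \<ominus> y \<oplus> y) b = crd (x \<ominus> y) b + crd y b"
    using assms by (intro crd_add) auto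
  moreover have "x \<ominus> y \<oplus> y = x"
    using assms by (simp add: Mod.minus_eq Mod.a_assoc Mod.l_neg)
  ultimately show ?thesis by simp
qed

lemmas crd_simps = crd_add crd_smult crd_minus crd_zero

definition filt :: "nat \<Rightarrow> 'm set" where
  "filt n = {x \<in> carrier M. \<forall>b\<in>B. crd x b \<in> I n}"

lemma filtI: "x \<in> carrier M \<Longrightarrow> (\<And>b. b \<in> B \<Longrightarrow> crd x b \<in> I n) \<Longrightarrow> x \<in> filt n"
  and filt_carrier: "x \<in> filt n \<Longrightarrow> x \<in> carrier M"
  and filtD: "x \<in> filt n \<Longrightarrow> b \<in> B \<Longrightarrow> crd x b \<in> I n"
  by (auto simp: filt_def)

lemma pq_filtration_eq: "pq_filtration M n = filt n"
proof (induction n)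
  case 0
  show ?case by (simp add: filt_def)
next
  case (Suc n)
  show ?case
  proof (intro subset_antisym subsetI)
    fix z assume "z \<in> pq_filtration M (Suc n)"
    then obtain x y where z: "z = of_nat CHAR('k) \<odot> x \<oplus> (qvar - 1) \<odot> y" "x \<in> filt n" "y \<in> filt n"
      unfolding pq_filtration.simps Suc by blast
    show "z \<in> filt (Suc n)"
    proof (rule filtI)
      show "z \<in> carrier M" using z filt_carrier by simp
      fix b assume b: "b \<in> B"
      have "crd z b = of_nat CHAR('k) * crd x b + (qvar - 1) * crd y b"
        using z filt_carrier b by (simp add: crd_simps)
      thus "crd z b \<in> I (Suc n)" using filtD[OF z(2) b] filtD[OF z(3) b]
        unfolding pq_ideal_power.simps by blast
    qed
  next
    fix z assume z: "z \<in> filt (Suc n)"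
    hence "\<forall>b\<in>B. \<exists>r s. crd z b = of_nat CHAR('k) * r + (qvar - 1) * s \<and> r \<in> I n \<and> s \<in> I n"
      using filtD[OF z] unfolding pq_ideal_power.simps by blast
    then obtain r s where rs: "\<And>b. b \<in> B \<Longrightarrow> crd z b = of_nat CHAR('k) * r b + (qvar - 1) * s b"
      "\<And>b. b \<in> B \<Longrightarrow> r b \<in> I n" "\<And>b. b \<in> B \<Longrightarrow> s b \<in> I n" by metis
    obtain x where x: "x \<in> carrier M" "\<And>b. b \<in> B \<Longrightarrow> crd x b = r b" using crd_surj[of r] by blast
    obtain y where y: "y \<in> carrier M" "\<And>b. b \<in> B \<Longrightarrow> crd y b = s b" using crd_surj[of s] by blast
    have "z = of_nat CHAR('k) \<odot> x \<oplus> (qvar - 1) \<odot> y"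
      using x y rs filt_carrier[OF z] by (intro crd_eqI) (simp_all add: crd_simps)
    moreover have "x \<in> filt n" "y \<in> filt n" using x y rs by (auto intro: filtI)
    ultimately show "z \<in> pq_filtration M (Suc n)" unfolding pq_filtration.simps Suc by blast
  qed
qed

lemma filt_0: "x \<in> carrier M \<Longrightarrow> x \<in> filt 0"
  by (auto simp: filt_def)

lemma filt_add: "x \<in> filt n \<Longrightarrow> y \<in> filt n \<Longrightarrow> x \<oplus> y \<in> filt n"
  by (auto simp: filt_def crd_simps pq_add)

lemma filt_minus: "x \<in> filt n \<Longrightarrow> y \<in> filt n \<Longrightarrow> x \<ominus> y \<in> filt n"
  by (auto simp: filt_def crd_simps pq_diff)

lemma filt_smult: "r \<in> I i \<Longrightarrow> x \<in> filt j \<Longrightarrow> r \<odot> x \<in> filt (i + j)"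
  by (auto simp: filt_def crd_simps pq_mult)

lemma filt_smult_right: "x \<in> filt j \<Longrightarrow> r \<odot> x \<in> filt j"
  using filt_smult[of r 0 x j] by simp

lemma filt_antimono: "x \<in> filt n \<Longrightarrow> m \<le> n \<Longrightarrow> x \<in> filt m"
  by (auto simp: filt_def pq_antimono)

lemma filt_zero: "\<zero> \<in> filt n"
  by (auto simp: filt_def crd_simps)

lemma minus_self: "x \<in> carrier M \<Longrightarrow> x \<ominus> x = \<zero>"
  by (simp add: Mod.minus_eq Mod.r_neg)

lemma filt_self: "x \<in> carrier M \<Longrightarrow> x \<ominus> x \<in> filt n"
  by (simp add: minus_self filt_zero)

lemma filt_trans:
  assumes "x \<ominus> y \<in> filt n" "y \<ominus> z \<in> filt n" "x \<in> carrier M" "y \<in> carrier M" "z \<in> carrier M"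
  shows "x \<ominus> z \<in> filt n"
proof -
  have "x \<ominus> z = (x \<ominus> y) \<oplus> (y \<ominus> z)" using assms(3-5) by (intro crd_eqI) (auto simp: crd_simps)
  thus ?thesis using filt_add[OF assms(1,2)] by simp
qed

lemma filt_sym:
  assumes "x \<ominus> y \<in> filt n" "x \<in> carrier M" "y \<in> carrier M"
  shows "y \<ominus> x \<in> filt n"
  using assms pq_uminus by (fastforce simp: filt_def crd_simps)

lemma filt_separated:
  assumes "\<And>n. x \<ominus> y \<in> filt n" "x \<in> carrier M" "y \<in> carrier M"
  shows "x = y"
proof (rule crd_eqI[OF assms(2,3)])
  fix b assume b: "b \<in> B"
  have "crd x b - crd y b \<in> I n" for n
    using filtD[OF assms(1) b, of n] assms b by (simp add: crd_simps)
  from pq_separated[OF this] show "crd x b = crd y b" by simp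
qed

lemma filt_complete:
  assumes x: "\<And>n. x n \<in> carrier M" and cauchy: "\<And>n. x (Suc n) \<ominus> x n \<in> filt n"
  obtains l where "l \<in> carrier M" "\<And>n. x n \<ominus> l \<in> filt n"
proof -
  have "\<forall>b\<in>B. \<exists>l. \<forall>n. crd (x n) b - l \<in> I n"
  proof
    fix b assume b: "b \<in> B"
    have "crd (x (Suc n)) b - crd (x n) b \<in> I n" for n
      using filtD[OF cauchy[of n] b] x b by (simp add: crd_simps)
    from pq_complete[OF this] show "\<exists>l. \<forall>n. crd (x n) b - l \<in> I n" .
  qed
  then obtain f where f: "\<And>b n. b \<in> B \<Longrightarrow> crd (x n) b - f b \<in> I n" by metis
  obtain l where l: "l \<in> carrier M" "\<And>b. b \<in> B \<Longrightarrow> crd l b = f b" using crd_surj[of f] by blast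
  show thesis
  proof (rule that[OF l(1)])
    show "x n \<ominus> l \<in> filt n" for n
      using x l f by (intro filtI) (auto simp: crd_simps)
  qed
qed

lemma smult_cancel:
  assumes "r \<noteq> 0" "r \<odot> x = r \<odot> y" "x \<in> carrier M" "y \<in> carrier M"
  shows "x = y"
proof (rule crd_eqI[OF assms(3,4)])
  fix b assume "b \<in> B"
  hence "r * crd x b = r * crd y b" using assms by (simp flip: crd_smult)
  thus "crd x b = crd y b" using assms(1) by simp
qed

lemma X_divisible_iff:
  assumes "x \<in> carrier M"
  shows "(\<exists>y\<in>carrier M. x = fps_X \<odot> y) \<longleftrightarrow> (\<forall>b\<in>B. fps_nth (crd x b) 0 = 0)"
proof
  assume "\<forall>b\<in>B. fps_nth (crd x b) 0 = 0"
  hence "crd x b = fps_X * fps_shift 1 (crd x b)" if "b \<in> B" for b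
    using that by (intro fps_ext) auto
  moreover obtain y where "y \<in> carrier M" "\<forall>b\<in>B. crd y b = fps_shift 1 (crd x b)"
    using crd_surj[of "\<lambda>b. fps_shift 1 (crd x b)"] by blast
  ultimately have "y \<in> carrier M" "x = fps_X \<odot> y"
    using assms by (auto intro!: crd_eqI simp: crd_simps)
  thus "\<exists>y\<in>carrier M. x = fps_X \<odot> y" by blast
qed (auto simp: crd_simps)

section \<open>The \<open>(p, q - 1)\<close>-adic topology of a free module\<close>

definition nbhd :: "'m \<Rightarrow> nat \<Rightarrow> 'm set" where
  "nbhd m n = {y \<in> carrier M. y \<ominus> m \<in> filt n}"

lemma coset_eq_nbhd:
  assumes "m \<in> carrier M"
  shows "{m \<oplus> x | x. x \<in> pq_filtration M n} = nbhd m n"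
proof (intro subset_antisym subsetI)
  fix y assume "y \<in> {m \<oplus> x | x. x \<in> pq_filtration M n}"
  then obtain x where x: "y = m \<oplus> x" "x \<in> filt n" by (auto simp: pq_filtration_eq)
  have "y \<ominus> m = x" using x filt_carrier assms by (intro crd_eqI) (auto simp: crd_simps)
  thus "y \<in> nbhd m n" using x filt_carrier assms by (auto simp: nbhd_def)
next
  fix y assume y: "y \<in> nbhd m n"
  hence "y = m \<oplus> (y \<ominus> m)" using assms by (intro crd_eqI) (auto simp: crd_simps nbhd_def)
  thus "y \<in> {m \<oplus> x | x. x \<in> pq_filtration M n}" using y by (auto simp: nbhd_def pq_filtration_eq)
qed

lemma pq_adic_topology_eq: "pq_adic_topology M = topology_generated_by {nbhd m n | m n. m \<in> carrier M}"
proof -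
  have "(A = {m \<oplus> x | x. x \<in> pq_filtration M n} \<and> m \<in> carrier M) = (A = nbhd m n \<and> m \<in> carrier M)"
    for A m n by (cases "m \<in> carrier M") (simp_all only: coset_eq_nbhd simp_thms)
  thus ?thesis by (simp only: pq_adic_topology_def)
qed

lemma openin_nbhd: "m \<in> carrier M \<Longrightarrow> openin (pq_adic_topology M) (nbhd m n)"
  unfolding pq_adic_topology_eq by (rule topology_generated_by_Basis) blast

lemma nbhd_self: "m \<in> carrier M \<Longrightarrow> m \<in> nbhd m n"
  by (simp add: nbhd_def filt_self)

lemma topspace_pq_adic: "topspace (pq_adic_topology M) = carrier M"
proof -
  have "nbhd m n \<subseteq> carrier M" for m n by (auto simp: nbhd_def)
  thus ?thesis unfolding pq_adic_topology_eq topology_generated_by_topspace using nbhd_self by blast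
qed

lemma continuous_map_pq_adicI:
  assumes "\<And>m n. m \<in> carrier M \<Longrightarrow> openin T1 {z \<in> topspace T1. f z \<in> nbhd m n}"
    and "\<And>z. z \<in> topspace T1 \<Longrightarrow> f z \<in> carrier M"
  shows "continuous_map T1 (pq_adic_topology M) f"
  unfolding pq_adic_topology_eq
proof (rule continuous_on_generated_topo)
  fix U assume "U \<in> {nbhd m n | m n. m \<in> carrier M}"
  then obtain m n where "m \<in> carrier M" "U = nbhd m n" by blast
  moreover have "f -` U \<inter> topspace T1 = {z \<in> topspace T1. f z \<in> U}" by blast
  ultimately show "openin T1 (f -` U \<inter> topspace T1)" using assms(1) by simp
next
  show "f ` topspace T1 \<subseteq> \<Union> {nbhd m n | m n. m \<in> carrier M}" using assms(2) nbhd_self by blast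
qed

end

lemma (in perfect_char) finite_free_coordinates:
  fixes M :: "('k witt fps, 'm) module"
  assumes "finite_free M"
  obtains B :: "'m set" and crd where "free_module M B crd"
proof -
  have mod: "Module.module R_ring M" using assms unfolding finite_free_def by (rule conjunct1)
  from assms obtain B where "finite B \<and> B \<subseteq> carrier M \<and>
      (\<forall>m\<in>carrier M. \<exists>!c. c \<in> B \<rightarrow>\<^sub>E UNIV \<and> m = (\<Oplus>\<^bsub>M\<^esub>b\<in>B. c b \<odot>\<^bsub>M\<^esub> b))"
    unfolding finite_free_def by (elim conjE exE) (rule that, intro conjI)
  hence B: "finite B" "B \<subseteq> carrier M"
    and ex1: "\<And>m. m \<in> carrier M \<Longrightarrow> \<exists>!c. c \<in> B \<rightarrow>\<^sub>E UNIV \<and> m = (\<Oplus>\<^bsub>M\<^esub>b\<in>B. c b \<odot>\<^bsub>M\<^esub> b)"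
    by simp_all
  interpret Mod: Module.module R_ring M by (rule mod)
  define comb where "comb c = (\<Oplus>\<^bsub>M\<^esub>b\<in>B. c b \<odot>\<^bsub>M\<^esub> b)" for c
  define crd where "crd m = (THE c. c \<in> B \<rightarrow>\<^sub>E UNIV \<and> m = comb c)" for m
  have crd: "crd m \<in> B \<rightarrow>\<^sub>E UNIV" "m = comb (crd m)" if "m \<in> carrier M" for m
    using theI'[OF ex1[OF that]] unfolding crd_def comb_def by auto
  have sm: "c b \<odot>\<^bsub>M\<^esub> b \<in> carrier M" if "b \<in> B" for b and c :: "'m \<Rightarrow> _"
    using that B by (intro Mod.smult_closed) auto
  have comb_closed: "comb c \<in> carrier M" for c
    unfolding comb_def using sm by (intro Mod.finsum_closed) auto
  have comb_cong: "comb c = comb d" if "\<And>b. b \<in> B \<Longrightarrow> c b = d b" for c d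
    unfolding comb_def using that sm by (intro Mod.finsum_cong') auto
  have unique: "c b = crd m b" if "m \<in> carrier M" "m = comb c" "b \<in> B" for c m b
  proof -
    have "restrict c B \<in> B \<rightarrow>\<^sub>E UNIV \<and> m = comb (restrict c B)"
      using that(2) comb_cong[of c "restrict c B"] by auto
    hence "restrict c B = crd m"
      using ex1[OF that(1)] crd[OF that(1)] unfolding comb_def by blast
    thus ?thesis using that(3) by (metis restrict_apply')
  qed
  have "free_module M B crd"
  proof (intro free_module.intro free_module_axioms.intro)
    show "perfect_char TYPE('k)" by (rule perfect_char_axioms)
  next
    show "Module.module R_ring M" by (rule mod)
  next
    fix x y b assume xy: "x \<in> carrier M" "y \<in> carrier M" and b: "b \<in> B"
    have "comb (\<lambda>b. crd x b + crd y b) = (\<Oplus>\<^bsub>M\<^esub>b\<in>B. crd x b \<odot>\<^bsub>M\<^esub> b \<oplus>\<^bsub>M\<^esub> crd y b \<odot>\<^bsub>M\<^esub> b)"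
      unfolding comb_def using sm B Mod.smult_l_distr by (intro Mod.finsum_cong') auto
    also have "\<dots> = comb (crd x) \<oplus>\<^bsub>M\<^esub> comb (crd y)"
      unfolding comb_def using sm by (intro Mod.finsum_addf) auto
    also have "\<dots> = x \<oplus>\<^bsub>M\<^esub> y" by (simp only: crd(2)[OF xy(1), symmetric] crd(2)[OF xy(2), symmetric])
    finally show "crd (x \<oplus>\<^bsub>M\<^esub> y) b = crd x b + crd y b"
      using unique[OF Mod.a_closed[OF xy] _ b, of "\<lambda>b. crd x b + crd y b"] by (simp only:)
  next
    fix x b r assume x: "x \<in> carrier M" and b: "b \<in> B"
    have "comb (\<lambda>b. r * crd x b) = (\<Oplus>\<^bsub>M\<^esub>b\<in>B. r \<odot>\<^bsub>M\<^esub> (crd x b \<odot>\<^bsub>M\<^esub> b))"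
      unfolding comb_def using sm B Mod.smult_assoc1 by (intro Mod.finsum_cong') auto
    also have "\<dots> = r \<odot>\<^bsub>M\<^esub> comb (crd x)"
      unfolding comb_def using sm B by (intro Mod.finsum_smult_ldistr[symmetric]) auto
    also have "\<dots> = r \<odot>\<^bsub>M\<^esub> x" by (simp only: crd(2)[OF x, symmetric])
    finally show "crd (r \<odot>\<^bsub>M\<^esub> x) b = r * crd x b"
      using unique[OF Mod.smult_closed[OF _ x] _ b, of r "\<lambda>b. r * crd x b"] by (simp only: R_ring_simps UNIV_I)
  next
    fix x y assume *: "x \<in> carrier M" "y \<in> carrier M" "\<And>b. b \<in> B \<Longrightarrow> crd x b = crd y b"
    have "x = comb (crd x)" by (rule crd(2)[OF *(1)])
    also have "\<dots> = comb (crd y)" by (rule comb_cong[OF *(3)])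
    also have "\<dots> = y" by (rule crd(2)[OF *(2), symmetric])
    finally show "x = y" .
  next
    fix f :: "'m \<Rightarrow> 'k witt fps"
    show "\<exists>x\<in>carrier M. \<forall>b\<in>B. crd x b = f b"
      using unique[OF comb_closed refl, of _ f] comb_closed by force
  qed
  thus thesis by (rule that)
qed

section \<open>From \<open>\<nabla>\<close>-modules to \<open>\<Gamma>\<close>-modules\<close>

locale nabla_free = free_module TYPE_k M B crd
  for TYPE_k :: "'k::field_prime_char itself"
    and M :: "('k witt fps, 'm) module" (structure)
    and B :: "'b set" and crd :: "'m \<Rightarrow> 'b \<Rightarrow> 'k witt fps" +
  fixes D :: "'m \<Rightarrow> 'm"
  assumes nabla: "is_nabla_module (M, D)"
begin

lemma D_closed [simp]: "x \<in> carrier M \<Longrightarrow> D x \<in> carrier M"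
  and D_add: "x \<in> carrier M \<Longrightarrow> y \<in> carrier M \<Longrightarrow> D (x \<oplus> y) = D x \<oplus> D y"
  and D_const: "x \<in> carrier M \<Longrightarrow> D (fps_const w \<odot> x) = fps_const w \<odot> D x"
  and D_qvar: "x \<in> carrier M \<Longrightarrow>
    D (qvar \<odot> x) = q_analog_p \<odot> x \<oplus> qvar ^ (CHAR('k) + 1) \<odot> D x"
  and D_extensional: "D \<in> extensional (carrier M)"
  using nabla unfolding is_nabla_module_def by (auto simp: PiE_iff)

definition gamma_M :: "'m \<Rightarrow> 'm" where
  "gamma_M x = x \<oplus> qq \<odot> D x"

lemma gamma_M_closed [simp]: "x \<in> carrier M \<Longrightarrow> gamma_M x \<in> carrier M"
  by (simp add: gamma_M_def)

lemma crd_gamma_M: "x \<in> carrier M \<Longrightarrow> b \<in> B \<Longrightarrow> crd (gamma_M x) b = crd x b + qq * crd (D x) b"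
  by (simp add: gamma_M_def crd_simps)

lemma gamma_M_add: "x \<in> carrier M \<Longrightarrow> y \<in> carrier M \<Longrightarrow> gamma_M (x \<oplus> y) = gamma_M x \<oplus> gamma_M y"
  by (rule crd_eqI) (auto simp: crd_gamma_M D_add crd_simps distrib_left)

lemma gamma_M_minus:
  assumes "x \<in> carrier M" "y \<in> carrier M"
  shows "gamma_M (x \<ominus> y) = gamma_M x \<ominus> gamma_M y"
proof -
  have "x = (x \<ominus> y) \<oplus> y" using assms by (intro crd_eqI) (auto simp: crd_simps)
  hence "gamma_M x = gamma_M (x \<ominus> y) \<oplus> gamma_M y" using assms gamma_M_add[of "x \<ominus> y" y] by simp
  thus ?thesis using assms by (intro crd_eqI) (auto simp: crd_simps)
qed

lemma gamma_M_const: "x \<in> carrier M \<Longrightarrow> gamma_M (fps_const w \<odot> x) = fps_const w \<odot> gamma_M x"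
  by (rule crd_eqI) (auto simp: crd_gamma_M D_const crd_simps distrib_left mult.left_commute)

lemma gamma_M_of_nat: "x \<in> carrier M \<Longrightarrow> gamma_M (of_nat n \<odot> x) = of_nat n \<odot> gamma_M x"
  using gamma_M_const[of x "of_nat n"] by (simp add: fps_of_nat)

lemma gamma_M_qvar:
  assumes "x \<in> carrier M"
  shows "gamma_M (qvar \<odot> x) = qvar ^ (CHAR('k) + 1) \<odot> gamma_M x"
proof (rule crd_eqI)
  \<comment> \<open>Here \<open>k\<close> stands for \<open>q\<^sup>2 - q\<close>, \<open>a\<close>
    for the q-analogue of \<open>p\<close>, and \<open>Q\<close> for
    \<open>q ^ (p + 1)\<close>.\<close>
  have *: "q * c + k * (a * c + Q * d) = Q * (c + k * d)" if "k * a = Q - q"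
    for q c k a Q d :: "'k witt fps"
  proof -
    have "q * c + k * (a * c + Q * d) = q * c + (k * a) * c + Q * (k * d)"
      by (simp add: algebra_simps)
    thus ?thesis unfolding that by (simp add: algebra_simps)
  qed
  fix b assume "b \<in> B"
  thus "crd (gamma_M (qvar \<odot> x)) b = crd (qvar ^ (CHAR('k) + 1) \<odot> gamma_M x) b"
    using assms *[OF qq_q_analog, of "crd x b" "crd (D x) b"]
    by (simp only: crd_gamma_M D_qvar crd_simps smult_closed gamma_M_closed D_closed)
qed (use assms in auto)

lemma gamma_M_X:
  assumes "x \<in> carrier M"
  shows "gamma_M (fps_X \<odot> x) = gamma_R fps_X \<odot> gamma_M x"
proof -
  have "fps_X \<odot> x = qvar \<odot> x \<ominus> x"
    using assms by (intro crd_eqI) (auto simp: crd_simps qvar_minus_1[symmetric] left_diff_distrib)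
  hence "gamma_M (fps_X \<odot> x) = qvar ^ (CHAR('k) + 1) \<odot> gamma_M x \<ominus> gamma_M x"
    using assms by (simp only: gamma_M_minus gamma_M_qvar smult_closed)
  thus ?thesis using assms by (intro crd_eqI) (auto simp: crd_simps gamma_R_X left_diff_distrib)
qed

lemma smult_smult: "x \<in> carrier M \<Longrightarrow> r \<odot> (s \<odot> x) = (r * s) \<odot> x"
  by (rule crd_eqI) (auto simp: crd_simps mult.assoc)

lemma gamma_M_smult_mod_X_power:
  assumes "x \<in> carrier M"
  shows "\<exists>y\<in>carrier M. gamma_M (r \<odot> x) \<ominus> gamma_R r \<odot> gamma_M x = fps_X ^ n \<odot> y"
proof (induction n arbitrary: r)
  case 0
  have "gamma_M (r \<odot> x) \<ominus> gamma_R r \<odot> gamma_M x \<in> carrier M" using assms by simp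
  moreover have "fps_X ^ 0 \<odot> y = y" if "y \<in> carrier M" for y
    using that by (intro crd_eqI) (auto simp: crd_simps)
  ultimately show ?case by (intro bexI[of _ "gamma_M (r \<odot> x) \<ominus> gamma_R r \<odot> gamma_M x"]) auto
next
  case (Suc n)
  define c s where "c = fps_const (fps_nth r 0)" and "s = fps_shift 1 r"
  have "fps_nth r i = fps_nth (c + fps_X * s) i" for i by (cases i) (auto simp: c_def s_def)
  hence r: "r = c + fps_X * s" by (rule fps_ext)
  from Suc[of s] obtain y where y: "y \<in> carrier M" "gamma_M (s \<odot> x) \<ominus> gamma_R s \<odot> gamma_M x = fps_X ^ n \<odot> y" by blast
  have "r \<odot> x = c \<odot> x \<oplus> fps_X \<odot> (s \<odot> x)"
    by (subst r) (use assms in \<open>intro crd_eqI; simp add: crd_simps distrib_right mult.assoc\<close>)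
  hence "gamma_M (r \<odot> x) = c \<odot> gamma_M x \<oplus> gamma_R fps_X \<odot> gamma_M (s \<odot> x)"
    using assms by (simp add: gamma_M_add gamma_M_X c_def gamma_M_const)
  moreover have "gamma_R r = c + gamma_R fps_X * gamma_R s"
    by (subst r) (simp add: gamma_R_add gamma_R_mult c_def gamma_R_const)
  ultimately have "gamma_M (r \<odot> x) \<ominus> gamma_R r \<odot> gamma_M x = gamma_R fps_X \<odot> (gamma_M (s \<odot> x) \<ominus> gamma_R s \<odot> gamma_M x)"
    using assms by (intro crd_eqI) (auto simp: crd_simps algebra_simps)
  also have "\<dots> = (gamma_R fps_X * fps_X ^ n) \<odot> y"
    unfolding y(2) by (rule smult_smult[OF y(1)])
  also have "gamma_R fps_X * fps_X ^ n = fps_X ^ Suc n * q_analog_Suc_p"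
    unfolding gamma_R_X_eq power_Suc by (simp only: mult.assoc mult.commute[of q_analog_Suc_p])
  also have "(fps_X ^ Suc n * q_analog_Suc_p) \<odot> y = fps_X ^ Suc n \<odot> (q_analog_Suc_p \<odot> y)"
    by (rule smult_smult[OF y(1), symmetric])
  finally show ?case by (rule bexI) (use y(1) in simp)
qed

lemma gamma_M_smult:
  assumes "x \<in> carrier M"
  shows "gamma_M (r \<odot> x) = gamma_R r \<odot> gamma_M x"
proof (rule crd_eqI)
  fix b assume b: "b \<in> B"
  show "crd (gamma_M (r \<odot> x)) b = crd (gamma_R r \<odot> gamma_M x) b"
  proof (rule fps_ext)
    fix i
    obtain y where y: "y \<in> carrier M" "gamma_M (r \<odot> x) \<ominus> gamma_R r \<odot> gamma_M x = fps_X ^ Suc i \<odot> y"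
      using gamma_M_smult_mod_X_power[OF assms] by blast
    have "crd (gamma_M (r \<odot> x)) b - crd (gamma_R r \<odot> gamma_M x) b = fps_X ^ Suc i * crd y b"
      using arg_cong[OF y(2), of "\<lambda>x. crd x b"] y(1) assms b
      by (simp only: crd_simps smult_closed gamma_M_closed)
    hence "fps_nth (crd (gamma_M (r \<odot> x)) b - crd (gamma_R r \<odot> gamma_M x) b) i = 0"
      by (simp only: fps_X_power_mult_nth) simp
    thus "fps_nth (crd (gamma_M (r \<odot> x)) b) i = fps_nth (crd (gamma_R r \<odot> gamma_M x) b) i" by simp
  qed
qed (use assms in auto)

section \<open>Filtration estimates for powers of \<gamma>\<close>

lemma gamma_M_minus_id_filt: "x \<in> filt j \<Longrightarrow> gamma_M x \<ominus> x \<in> filt (Suc j)"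
proof (induction j arbitrary: x)
  case 0
  hence x: "x \<in> carrier M" by (rule filt_carrier)
  have "gamma_M x \<ominus> x = qq \<odot> D x"
    using x by (intro crd_eqI) (auto simp: crd_gamma_M crd_simps)
  thus ?case using filt_smult[OF qq_in_pq filt_0[OF D_closed[OF x]]] by simp
next
  case (Suc j)
  then obtain a b where x: "x = of_nat CHAR('k) \<odot> a \<oplus> fps_X \<odot> b" "a \<in> filt j" "b \<in> filt j"
    unfolding pq_filtration_eq[symmetric] pq_filtration.simps qvar_minus_1 by blast
  have ab: "a \<in> carrier M" "b \<in> carrier M" using x filt_carrier by auto
  have "gamma_M x = of_nat CHAR('k) \<odot> gamma_M a \<oplus> (fps_X * q_analog_Suc_p) \<odot> gamma_M b"
    using ab by (simp add: x(1) gamma_M_add gamma_M_of_nat gamma_M_X gamma_R_X_eq)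
  \<comment> \<open>A twisted Leibniz expansion: the first two terms gain a step by induction, the
    last because \<open>q_analog_Suc_p - 1\<close> lies in \<open>I 1\<close>.\<close>
  hence "gamma_M x \<ominus> x = of_nat CHAR('k) \<odot> (gamma_M a \<ominus> a) \<oplus> (fps_X \<odot> (q_analog_Suc_p \<odot> (gamma_M b \<ominus> b)) \<oplus> fps_X \<odot> ((q_analog_Suc_p - 1) \<odot> b))"
    using ab x(1) by (intro crd_eqI) (auto simp: crd_simps algebra_simps)
  moreover have "of_nat CHAR('k) \<odot> (gamma_M a \<ominus> a) \<in> filt (1 + Suc j)"
    by (rule filt_smult[OF p_in_pq Suc.IH[OF x(2)]])
  moreover have "fps_X \<odot> (q_analog_Suc_p \<odot> (gamma_M b \<ominus> b)) \<in> filt (1 + Suc j)"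
    by (rule filt_smult[OF X_in_pq filt_smult_right[OF Suc.IH[OF x(3)]]])
  moreover have "fps_X \<odot> ((q_analog_Suc_p - 1) \<odot> b) \<in> filt (1 + (1 + j))"
    by (rule filt_smult[OF X_in_pq filt_smult[OF q_analog_Suc_p_minus_1 x(3)]])
  ultimately show ?case using filt_add by simp
qed

lemma gamma_M_funpow_closed [simp]: "x \<in> carrier M \<Longrightarrow> (gamma_M ^^ m) x \<in> carrier M"
  by (induction m) auto

lemma gamma_M_funpow_add: "x \<in> carrier M \<Longrightarrow> y \<in> carrier M \<Longrightarrow> (gamma_M ^^ m) (x \<oplus> y) = (gamma_M ^^ m) x \<oplus> (gamma_M ^^ m) y"
  by (induction m) (auto simp: gamma_M_add)

lemma gamma_M_funpow_minus: "x \<in> carrier M \<Longrightarrow> y \<in> carrier M \<Longrightarrow> (gamma_M ^^ m) (x \<ominus> y) = (gamma_M ^^ m) x \<ominus> (gamma_M ^^ m) y"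
  by (induction m) (auto simp: gamma_M_minus)

lemma gamma_M_funpow_smult: "x \<in> carrier M \<Longrightarrow> (gamma_M ^^ m) (r \<odot> x) = (gamma_R ^^ m) r \<odot> (gamma_M ^^ m) x"
  by (induction m) (auto simp: gamma_M_smult)

lemma gamma_R_of_nat: "(gamma_R ^^ m) (of_nat n) = of_nat n"
  by (induction m) (auto simp: gamma_R_const simp flip: fps_of_nat)

lemma gamma_M_funpow_minus_id: "x \<in> filt j \<Longrightarrow> (gamma_M ^^ m) x \<ominus> x \<in> filt (Suc j)"
proof (induction m)
  case 0
  thus ?case by (simp add: filt_self filt_carrier)
next
  case (Suc m)
  note x = filt_carrier[OF Suc.prems]
  have "(gamma_M ^^ m) x \<in> filt j"
  proof -
    have "(gamma_M ^^ m) x = ((gamma_M ^^ m) x \<ominus> x) \<oplus> x" using x by (intro crd_eqI) (auto simp: crd_simps)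
    moreover have "((gamma_M ^^ m) x \<ominus> x) \<oplus> x \<in> filt j"
      by (rule filt_add[OF filt_antimono[OF Suc.IH[OF Suc.prems]] Suc.prems]) simp
    ultimately show ?thesis by (rule ssubst)
  qed
  from gamma_M_minus_id_filt[OF this] have "gamma_M ((gamma_M ^^ m) x) \<ominus> (gamma_M ^^ m) x \<in> filt (Suc j)" .
  thus ?case using filt_trans[OF _ Suc.IH[OF Suc.prems]] x by simp
qed

lemma gamma_M_funpow_filt:
  assumes "x \<in> filt j"
  shows "(gamma_M ^^ m) x \<in> filt j"
proof -
  note x = filt_carrier[OF assms]
  have "(gamma_M ^^ m) x = ((gamma_M ^^ m) x \<ominus> x) \<oplus> x" using x by (intro crd_eqI) (auto simp: crd_simps)
  moreover have "((gamma_M ^^ m) x \<ominus> x) \<oplus> x \<in> filt j"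
    by (rule filt_add[OF filt_antimono[OF gamma_M_funpow_minus_id[OF assms]] assms]) simp
  ultimately show ?thesis by (rule ssubst)
qed

text \<open>If \<open>U = 1 + N\<close> with \<open>N\<close> raising the filtration by \<open>k + 1\<close>, then \<open>U ^ i = 1 + i N\<close> up to terms
  raising it by \<open>2 k + 2\<close>, so that \<open>U ^ p - 1\<close> raises it by \<open>k + 2\<close>.\<close>

lemma gamma_M_p_power:
  assumes "x \<in> filt j"
  shows "(gamma_M ^^ (CHAR('k) ^ k)) x \<ominus> x \<in> filt (Suc (j + k))"
  using assms
proof (induction k arbitrary: j x)
  case 0
  thus ?case using gamma_M_minus_id_filt by simp
next
  case (Suc k)
  note x = filt_carrier[OF Suc.prems]
  define e where "e = CHAR('k) ^ k"
  define U where "U = gamma_M ^^ e"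
  define d where "d = U x \<ominus> x"
  have Uc [simp]: "U y \<in> carrier M" if "y \<in> carrier M" for y using that by (simp add: U_def)
  have Ui [simp]: "(U ^^ i) y \<in> carrier M" if "y \<in> carrier M" for y i using that by (induction i) auto
  have d: "d \<in> filt (Suc (j + k))" unfolding d_def U_def e_def by (rule Suc.IH[OF Suc.prems])
  hence dc [simp]: "d \<in> carrier M" by (rule filt_carrier)
  \<comment> \<open>As \<open>d\<close> already lies in step \<open>j + k + 1\<close>, the crude
    gain of one step for \<open>U\<close> is enough.\<close>
  have dd: "U d \<ominus> d \<in> filt (Suc (Suc (j + k)))"
    unfolding U_def by (rule gamma_M_funpow_minus_id[OF d])
  have main: "(U ^^ i) x \<ominus> (x \<oplus> of_nat i \<odot> d) \<in> filt (Suc (Suc (j + k)))" for i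
  proof (induction i)
    case 0
    have "(U ^^ 0) x \<ominus> (x \<oplus> of_nat 0 \<odot> d) = \<zero>" using x by (intro crd_eqI) (auto simp: crd_simps)
    thus ?case by (simp only: filt_zero)
  next
    case (Suc i)
    have "U ((U ^^ i) x \<ominus> (x \<oplus> of_nat i \<odot> d)) = (U ^^ Suc i) x \<ominus> (U x \<oplus> of_nat i \<odot> U d)"
      using x by (simp add: U_def gamma_M_funpow_minus gamma_M_funpow_add gamma_M_funpow_smult gamma_R_of_nat Ui[unfolded U_def])
    moreover have "U ((U ^^ i) x \<ominus> (x \<oplus> of_nat i \<odot> d)) \<in> filt (Suc (Suc (j + k)))"
      unfolding U_def by (rule gamma_M_funpow_filt[OF Suc[unfolded U_def]])
    ultimately have 1: "(U ^^ Suc i) x \<ominus> (U x \<oplus> of_nat i \<odot> U d) \<in> filt (Suc (Suc (j + k)))" by simp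
    have "(U x \<oplus> of_nat i \<odot> U d) \<ominus> (x \<oplus> of_nat (Suc i) \<odot> d) = of_nat i \<odot> (U d \<ominus> d)"
      using x by (intro crd_eqI) (auto simp: crd_simps algebra_simps d_def)
    hence 2: "(U x \<oplus> of_nat i \<odot> U d) \<ominus> (x \<oplus> of_nat (Suc i) \<odot> d) \<in> filt (Suc (Suc (j + k)))"
      using filt_smult_right[OF dd] by simp
    show ?case by (rule filt_trans[OF 1 2]) (use x in simp_all)
  qed
  have pd: "of_nat CHAR('k) \<odot> d \<in> filt (Suc (Suc (j + k)))"
    using filt_smult[OF p_in_pq d] by simp
  have "(U ^^ CHAR('k)) x \<ominus> x = ((U ^^ CHAR('k)) x \<ominus> (x \<oplus> of_nat CHAR('k) \<odot> d)) \<oplus> of_nat CHAR('k) \<odot> d"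
    using x by (intro crd_eqI) (auto simp: crd_simps)
  hence "(U ^^ CHAR('k)) x \<ominus> x \<in> filt (Suc (Suc (j + k)))" using filt_add[OF main pd] by simp
  moreover have "U ^^ CHAR('k) = gamma_M ^^ (CHAR('k) ^ Suc k)"
    by (simp only: U_def e_def funpow_mult power_Suc mult.commute)
  ultimately show ?case by simp
qed

lemma gamma_M_funpow_multiple:
  assumes "x \<in> carrier M"
  shows "(gamma_M ^^ (CHAR('k) ^ k * e)) x \<ominus> x \<in> filt k"
proof (induction e)
  case 0
  show ?case using assms by (simp add: filt_self)
next
  case (Suc e)
  let ?y = "(gamma_M ^^ (CHAR('k) ^ k * e)) x"
  have "(gamma_M ^^ (CHAR('k) ^ k)) ?y \<ominus> ?y \<in> filt (Suc (0 + k))"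
    using assms by (intro gamma_M_p_power filt_0) simp
  hence "(gamma_M ^^ (CHAR('k) ^ k)) ?y \<ominus> ?y \<in> filt k" by (rule filt_antimono) simp
  hence "(gamma_M ^^ (CHAR('k) ^ k)) ?y \<ominus> x \<in> filt k" by (rule filt_trans[OF _ Suc]) (use assms in simp_all)
  thus ?case by (simp add: funpow_add)
qed

lemma gamma_M_funpow_cong:
  assumes "x \<in> carrier M" "[m = m'] (mod CHAR('k) ^ n)"
  shows "(gamma_M ^^ m) x \<ominus> (gamma_M ^^ m') x \<in> filt n"
proof -
  have *: "(gamma_M ^^ m) x \<ominus> (gamma_M ^^ (m mod CHAR('k) ^ n)) x \<in> filt n" for m
  proof -
    let ?y = "(gamma_M ^^ (m mod CHAR('k) ^ n)) x"
    have "(gamma_M ^^ (CHAR('k) ^ n * (m div CHAR('k) ^ n))) ?y \<ominus> ?y \<in> filt n"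
      using assms(1) by (intro gamma_M_funpow_multiple) simp
    moreover have "(gamma_M ^^ (CHAR('k) ^ n * (m div CHAR('k) ^ n))) ?y = (gamma_M ^^ m) x"
      using funpow_add[of "CHAR('k) ^ n * (m div CHAR('k) ^ n)" "m mod CHAR('k) ^ n" gamma_M] by simp
    ultimately show ?thesis by simp
  qed
  have "m mod CHAR('k) ^ n = m' mod CHAR('k) ^ n" using assms(2) by (simp add: cong_def)
  hence "(gamma_M ^^ (m mod CHAR('k) ^ n)) x \<ominus> (gamma_M ^^ m') x \<in> filt n"
    using filt_sym[OF *[of m']] assms(1) by simp
  from filt_trans[OF *[of m] this] show ?thesis using assms(1) by simp
qed

section \<open>The action as a limit of powers of \<gamma>\<close>

lemma limit_exists:
  assumes g: "g \<in> carrier Gamma_group" and x: "x \<in> carrier M"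
  shows "\<exists>l\<in>carrier M. \<forall>n m. approx g n m \<longrightarrow> (gamma_M ^^ m) x \<ominus> l \<in> filt n"
proof -
  have gG: "g \<in> carrier G" using g carrier_Gamma_subset by blast
  obtain a where a: "\<And>n. approx g n (a n)" using Gamma_approx[OF g] by metis
  have "(gamma_M ^^ a (Suc n)) x \<ominus> (gamma_M ^^ a n) x \<in> filt n" for n
    by (rule gamma_M_funpow_cong[OF x approx_unique[OF approx_le[OF gG a] a]]) simp
  then obtain l where l: "l \<in> carrier M" "\<And>n. (gamma_M ^^ a n) x \<ominus> l \<in> filt n"
    using filt_complete[of "\<lambda>n. (gamma_M ^^ a n) x"] x by auto
  \<comment> \<open>The estimate holds for every approximating exponent, not just the chosen
    \<open>a n\<close>, since any two are congruent modulo \<open>p ^ n\<close>.\<close>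
  have "(gamma_M ^^ m) x \<ominus> l \<in> filt n" if "approx g n m" for n m
    by (rule filt_trans[OF gamma_M_funpow_cong[OF x approx_unique[OF that a]] l(2)]) (use x l in simp_all)
  thus ?thesis using l(1) by blast
qed

definition rho :: "('k frac_closure \<Rightarrow> 'k frac_closure) \<Rightarrow> 'm \<Rightarrow> 'm" where
  "rho = (\<lambda>g\<in>carrier Gamma_group. \<lambda>x\<in>carrier M.
     SOME l. l \<in> carrier M \<and> (\<forall>n m. approx g n m \<longrightarrow> (gamma_M ^^ m) x \<ominus> l \<in> filt n))"

lemma rho_spec:
  assumes "g \<in> carrier Gamma_group" "x \<in> carrier M"
  shows "rho g x \<in> carrier M" "approx g n m \<Longrightarrow> (gamma_M ^^ m) x \<ominus> rho g x \<in> filt n"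
proof -
  have "\<exists>l. l \<in> carrier M \<and> (\<forall>n m. approx g n m \<longrightarrow> (gamma_M ^^ m) x \<ominus> l \<in> filt n)"
    using limit_exists[OF assms] by blast
  from someI_ex[OF this] have "rho g x \<in> carrier M \<and> (\<forall>n m. approx g n m \<longrightarrow> (gamma_M ^^ m) x \<ominus> rho g x \<in> filt n)"
    using assms by (simp add: rho_def)
  thus "rho g x \<in> carrier M" "approx g n m \<Longrightarrow> (gamma_M ^^ m) x \<ominus> rho g x \<in> filt n" by auto
qed

text \<open>A candidate value has to be tested against only one approximating exponent per level.
  This is how the algebraic laws of \<open>rho\<close> are inherited from powers of
  \<open>gamma_M\<close>.\<close>

lemma rho_eqI:
  assumes "g \<in> carrier Gamma_group" "x \<in> carrier M" "y \<in> carrier M"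
    and "\<And>n. \<exists>m. approx g n m \<and> (gamma_M ^^ m) x \<ominus> y \<in> filt n"
  shows "rho g x = y"
proof (rule filt_separated[OF _ rho_spec(1)[OF assms(1,2)] assms(3)])
  fix n
  obtain m where m: "approx g n m" "(gamma_M ^^ m) x \<ominus> y \<in> filt n" using assms(4) by blast
  show "rho g x \<ominus> y \<in> filt n"
    using filt_trans[OF filt_sym[OF rho_spec(2)[OF assms(1,2) m(1)]] m(2)] assms rho_spec(1) by simp
qed

lemma rho_gamma: "x \<in> carrier M \<Longrightarrow> rho \<gamma> x = gamma_M x"
  using approx_gamma by (intro rho_eqI gamma_in_Gamma exI[of _ 1] conjI) (simp_all add: filt_self)

lemma rho_one: "x \<in> carrier M \<Longrightarrow> rho (\<lambda>x\<in>Kinf. x) x = x"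
  using approx_gamma_pow[of 0] gamma_pow_in_Gamma[of 0]
  by (intro rho_eqI exI[of _ 0] conjI) (simp_all add: filt_self)

lemma rho_compose:
  assumes g: "g \<in> carrier Gamma_group" and h: "h \<in> carrier Gamma_group" and x: "x \<in> carrier M"
  shows "rho (compose Kinf g h) x = rho g (rho h x)"
proof (rule rho_eqI[OF compose_in_Gamma[OF g h] x])
  note hx = rho_spec(1)[OF h x]
  show "rho g (rho h x) \<in> carrier M" by (rule rho_spec(1)[OF g hx])
  fix n
  obtain m m' where m: "approx g n m" "approx h n m'" using Gamma_approx g h by metis
  have gG: "g \<in> carrier G" using g carrier_Gamma_subset by blast
  have "(gamma_M ^^ m) ((gamma_M ^^ m') x \<ominus> rho h x) \<in> filt n"
    by (rule gamma_M_funpow_filt[OF rho_spec(2)[OF h x m(2)]])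
  hence "(gamma_M ^^ (m + m')) x \<ominus> (gamma_M ^^ m) (rho h x) \<in> filt n"
    using x hx by (simp add: gamma_M_funpow_minus funpow_add)
  hence "(gamma_M ^^ (m + m')) x \<ominus> rho g (rho h x) \<in> filt n"
    by (rule filt_trans[OF _ rho_spec(2)[OF g hx m(1)]]) (use x hx rho_spec(1)[OF g hx] in simp_all)
  thus "\<exists>m. approx (compose Kinf g h) n m \<and> (gamma_M ^^ m) x \<ominus> rho g (rho h x) \<in> filt n"
    using approx_compose[OF gG m] by blast
qed

lemma rho_add:
  assumes g: "g \<in> carrier Gamma_group" and x: "x \<in> carrier M" and y: "y \<in> carrier M"
  shows "rho g (x \<oplus> y) = rho g x \<oplus> rho g y"
proof (rule rho_eqI[OF g])
  note c = rho_spec(1)[OF g x] rho_spec(1)[OF g y]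
  show "x \<oplus> y \<in> carrier M" "rho g x \<oplus> rho g y \<in> carrier M" using x y c by auto
  fix n
  obtain m where m: "approx g n m" using Gamma_approx[OF g] by blast
  have "(gamma_M ^^ m) (x \<oplus> y) \<ominus> (rho g x \<oplus> rho g y) = ((gamma_M ^^ m) x \<ominus> rho g x) \<oplus> ((gamma_M ^^ m) y \<ominus> rho g y)"
    using x y c by (intro crd_eqI) (auto simp: gamma_M_funpow_add crd_simps)
  hence "(gamma_M ^^ m) (x \<oplus> y) \<ominus> (rho g x \<oplus> rho g y) \<in> filt n"
    using filt_add[OF rho_spec(2)[OF g x m] rho_spec(2)[OF g y m]] by simp
  thus "\<exists>m. approx g n m \<and> (gamma_M ^^ m) (x \<oplus> y) \<ominus> (rho g x \<oplus> rho g y) \<in> filt n" using m by blast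
qed

lemma rho_smult:
  assumes g: "g \<in> carrier Gamma_group" and x: "x \<in> carrier M"
  shows "rho g (r \<odot> x) = Gamma_act g r \<odot> rho g x"
proof (rule rho_eqI[OF g])
  note c = rho_spec(1)[OF g x]
  show "r \<odot> x \<in> carrier M" "Gamma_act g r \<odot> rho g x \<in> carrier M" using x c by auto
  fix n
  obtain m where m: "approx g n m" using Gamma_approx[OF g] by blast
  have gG: "g \<in> carrier G" using g carrier_Gamma_subset by blast
  have "(gamma_M ^^ m) (r \<odot> x) \<ominus> Gamma_act g r \<odot> rho g x
      = ((gamma_R ^^ m) r - Gamma_act g r) \<odot> (gamma_M ^^ m) x \<oplus> Gamma_act g r \<odot> ((gamma_M ^^ m) x \<ominus> rho g x)"
    using x c by (intro crd_eqI) (auto simp: gamma_M_funpow_smult crd_simps algebra_simps)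
  moreover have "((gamma_R ^^ m) r - Gamma_act g r) \<odot> (gamma_M ^^ m) x \<in> filt (n + 0)"
    using x by (intro filt_smult Gamma_act_approx gG m filt_0) simp
  moreover have "Gamma_act g r \<odot> ((gamma_M ^^ m) x \<ominus> rho g x) \<in> filt n"
    by (rule filt_smult_right[OF rho_spec(2)[OF g x m]])
  ultimately have "(gamma_M ^^ m) (r \<odot> x) \<ominus> Gamma_act g r \<odot> rho g x \<in> filt n" using filt_add by simp
  thus "\<exists>m. approx g n m \<and> (gamma_M ^^ m) (r \<odot> x) \<ominus> Gamma_act g r \<odot> rho g x \<in> filt n" using m by blast
qed

lemma rho_filt:
  assumes g: "g \<in> carrier Gamma_group" and x: "x \<in> filt n"
  shows "rho g x \<in> filt n"
proof -
  note xc = filt_carrier[OF x]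
  obtain m where m: "approx g n m" using Gamma_approx[OF g] by blast
  have "rho g x = (gamma_M ^^ m) x \<ominus> ((gamma_M ^^ m) x \<ominus> rho g x)"
    using xc rho_spec(1)[OF g xc] by (intro crd_eqI) (auto simp: crd_simps)
  moreover have "(gamma_M ^^ m) x \<ominus> ((gamma_M ^^ m) x \<ominus> rho g x) \<in> filt n"
    by (rule filt_minus[OF gamma_M_funpow_filt[OF x] rho_spec(2)[OF g xc m]])
  ultimately show ?thesis by (rule ssubst)
qed

lemma rho_continuous:
  "continuous_map (prod_topology Gamma_topology (pq_adic_topology M)) (pq_adic_topology M)
     (\<lambda>(g, x). rho g x)"
proof (rule continuous_map_pq_adicI)
  let ?P = "prod_topology (Gamma_topology :: ('k frac_closure \<Rightarrow> 'k frac_closure) topology) (pq_adic_topology M)"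
  have top: "topspace ?P = carrier Gamma_group \<times> carrier M"
    by (simp only: topspace_prod_topology topspace_Gamma topspace_pq_adic)
  show "(case z of (g, x) \<Rightarrow> rho g x) \<in> carrier M" if "z \<in> topspace ?P" for z
    using that rho_spec(1) unfolding top by auto
  fix m n assume m: "m \<in> carrier M"
  define V where "V = {z \<in> topspace ?P. (case z of (g, x) \<Rightarrow> rho g x) \<in> nbhd m n}"
  have "\<exists>T. openin ?P T \<and> z \<in> T \<and> T \<subseteq> V" if "z \<in> V" for z
  proof -
    obtain g x where z: "z = (g, x)" by (cases z)
    from that have g: "g \<in> carrier Gamma_group" and x: "x \<in> carrier M" and gx: "rho g x \<in> nbhd m n"
      by (auto simp: V_def z topspace_Gamma topspace_pq_adic)
    obtain a where a: "approx g n a" using Gamma_approx[OF g] by blast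
    \<comment> \<open>The same \<open>n\<close> works in both factors: automorphisms sharing an
      exponent at level \<open>n\<close> agree modulo \<open>filt n\<close>, and every
      \<open>rho h\<close> preserves \<open>filt n\<close>.\<close>
    define T where "T = {h \<in> carrier Gamma_group. approx h n a} \<times> nbhd x n"
    have "openin ?P T"
      unfolding T_def openin_prod_Times_iff using openin_Gamma_approx openin_nbhd[OF x] by blast
    moreover have "z \<in> T" using g a nbhd_self[OF x] by (simp add: z T_def)
    moreover have "T \<subseteq> V"
    proof
      fix w assume "w \<in> T"
      then obtain h y where w: "w = (h, y)" "h \<in> carrier Gamma_group" "approx h n a"
        "y \<in> carrier M" "y \<ominus> x \<in> filt n" by (auto simp: T_def nbhd_def)
      note hy = rho_spec(1)[OF w(2,4)] and hx = rho_spec(1)[OF w(2) x] and gxc = rho_spec(1)[OF g x]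
      have "y = x \<oplus> (y \<ominus> x)" using w(4) x by (intro crd_eqI) (auto simp: crd_simps)
      hence "rho h y = rho h x \<oplus> rho h (y \<ominus> x)" using rho_add[OF w(2) x, of "y \<ominus> x"] w(4) x by simp
      hence "rho h y \<ominus> rho h x = rho h (y \<ominus> x)"
        using hx filt_carrier[OF rho_filt[OF w(2,5)]] by (intro crd_eqI) (auto simp: crd_simps)
      hence 1: "rho h y \<ominus> rho h x \<in> filt n" using rho_filt[OF w(2,5)] by simp
      have 2: "rho h x \<ominus> rho g x \<in> filt n"
        using filt_trans[OF filt_sym[OF rho_spec(2)[OF w(2) x w(3)]] rho_spec(2)[OF g x a]] x hx gxc by simp
      have 3: "rho g x \<ominus> m \<in> filt n" using gx by (simp add: nbhd_def)
      have "rho h y \<ominus> m \<in> filt n"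
        using filt_trans[OF filt_trans[OF 1 2] 3] hy hx gxc m by simp
      thus "w \<in> V" using w hy by (auto simp: V_def nbhd_def topspace_Gamma topspace_pq_adic)
    qed
    ultimately show ?thesis by blast
  qed
  thus "openin ?P V" by (subst openin_subopen) blast
qed

lemma is_gamma_module_rho: "is_gamma_module (M, rho)"
  unfolding is_gamma_module_def case_prod_conv mult_Gamma one_Gamma
proof (intro conjI ballI allI)
  show "rho \<in> carrier Gamma_group \<rightarrow>\<^sub>E (carrier M \<rightarrow>\<^sub>E carrier M)"
  proof (intro PiE_I)
    show "rho g x \<in> carrier M" if "g \<in> carrier Gamma_group" "x \<in> carrier M" for g x
      by (rule rho_spec(1)[OF that])
  qed (auto simp: rho_def)
qed (simp_all only: module_M rho_one rho_compose rho_add rho_smult rho_continuous)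

lemma trivial_rho: "trivial_mod_q_minus_1 (M, rho)"
  unfolding trivial_mod_q_minus_1_def case_prod_conv qvar_minus_1
proof (intro ballI)
  fix g :: "'k frac_closure \<Rightarrow> 'k frac_closure" and x
  assume g: "g \<in> carrier Gamma_group" and x: "x \<in> carrier M"
  note gx = rho_spec(1)[OF g x]
  \<comment> \<open>Since \<open>q\<^sup>2 - q\<close> is a multiple of \<open>q - 1\<close>,
    constant terms of coordinates are unchanged by \<open>gamma_M\<close>; p-adic separatedness
    carries this to the limit.\<close>
  have pow: "fps_nth (crd ((gamma_M ^^ m) x) b) 0 = fps_nth (crd x b) 0" if "b \<in> B" for m b
    using that x by (induction m) (auto simp: crd_gamma_M qq_eq)
  have "fps_nth (crd (rho g x \<ominus> x) b) 0 = 0" if b: "b \<in> B" for b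
  proof (rule witt_separated)
    fix n
    obtain m where m: "approx g (Suc n) m" using Gamma_approx[OF g] by blast
    have "crd ((gamma_M ^^ m) x \<ominus> rho g x) b \<in> I (Suc n)" by (rule filtD[OF rho_spec(2)[OF g x m] b])
    from pq_nthD[OF this, of 0] have "pW ^ Suc n dvd - fps_nth (crd (rho g x \<ominus> x) b) 0"
      using x gx b by (simp add: crd_simps pow)
    thus "pW ^ n dvd fps_nth (crd (rho g x \<ominus> x) b) 0"
      unfolding dvd_minus_iff by (rule power_le_dvd) simp
  qed
  thus "\<exists>y\<in>carrier M. rho g x \<ominus> x = fps_X \<odot> y"
    using X_divisible_iff[of "rho g x \<ominus> x"] x gx by simp
qed

lemma associated_nabla_rho: "associated_nabla (M, rho) = D"
proof (rule extensionalityI[OF _ D_extensional])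
  show "associated_nabla (M, rho) \<in> extensional (carrier M)" by (simp add: associated_nabla_def)
  fix x assume x: "x \<in> carrier M"
  have eq: "rho \<gamma> x \<ominus> x = qq \<odot> D x"
    using x by (intro crd_eqI) (auto simp: rho_gamma crd_gamma_M crd_simps)
  show "associated_nabla (M, rho) x = D x"
    unfolding associated_nabla_def case_prod_conv restrict_apply'[OF x] eq
    using x smult_cancel[OF qq_neq_0] by (intro the_equality) auto
qed

end

section \<open>From \<open>\<Gamma>\<close>-modules to \<open>\<nabla>\<close>-modules\<close>

locale gamma_free = free_module TYPE_k M B crd
  for TYPE_k :: "'k::field_prime_char itself"
    and M :: "('k witt fps, 'm) module" (structure)
    and B :: "'b set" and crd :: "'m \<Rightarrow> 'b \<Rightarrow> 'k witt fps" +
  fixes \<rho> :: "('k frac_closure \<Rightarrow> 'k frac_closure) \<Rightarrow> 'm \<Rightarrow> 'm"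
  assumes gamma_module: "is_gamma_module (M, \<rho>)"
    and trivial: "trivial_mod_q_minus_1 (M, \<rho>)"
begin

abbreviation \<Gamma> :: "('k frac_closure \<Rightarrow> 'k frac_closure) set" where "\<Gamma> \<equiv> carrier Gamma_group"

lemma \<rho>_extensional: "\<rho> \<in> \<Gamma> \<rightarrow>\<^sub>E (carrier M \<rightarrow>\<^sub>E carrier M)"
  and \<rho>_one: "x \<in> carrier M \<Longrightarrow> \<rho> (\<lambda>x\<in>Kinf. x) x = x"
  and \<rho>_compose: "g \<in> \<Gamma> \<Longrightarrow> h \<in> \<Gamma> \<Longrightarrow> x \<in> carrier M \<Longrightarrow> \<rho> (compose Kinf g h) x = \<rho> g (\<rho> h x)"
  and \<rho>_add: "g \<in> \<Gamma> \<Longrightarrow> x \<in> carrier M \<Longrightarrow> y \<in> carrier M \<Longrightarrow> \<rho> g (x \<oplus> y) = \<rho> g x \<oplus> \<rho> g y"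
  and \<rho>_smult: "g \<in> \<Gamma> \<Longrightarrow> x \<in> carrier M \<Longrightarrow> \<rho> g (r \<odot> x) = Gamma_act g r \<odot> \<rho> g x"
  and \<rho>_continuous: "continuous_map (prod_topology Gamma_topology (pq_adic_topology M)) (pq_adic_topology M)
     (\<lambda>(g, x). \<rho> g x)"
  using gamma_module unfolding is_gamma_module_def case_prod_conv mult_Gamma one_Gamma by simp_all

lemma \<rho>_closed: "g \<in> \<Gamma> \<Longrightarrow> x \<in> carrier M \<Longrightarrow> \<rho> g x \<in> carrier M"
  using \<rho>_extensional by (auto simp: PiE_iff)

lemma \<rho>_gamma_closed [simp]: "x \<in> carrier M \<Longrightarrow> \<rho> \<gamma> x \<in> carrier M"
  by (rule \<rho>_closed[OF gamma_in_Gamma])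

text \<open>Continuity is applied to the orbit map of a fixed \<open>x\<close>, which makes the
  action of \<open>g\<close> a limit of actions of powers of \<gamma>.\<close>

lemma \<rho>_approx:
  assumes g: "g \<in> \<Gamma>" and x: "x \<in> carrier M"
  shows "\<exists>N. \<forall>k\<ge>N. \<forall>m. approx g k m \<longrightarrow> \<rho> (gamma_pow m) x \<ominus> \<rho> g x \<in> filt n"
proof -
  define U where "U = {h \<in> \<Gamma>. \<rho> h x \<in> nbhd (\<rho> g x) n}"
  have "continuous_map Gamma_topology (prod_topology Gamma_topology (pq_adic_topology M)) (\<lambda>h. (h, x))"
    using x by (intro continuous_map_pairedI) (auto simp: topspace_pq_adic)
  from continuous_map_compose[OF this \<rho>_continuous]
  have "continuous_map Gamma_topology (pq_adic_topology M) (\<lambda>h. \<rho> h x)"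
    by (simp add: comp_def)
  from openin_continuous_map_preimage[OF this openin_nbhd[OF \<rho>_closed[OF g x]]]
  have "openin Gamma_topology U" by (simp only: U_def topspace_Gamma)
  moreover have "g \<in> U" using g nbhd_self[OF \<rho>_closed[OF g x]] by (simp add: U_def)
  ultimately obtain N where "\<forall>k\<ge>N. \<forall>m. approx g k m \<longrightarrow> gamma_pow m \<in> U"
    using Gamma_neighbourhood by blast
  thus ?thesis by (intro exI[of _ N]) (auto simp: U_def nbhd_def)
qed

abbreviation nabla_M :: "'m \<Rightarrow> 'm" where "nabla_M \<equiv> associated_nabla (M, \<rho>)"

lemma nabla_exists:
  assumes x: "x \<in> carrier M"
  shows "\<exists>y\<in>carrier M. qq \<odot> y = \<rho> \<gamma> x \<ominus> x"
proof -
  obtain y where y: "y \<in> carrier M" "\<rho> \<gamma> x \<ominus> x = fps_X \<odot> y"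
    using trivial x gamma_in_Gamma unfolding trivial_mod_q_minus_1_def qvar_minus_1 by auto
  obtain v :: "'k witt fps" where v: "qvar * v = 1" using qvar_unit by blast
  \<comment> \<open>Triviality gives divisibility by \<open>q - 1\<close>; the unit \<open>q\<close>
    supplies the remaining factor.\<close>
  have "qq * v = fps_X" unfolding qq_eq using v by (simp add: mult_ac)
  hence "qq \<odot> (v \<odot> y) = \<rho> \<gamma> x \<ominus> x"
    unfolding y(2) using y(1) by (intro crd_eqI) (auto simp: crd_smult mult.assoc[symmetric])
  thus ?thesis using y(1) by (intro bexI[of _ "v \<odot> y"]) auto
qed

lemma nabla_eqI:
  assumes "x \<in> carrier M" "y \<in> carrier M" "qq \<odot> y = \<rho> \<gamma> x \<ominus> x"
  shows "nabla_M x = y"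
  unfolding associated_nabla_def case_prod_conv restrict_apply'[OF assms(1)] assms(3)[symmetric]
  using assms(2) smult_cancel[OF qq_neq_0] by (intro the_equality) auto

lemma nabla_spec:
  assumes "x \<in> carrier M"
  shows "nabla_M x \<in> carrier M" "qq \<odot> nabla_M x = \<rho> \<gamma> x \<ominus> x"
  using nabla_exists[OF assms] nabla_eqI[OF assms] by auto

lemma crd_nabla:
  assumes "x \<in> carrier M" "b \<in> B"
  shows "crd (\<rho> \<gamma> x) b = crd x b + qq * crd (nabla_M x) b"
proof -
  have "crd (qq \<odot> nabla_M x) b = crd (\<rho> \<gamma> x \<ominus> x) b" by (simp only: nabla_spec[OF assms(1)])
  thus ?thesis using assms nabla_spec(1)[OF assms(1)] \<rho>_gamma_closed[OF assms(1)]
    by (simp only: crd_simps) (simp add: algebra_simps)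
qed

lemma is_nabla_module_nabla: "is_nabla_module (M, nabla_M)"
  unfolding is_nabla_module_def case_prod_conv
proof (intro conjI ballI allI)
  show "Module.module R_ring M" by (rule module_M)
  show "nabla_M \<in> carrier M \<rightarrow>\<^sub>E carrier M"
    using nabla_spec(1) by (auto simp: PiE_iff associated_nabla_def)
  note g = gamma_in_Gamma
  fix x assume x: "x \<in> carrier M"
  note Dx = nabla_spec(1)[OF x]
  show "nabla_M (x \<oplus> y) = nabla_M x \<oplus> nabla_M y" if y: "y \<in> carrier M" for y
    using x y Dx nabla_spec(1)[OF y]
    by (intro nabla_eqI crd_eqI) (auto simp: crd_simps \<rho>_add[OF g] crd_nabla distrib_left)
  show "nabla_M (fps_const w \<odot> x) = fps_const w \<odot> nabla_M x" for w
    using x Dx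
    by (intro nabla_eqI crd_eqI)
       (auto simp: crd_simps \<rho>_smult[OF g] Gamma_act_gamma gamma_R_const crd_nabla distrib_left mult.left_commute)
  have gamma_R_qvar: "gamma_R qvar = qvar ^ (CHAR('k) + 1)"
  proof -
    have "gamma_R (1 + fps_X) = 1 + gamma_R fps_X" unfolding gamma_R_add by (simp add: gamma_R_def)
    thus ?thesis by (simp add: gamma_R_X flip: qvar_def)
  qed
  have *: "k * (a * c + Q * d) = Q * (c + k * d) - q * c" if "k * a = Q - q"
    for q c k a Q d :: "'k witt fps"
  proof -
    have "k * (a * c + Q * d) = (k * a) * c + Q * (k * d)"
      by (simp add: algebra_simps)
    thus ?thesis unfolding that by (simp add: algebra_simps)
  qed
  show "nabla_M (qvar \<odot> x) = q_analog_p \<odot> x \<oplus> qvar ^ (CHAR('k) + 1) \<odot> nabla_M x"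
  proof (intro nabla_eqI crd_eqI)
    fix b assume b: "b \<in> B"
    show "crd (qq \<odot> (q_analog_p \<odot> x \<oplus> qvar ^ (CHAR('k) + 1) \<odot> nabla_M x)) b = crd (\<rho> \<gamma> (qvar \<odot> x) \<ominus> qvar \<odot> x) b"
      using x Dx b *[OF qq_q_analog, of "crd x b" "crd (nabla_M x) b"] \<rho>_gamma_closed[OF x]
      by (simp only: crd_simps \<rho>_smult[OF g] Gamma_act_gamma gamma_R_qvar crd_nabla smult_closed
          Mod.a_closed Mod.minus_closed)
  qed (use x Dx in auto)
qed

end

section \<open>Morphisms\<close>

lemma linear_mapD:
  assumes "linear_map M N f"
  shows "f \<in> carrier M \<rightarrow>\<^sub>E carrier N"
    and "x \<in> carrier M \<Longrightarrow> f x \<in> carrier N"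
    and "x \<in> carrier M \<Longrightarrow> y \<in> carrier M \<Longrightarrow> f (x \<oplus>\<^bsub>M\<^esub> y) = f x \<oplus>\<^bsub>N\<^esub> f y"
    and "x \<in> carrier M \<Longrightarrow> f (r \<odot>\<^bsub>M\<^esub> x) = r \<odot>\<^bsub>N\<^esub> f x"
  using assms unfolding linear_map_def by (auto simp: PiE_iff)

context perfect_char
begin

lemma linear_map_minus:
  fixes M N :: "('k witt fps, 'm) module"
  assumes M: "free_module M BM cM" and N: "free_module N BN cN" and f: "linear_map M N f"
    and x: "x \<in> carrier M" and y: "y \<in> carrier M"
  shows "f (x \<ominus>\<^bsub>M\<^esub> y) = f x \<ominus>\<^bsub>N\<^esub> f y"
proof -
  interpret M: free_module TYPE_k M BM cM by (rule M)
  interpret N: free_module TYPE_k N BN cN by (rule N)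
  have eq: "x = (x \<ominus>\<^bsub>M\<^esub> y) \<oplus>\<^bsub>M\<^esub> y"
    using x y by (intro M.crd_eqI) (auto simp: M.crd_simps)
  have "f x = f (x \<ominus>\<^bsub>M\<^esub> y) \<oplus>\<^bsub>N\<^esub> f y"
    using linear_mapD(3)[OF f, of "x \<ominus>\<^bsub>M\<^esub> y" y] x y eq by simp
  moreover have "f (x \<ominus>\<^bsub>M\<^esub> y) \<in> carrier N" "f y \<in> carrier N"
    using linear_mapD(2)[OF f] x y by auto
  ultimately show ?thesis by (intro N.crd_eqI) (auto simp: N.crd_simps)
qed

text \<open>Linear maps are continuous, in the form required for passing to limits.\<close>

lemma linear_map_filt:
  fixes M N :: "('k witt fps, 'm) module"
  assumes M: "free_module M BM cM" and N: "free_module N BN cN" and f: "linear_map M N f"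
    and x: "x \<in> pq_filtration M n"
  shows "f x \<in> pq_filtration N n"
proof -
  interpret M: free_module TYPE_k M BM cM by (rule M)
  interpret N: free_module TYPE_k N BN cN by (rule N)
  show ?thesis using x
  proof (induction n arbitrary: x)
    case 0
    thus ?case using linear_mapD(2)[OF f] by simp
  next
    case (Suc n)
    then obtain a b where ab: "x = of_nat CHAR('k) \<odot>\<^bsub>M\<^esub> a \<oplus>\<^bsub>M\<^esub> (qvar - 1) \<odot>\<^bsub>M\<^esub> b"
      "a \<in> pq_filtration M n" "b \<in> pq_filtration M n" by auto
    have "a \<in> carrier M" "b \<in> carrier M"
      using ab(2,3) unfolding M.pq_filtration_eq by (auto intro: M.filt_carrier)
    hence "f x = of_nat CHAR('k) \<odot>\<^bsub>N\<^esub> f a \<oplus>\<^bsub>N\<^esub> (qvar - 1) \<odot>\<^bsub>N\<^esub> f b"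
      using linear_mapD(3,4)[OF f] by (simp add: ab(1))
    thus ?case using Suc.IH[OF ab(2)] Suc.IH[OF ab(3)] by auto
  qed
qed

text \<open>Commuting with the nabla-operators is commuting with \<gamma>, as
  \<open>q\<^sup>2 - q\<close> can be cancelled; powers of \<gamma> and continuity then give all of
  the group. The identity map between two structures on one module yields injectivity on
  objects.\<close>

lemma equivariant_iff:
  fixes M N :: "('k witt fps, 'm) module"
  assumes M: "gamma_free M BM cM \<rho>" and N: "gamma_free N BN cN \<sigma>" and f: "linear_map M N f"
  shows "(\<forall>g\<in>carrier Gamma_group. \<forall>x\<in>carrier M. f (\<rho> g x) = \<sigma> g (f x)) \<longleftrightarrow>
    (\<forall>x\<in>carrier M. f (associated_nabla (M, \<rho>) x) = associated_nabla (N, \<sigma>) (f x))"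
proof -
  interpret M: gamma_free TYPE_k M BM cM \<rho> by (rule M)
  interpret N: gamma_free TYPE_k N BN cN \<sigma> by (rule N)
  note lin = linear_mapD[OF f]
  note f_minus = linear_map_minus[OF M.free_module_axioms N.free_module_axioms f]
  have gamma_iff: "f (\<rho> \<gamma> x) = \<sigma> \<gamma> (f x) \<longleftrightarrow> f (associated_nabla (M, \<rho>) x) = associated_nabla (N, \<sigma>) (f x)"
    if x: "x \<in> carrier M" for x
  proof -
    note fx = lin(2)[OF x]
    have eq: "qq \<odot>\<^bsub>N\<^esub> f (associated_nabla (M, \<rho>) x) = f (\<rho> \<gamma> x) \<ominus>\<^bsub>N\<^esub> f x"
      using M.nabla_spec[OF x] x lin(4) f_minus M.\<rho>_gamma_closed by metis
    show ?thesis
    proof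
      assume "f (\<rho> \<gamma> x) = \<sigma> \<gamma> (f x)"
      hence "qq \<odot>\<^bsub>N\<^esub> f (associated_nabla (M, \<rho>) x) = \<sigma> \<gamma> (f x) \<ominus>\<^bsub>N\<^esub> f x" using eq by simp
      from N.nabla_eqI[OF fx lin(2)[OF M.nabla_spec(1)[OF x]] this]
      show "f (associated_nabla (M, \<rho>) x) = associated_nabla (N, \<sigma>) (f x)" ..
    next
      assume "f (associated_nabla (M, \<rho>) x) = associated_nabla (N, \<sigma>) (f x)"
      hence eq': "f (\<rho> \<gamma> x) \<ominus>\<^bsub>N\<^esub> f x = \<sigma> \<gamma> (f x) \<ominus>\<^bsub>N\<^esub> f x" using eq N.nabla_spec(2)[OF fx] by simp
      note c = lin(2)[OF M.\<rho>_gamma_closed[OF x]] N.\<rho>_gamma_closed[OF fx]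
      show "f (\<rho> \<gamma> x) = \<sigma> \<gamma> (f x)"
      proof (rule N.crd_eqI[OF c])
        fix b assume "b \<in> BN"
        thus "cN (f (\<rho> \<gamma> x)) b = cN (\<sigma> \<gamma> (f x)) b"
          using arg_cong[OF eq', of "\<lambda>x. cN x b"] c fx by (simp add: N.crd_minus)
      qed
    qed
  qed
  have "f (\<rho> g x) = \<sigma> g (f x)"
    if comm: "\<forall>x\<in>carrier M. f (\<rho> \<gamma> x) = \<sigma> \<gamma> (f x)" and g: "g \<in> carrier Gamma_group" and x: "x \<in> carrier M"
    for g x
  proof -
    note fx = lin(2)[OF x] and gx = M.\<rho>_closed[OF g x]
    note c = lin(2)[OF gx] N.\<rho>_closed[OF g fx]
    have gamma_pow: "f (\<rho> (gamma_pow m) x) = \<sigma> (gamma_pow m) (f x)" for m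
    proof (induction m)
      case 0
      show ?case using x fx by (simp only: gamma_pow.simps M.\<rho>_one N.\<rho>_one)
    next
      case (Suc m)
      note mx = M.\<rho>_closed[OF gamma_pow_in_Gamma x, of m]
      have "f (\<rho> (gamma_pow (Suc m)) x) = f (\<rho> \<gamma> (\<rho> (gamma_pow m) x))"
        by (simp only: gamma_pow.simps M.\<rho>_compose[OF gamma_in_Gamma gamma_pow_in_Gamma x])
      also have "\<dots> = \<sigma> \<gamma> (\<sigma> (gamma_pow m) (f x))" using comm mx Suc by simp
      also have "\<dots> = \<sigma> (gamma_pow (Suc m)) (f x)"
        by (simp only: gamma_pow.simps N.\<rho>_compose[OF gamma_in_Gamma gamma_pow_in_Gamma fx])
      finally show ?case .
    qed
    show ?thesis
    proof (rule N.filt_separated[OF _ c])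
      fix n
      obtain K where K: "\<forall>k\<ge>K. \<forall>m. approx g k m \<longrightarrow> \<rho> (gamma_pow m) x \<ominus>\<^bsub>M\<^esub> \<rho> g x \<in> M.filt n"
        using M.\<rho>_approx[OF g x] by blast
      obtain K' where K': "\<forall>k\<ge>K'. \<forall>m. approx g k m \<longrightarrow> \<sigma> (gamma_pow m) (f x) \<ominus>\<^bsub>N\<^esub> \<sigma> g (f x) \<in> N.filt n"
        using N.\<rho>_approx[OF g fx] by blast
      \<comment> \<open>A single exponent has to serve the approximations in both modules.\<close>
      obtain m where m: "approx g (max K K') m" using Gamma_approx[OF g] by blast
      have 1: "\<rho> (gamma_pow m) x \<ominus>\<^bsub>M\<^esub> \<rho> g x \<in> pq_filtration M n"
        unfolding M.pq_filtration_eq using K m max.cobounded1 by blast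
      have 2: "\<sigma> (gamma_pow m) (f x) \<ominus>\<^bsub>N\<^esub> \<sigma> g (f x) \<in> N.filt n"
        using K' m max.cobounded2 by blast
      have "f (\<rho> (gamma_pow m) x) \<ominus>\<^bsub>N\<^esub> f (\<rho> g x) \<in> N.filt n"
        using linear_map_filt[OF M.free_module_axioms N.free_module_axioms f 1]
        unfolding N.pq_filtration_eq f_minus[OF M.\<rho>_closed[OF gamma_pow_in_Gamma x] gx] .
      hence 3: "\<sigma> (gamma_pow m) (f x) \<ominus>\<^bsub>N\<^esub> f (\<rho> g x) \<in> N.filt n" unfolding gamma_pow .
      note mc = N.\<rho>_closed[OF gamma_pow_in_Gamma fx, of m]
      show "f (\<rho> g x) \<ominus>\<^bsub>N\<^esub> \<sigma> g (f x) \<in> N.filt n"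
        by (rule N.filt_trans[OF N.filt_sym[OF 3 mc c(1)] 2 c(1) mc c(2)])
    qed
  qed
  thus ?thesis using gamma_iff gamma_in_Gamma by blast
qed

end

section \<open>The isomorphism of categories\<close>

text \<open>The functor is the identity on morphisms, so an inverse on objects is automatically
  functorial once the morphism sets coincide.\<close>

lemma cat_isomorphismI:
  assumes C: "category C" and D: "category D" and bij: "bij_betw F (Objs C) (Objs D)"
    and Homs: "\<And>a b. a \<in> Objs C \<Longrightarrow> b \<in> Objs C \<Longrightarrow> Homs D (F a) (F b) = Homs C a b"
    and Comp: "\<And>a b c. Comp D (F a) (F b) (F c) = Comp C a b c"
    and Idn: "\<And>a. Idn D (F a) = Idn C a"
  shows "cat_isomorphism C D F (\<lambda>_ _ f. f)"
proof -
  define H where "H = inv_into (Objs C) F"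
  have FH: "F (H a) = a" "H a \<in> Objs C" if "a \<in> Objs D" for a
    using that bij unfolding H_def bij_betw_def by (auto simp: f_inv_into_f inv_into_into)
  have HF: "H (F a) = a" "F a \<in> Objs D" if "a \<in> Objs C" for a
    using that bij unfolding H_def bij_betw_def by auto
  have 1: "cat_functor C D F (\<lambda>_ _ f. f)"
    unfolding cat_functor_def using C D HF by (simp add: Homs Comp Idn)
  have HH: "Homs C (H a) (H b) = Homs D a b" if "a \<in> Objs D" "b \<in> Objs D" for a b
    using Homs[of "H a" "H b"] FH that by simp
  have HC: "Comp C (H a) (H b) (H c) = Comp D a b c" if "a \<in> Objs D" "b \<in> Objs D" "c \<in> Objs D" for a b c
    using Comp[of "H a" "H b" "H c"] FH that by simp
  have HI: "Idn C (H a) = Idn D a" if "a \<in> Objs D" for a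
    using Idn[of "H a"] FH that by simp
  have 2: "cat_functor D C H (\<lambda>_ _ f. f)"
    unfolding cat_functor_def using C D FH by (simp add: HH HC HI)
  show ?thesis unfolding cat_isomorphism_def
    using 1 2 FH HF by (intro conjI exI[of _ H] exI[of _ "\<lambda>_ _ f. f"]) auto
qed

lemma linear_map_id:
  assumes "Module.module R_ring M"
  shows "linear_map M M (\<lambda>x\<in>carrier M. x)"
proof -
  interpret Module.module R_ring M by (rule assms)
  have "r \<odot>\<^bsub>M\<^esub> x \<in> carrier M" if "x \<in> carrier M" for r x
    using smult_closed[of r x] that by simp
  thus ?thesis unfolding linear_map_def by auto
qed

lemma linear_map_compose:
  assumes "Module.module R_ring M" "linear_map M N f" "linear_map N L g"
  shows "linear_map M L (compose (carrier M) g f)"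
proof -
  interpret Module.module R_ring M by (rule assms(1))
  have "r \<odot>\<^bsub>M\<^esub> x \<in> carrier M" if "x \<in> carrier M" for r x
    using smult_closed[of r x] that by simp
  thus ?thesis using linear_mapD[OF assms(2)] linear_mapD[OF assms(3)]
    unfolding linear_map_def by (auto simp: compose_def)
qed

lemma compose_linear_map_id:
  assumes "linear_map M N f"
  shows "compose (carrier M) f (\<lambda>x\<in>carrier M. x) = f"
    and "compose (carrier M) (\<lambda>x\<in>carrier N. x) f = f"
  using linear_mapD(1,2)[OF assms]
  by (auto simp: compose_def fun_eq_iff PiE_iff extensional_def)

lemma compose_linear_map_assoc:
  assumes "linear_map M N f"
  shows "compose (carrier M) h (compose (carrier M) g f) = compose (carrier M) (compose (carrier N) h g) f"
  using linear_mapD(2)[OF assms] by (auto simp: compose_def fun_eq_iff)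

lemma category_Gamma: "category Gamma_category"
proof -
  have mod: "Module.module R_ring M" if "is_gamma_module (M, \<rho>)" for M :: "('k::field_prime_char witt fps, 'm) module" and \<rho>
    using that by (simp add: is_gamma_module_def)
  have closed: "\<rho> g x \<in> carrier M" if "is_gamma_module (M, \<rho>)" "g \<in> carrier Gamma_group" "x \<in> carrier M"
    for M :: "('k::field_prime_char witt fps, 'm) module" and \<rho> g x
    using that by (auto simp: is_gamma_module_def PiE_iff)
  show ?thesis
    unfolding category_def Gamma_category_def
    by (auto simp: linear_map_id linear_map_compose compose_linear_map_id compose_linear_map_assoc
        mod closed compose_eq linear_mapD(2))
qed

lemma category_nabla: "category nabla_category"
proof -
  have mod: "Module.module R_ring M" if "is_nabla_module (M, D)" for M :: "('k::field_prime_char witt fps, 'm) module" and D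
    using that by (simp add: is_nabla_module_def)
  have closed: "D x \<in> carrier M" if "is_nabla_module (M, D)" "x \<in> carrier M"
    for M :: "('k::field_prime_char witt fps, 'm) module" and D x
    using that by (auto simp: is_nabla_module_def PiE_iff)
  show ?thesis
    unfolding category_def nabla_category_def
    by (auto simp: linear_map_id linear_map_compose compose_linear_map_id compose_linear_map_assoc
        mod closed compose_eq linear_mapD(2))
qed

theorem proposition7p14:
  assumes perfect: "surj (\<lambda>x :: 'k::field_prime_char. x ^ CHAR('k))"
  shows "cat_isomorphism
    (Gamma_category :: (('k, 'm) gamma_structure, 'm \<Rightarrow> 'm) cat)
    (nabla_category :: (('k, 'm) nabla_structure, 'm \<Rightarrow> 'm) cat)
    (\<lambda>(M, \<rho>). (M, associated_nabla (M, \<rho>)))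
    (\<lambda>_ _ f. f)"
proof (rule cat_isomorphismI[OF category_Gamma category_nabla])
  interpret perfect_char "TYPE('k)" by unfold_locales (rule perfect)
  let ?C = "Gamma_category :: (('k, 'm) gamma_structure, 'm \<Rightarrow> 'm) cat"
  let ?D = "nabla_category :: (('k, 'm) nabla_structure, 'm \<Rightarrow> 'm) cat"
  let ?F = "\<lambda>(M, \<rho>). (M, associated_nabla (M, \<rho>))
    :: ('k, 'm) nabla_structure"
  have objC: "(M, \<rho>) \<in> Objs ?C \<longleftrightarrow> is_gamma_module (M, \<rho>) \<and> finite_free M \<and>
      trivial_mod_q_minus_1 (M, \<rho>) \<and> weakly_nilpotent (M, associated_nabla (M, \<rho>))" for M \<rho>
    by (simp add: Gamma_category_def)
  have objD: "(M, D) \<in> Objs ?D \<longleftrightarrow> is_nabla_module (M, D) \<and> finite_free M \<and> weakly_nilpotent (M, D)" for M D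
    by (simp add: nabla_category_def)
  have coords: "\<exists>B crd. gamma_free M (B :: 'm set) crd \<rho>" if obj: "(M, \<rho>) \<in> Objs ?C" for M \<rho>
  proof -
    from obj have "finite_free M" by (simp add: objC)
    then obtain B :: "'m set" and crd where "free_module M B crd" by (rule finite_free_coordinates)
    hence "gamma_free M B crd \<rho>"
      using obj by (intro gamma_free.intro gamma_free_axioms.intro) (simp_all add: objC)
    thus ?thesis by blast
  qed
  have equivariant: "(\<forall>g\<in>carrier Gamma_group. \<forall>x\<in>carrier M. f (\<rho> g x) = \<sigma> g (f x)) \<longleftrightarrow>
      (\<forall>x\<in>carrier M. f (associated_nabla (M, \<rho>) x) = associated_nabla (N, \<sigma>) (f x))"
    if obj: "(M, \<rho>) \<in> Objs ?C" "(N, \<sigma>) \<in> Objs ?C" and f: "linear_map M N f" for M \<rho> N \<sigma> f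
  proof -
    obtain BM :: "'m set" and cM where M: "gamma_free M BM cM \<rho>" using coords[OF obj(1)] by blast
    obtain BN :: "'m set" and cN where N: "gamma_free N BN cN \<sigma>" using coords[OF obj(2)] by blast
    show ?thesis by (rule equivariant_iff[OF M N f])
  qed
  show "bij_betw ?F (Objs ?C) (Objs ?D)"
  proof (rule bij_betw_imageI)
    show "inj_on ?F (Objs ?C)"
    proof (rule inj_onI)
      fix a b assume *: "a \<in> Objs ?C" "b \<in> Objs ?C" "?F a = ?F b"
      obtain M \<rho> \<sigma> where ab: "a = (M, \<rho>)" "b = (M, \<sigma>)"
        using *(3) by (cases a, cases b) simp
      have obj: "(M, \<rho>) \<in> Objs ?C" "(M, \<sigma>) \<in> Objs ?C"
        and eq: "associated_nabla (M, \<rho>) = associated_nabla (M, \<sigma>)"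
        using * by (simp_all add: ab)
      obtain B :: "'m set" and crd where "gamma_free M B crd \<rho>" using coords[OF obj(1)] by blast
      then interpret M: gamma_free "TYPE('k)" M B crd \<rho> .
      obtain B' :: "'m set" and crd' where "gamma_free M B' crd' \<sigma>" using coords[OF obj(2)] by blast
      then interpret M': gamma_free "TYPE('k)" M B' crd' \<sigma> .
      \<comment> \<open>Equivariance of the identity from one action to the other says that the two
        actions are equal.\<close>
      define f where "f = (\<lambda>x\<in>carrier M. x)"
      have f: "linear_map M M f" unfolding f_def by (rule linear_map_id[OF M.module_M])
      have "f (associated_nabla (M, \<rho>) x) = associated_nabla (M, \<sigma>) (f x)" if "x \<in> carrier M" for x
        using that M.nabla_spec(1)[OF that] eq by (simp add: f_def)
      hence comm: "f (\<rho> g x) = \<sigma> g (f x)" if "g \<in> carrier Gamma_group" "x \<in> carrier M" for g x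
        using equivariant[OF obj f] that by blast
      have "\<rho> = \<sigma>"
      proof (rule PiE_ext[OF M.\<rho>_extensional M'.\<rho>_extensional])
        fix g :: "'k frac_closure \<Rightarrow> 'k frac_closure" assume g: "g \<in> carrier Gamma_group"
        show "\<rho> g = \<sigma> g"
        proof (rule PiE_ext)
          show "\<rho> g \<in> carrier M \<rightarrow>\<^sub>E carrier M" using M.\<rho>_extensional g by (rule PiE_mem)
          show "\<sigma> g \<in> carrier M \<rightarrow>\<^sub>E carrier M" using M'.\<rho>_extensional g by (rule PiE_mem)
          show "\<rho> g x = \<sigma> g x" if "x \<in> carrier M" for x
            using comm[OF g that] that M.\<rho>_closed[OF g that] by (simp add: f_def)
        qed
      qed
      thus "a = b" by (simp add: ab)
    qed
    show "?F ` Objs ?C = Objs ?D"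
    proof (intro subset_antisym subsetI)
      fix a assume "a \<in> ?F ` Objs ?C"
      then obtain M \<rho> where a: "a = (M, associated_nabla (M, \<rho>))" and obj: "(M, \<rho>) \<in> Objs ?C" by auto
      obtain B :: "'m set" and crd where "gamma_free M B crd \<rho>" using coords[OF obj] by blast
      then interpret M: gamma_free "TYPE('k)" M B crd \<rho> .
      show "a \<in> Objs ?D" using obj M.is_nabla_module_nabla by (simp add: a objC objD)
    next
      fix a assume "a \<in> Objs ?D"
      then obtain M D where a: "a = (M, D)" and obj: "is_nabla_module (M, D)" "finite_free M" "weakly_nilpotent (M, D)"
        by (cases a) (auto simp: objD)
      obtain B :: "'m set" and crd where B: "free_module M B crd"
        by (rule finite_free_coordinates[OF obj(2)])
      interpret M: nabla_free "TYPE('k)" M B crd D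
        using B obj(1) by (intro nabla_free.intro nabla_free_axioms.intro)
      have "(M, M.rho) \<in> Objs ?C"
        using M.is_gamma_module_rho M.trivial_rho obj by (simp add: objC M.associated_nabla_rho)
      thus "a \<in> ?F ` Objs ?C"
        by (rule rev_image_eqI) (simp add: a M.associated_nabla_rho)
    qed
  qed
  show "Homs ?D (?F a) (?F b) = Homs ?C a b" if "a \<in> Objs ?C" "b \<in> Objs ?C" for a b
  proof -
    obtain M \<rho> N \<sigma> where ab: "a = (M, \<rho>)" "b = (N, \<sigma>)" by (cases a, cases b)
    show ?thesis
      using equivariant[of M \<rho> N \<sigma>] that unfolding ab
      by (auto simp: Gamma_category_def nabla_category_def)
  qed
qed (auto simp: Gamma_category_def nabla_category_def split: prod.splits)

end
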